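(* Let $(M,F)$ be an $n$-dimensional Finsler manifold of scalar flag curvature $\mathbf{K}=\mathbf{K}(x,y)$ and of weakly isotropic $S$-curvature. Then $F$ has almost isotropic $S$-curvature if and only if the flag curvature is weakly isotropic and satisfies $$\mathbf{K}=\frac{3}{n^2-1}(\pi^*dc)(\mathbf{G})+\pi^*\sigma$$ for some functions $c,\sigma\in C^\infty(M)$; here $c$ is the Berwald scalar curvature $\mathsf{e}$ up to a constant (i.e. $\pi^*c-\mathsf{e}$ is constant on each connected component).
   Context: Indices: $i,j,k,l,p,q$ run over $1,\dots,n$; $\alpha,\beta,\gamma,\mu$ run over $1,\dots,n-1$; $\bar\alpha:=n+\alpha$; repeated indices are summed; $n\ge 2$. Finsler setup. $F:TM\to[0,\infty)$ is continuous, smooth on $TM\setminus 0$, positively $1$-homogeneous in $y$, and $g_{ij}=\frac12[F^2]_{y^iy^j}$ is positive definite on $TM\setminus0$. $SM=\{(x,y)\in TM: F(x,y)=1\}$ with projection $\pi:SM\to M$; objects on $TM\setminus 0$ that are $0$-homogeneous in $y$ are regarded as objects on $SM$. Spray coefficients $G^i=\frac14 g^{il}([F^2]_{x^ky^l}y^k-[F^2]_{x^l})$, $N^i_k=\partial G^i/\partial y^k$, $\frac{\delta}{\delta x^i}=\frac{\partial}{\partial x^i}-N^k_i\frac{\partial}{\partial y^k}$, $\delta y^i=dy^i+N^i_kdx^k$. A local adapted frame of $T(SM)$ is $\mathbf{e}_i=u_i^j\frac{\delta}{\delta x^j}$, $\mathbf{e}_{\bar\alpha}=-u_\alpha^jF\frac{\partial}{\partial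 y^j}$, where $g_{kl}u^k_iu^l_j=\delta_{ij}$ and $u_n^i=y^i/F$; its dual coframe is $\omega^i,\omega^{\bar\alpha}$. Thus $\mathbf{e}_n=\mathbf{G}=\frac{y^i}{F}\frac{\delta}{\delta x^i}$ is the Reeb field. Flag curvature. The Riemann curvature is $R^i_{\ k}=2\frac{\partial G^i}{\partial x^k}-y^j\frac{\partial^2G^i}{\partial x^j\partial y^k}+2G^j\frac{\partial^2G^i}{\partial y^j\partial y^k}-\frac{\partial G^i}{\partial y^j}\frac{\partial G^j}{\partial y^k}$. $F$ is of scalar flag curvature $\mathbf{K}=\mathbf{K}(x,y)$ if $R^i_{\ k}=\mathbf{K}\,(F^2\delta^i_k-FF_{y^k}y^i)$, i.e. the flag curvature is independent of the choice of flag containing $y$; $\mathbf{K}$ is then a function on $SM$. The flag curvature is called weakly isotropic if $\mathbf{K}=\frac{3}{n^2-1}(\pi^*dc)(\mathbf{G})+\pi^*\sigma$ for some $c,\sigma\in C^\infty(M)$. Berwald scalar curvature. The Berwald connection has, in natural coordinates, connection forms $\tilde\omega^i_j=\frac{\partial^2G^i}{\partial y^j\partial y^k}dx^k$; in the adapted frame its curvature forms are $\tilde\Omega^i_j=d\tilde\omega^i_j-\tilde\omega^k_j\wedge\tilde\omega^i_k=\frac12\tilde R^{~i}_{j~kl}\omega^k\wedge\omega^l+\tilde P^{~i}_{j~k\gamma}\omega^k\wedge\omega^{\bar\gamma}$. The mean Berwald curvature is $\mathbf{E}=\mathrm{tr}\tilde P=\tilde P^{~i}_{i~\gamma\mu}\omega^\gamma\wedge\omega^{\bar\mu}=:E_{\gamma\mu}\omega^\gamma\wedge\omega^{\bar\mu}$,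 and the Berwald scalar curvature is the function $\mathsf{e}=\mathrm{tr}\,\mathbf{E}=\sum_\gamma E_{\gamma\gamma}$ on $SM$. $S$-curvature. Fix a volume form $dV_M=\sigma_0(x)\,dx^1\wedge\cdots\wedge dx^n$, $\sigma_0>0$, on $M$ (a positive density if $M$ is not orientable). The distortion is $\tau=\ln\frac{\sqrt{\det(g_{ij})}}{\sigma_0(x)}$, and $S:=\mathbf{G}(\tau)$ is a function on $SM$, called the $S$-curvature. $F$ has weakly isotropic $S$-curvature if $S=\frac{1}{n-1}\pi^*b+\pi^*\xi(\mathbf{G})$ for some $b\in C^\infty(M)$ and $\xi\in\Omega^1(M)$; it has almost isotropic $S$-curvature if moreover $d\xi=0$. *)

theory Defs
  imports "HOL-Analysis.Analysis"
begin

section \<open>Smooth maps and exterior calculus in coordinates\<close>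

(* Differentiability is required at every point, so this is the usual C^k only for open S. *)
primrec Ck_on :: "nat \<Rightarrow> 'a::real_normed_vector set \<Rightarrow> ('a \<Rightarrow> 'b::real_normed_vector) \<Rightarrow> bool"
  where
    "Ck_on 0 S f \<longleftrightarrow> continuous_on S f"
  | "Ck_on (Suc k) S f \<longleftrightarrow> (\<forall>x\<in>S. f differentiable (at x)) \<and>
       (\<forall>v. Ck_on k S (\<lambda>x. frechet_derivative f (at x) v))"

definition smooth_on :: "'a::real_normed_vector set \<Rightarrow> ('a \<Rightarrow> 'b::real_normed_vector) \<Rightarrow> bool"
  where "smooth_on S f \<longleftrightarrow> (\<forall>k. Ck_on k S f)"

(* A one-form is a map from points to functionals. The constant vector fields X, Y commute,
   so the bracket term of the exterior derivative is absent. *)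
definition ext_deriv ::
  "('v::real_normed_vector \<Rightarrow> 'v \<Rightarrow> real) \<Rightarrow> 'v \<Rightarrow> 'v \<Rightarrow> 'v \<Rightarrow> real"
  where "ext_deriv w z X Y =
    frechet_derivative (\<lambda>q. w q Y) (at z) X - frechet_derivative (\<lambda>q. w q X) (at z) Y"

definition wedge ::
  "('v \<Rightarrow> 'v \<Rightarrow> real) \<Rightarrow> ('v \<Rightarrow> 'v \<Rightarrow> real) \<Rightarrow> 'v \<Rightarrow> 'v \<Rightarrow> 'v \<Rightarrow> real"
  where "wedge w w' z X Y = w z X * w' z Y - w z Y * w' z X"


section \<open>Smooth manifolds and their tangent bundles\<close>

(* A chart is its domain together with the coordinate map, which is irrelevant off the domain. *)
type_synonym ('a, 'n) chart = "'a set \<times> ('a \<Rightarrow> real^'n)"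

definition chart_img :: "('a, 'n) chart \<Rightarrow> (real^'n) set"
  where "chart_img c = snd c ` fst c"

definition chart_inv :: "('a, 'n) chart \<Rightarrow> real^'n \<Rightarrow> 'a"
  where "chart_inv c = inv_into (fst c) (snd c)"

definition smooth_manifold :: "'a topology \<Rightarrow> ('a, 'n::finite) chart set \<Rightarrow> bool"
  where "smooth_manifold M A \<longleftrightarrow>
    Hausdorff_space M \<and> second_countable M \<and>
    (\<Union>c\<in>A. fst c) = topspace M \<and>
    (\<forall>c\<in>A. openin M (fst c) \<and> open (chart_img c) \<and>
       homeomorphic_map (subtopology M (fst c)) (top_of_set (chart_img c)) (snd c)) \<and>
    (\<forall>c\<in>A. \<forall>d\<in>A. smooth_on (snd c ` (fst c \<inter> fst d)) (snd d \<circ> chart_inv c))"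

definition transition_deriv ::
  "('a, 'n::finite) chart \<Rightarrow> ('a, 'n) chart \<Rightarrow> 'a \<Rightarrow> real^'n \<Rightarrow> real^'n"
  where "transition_deriv c d p = frechet_derivative (snd d \<circ> chart_inv c) (at (snd c p))"

(* A tangent vector at p is the family of its coordinate vectors in the charts around p,
   related by the derivatives of the transition maps. *)
type_synonym ('a, 'n) tvec = "('a, 'n) chart \<Rightarrow> real^'n"

definition tangent_space :: "('a, 'n::finite) chart set \<Rightarrow> 'a \<Rightarrow> ('a, 'n) tvec set"
  where "tangent_space A p = {v.
    (\<forall>c. c \<notin> A \<or> p \<notin> fst c \<longrightarrow> v c = 0) \<and>
    (\<forall>c\<in>A. \<forall>d\<in>A. p \<in> fst c \<inter> fst d \<longrightarrow> v d = transition_deriv c d p (v c))}"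

definition tvec_of :: "('a, 'n::finite) chart set \<Rightarrow> ('a, 'n) chart \<Rightarrow> 'a \<Rightarrow> real^'n \<Rightarrow> ('a, 'n) tvec"
  where "tvec_of A c p y =
    (\<lambda>d. if d \<in> A \<and> p \<in> fst d then transition_deriv c d p y else 0)"

definition tcoords :: "('a, 'n) chart \<Rightarrow> 'a \<Rightarrow> ('a, 'n) tvec \<Rightarrow> (real^'n) \<times> (real^'n)"
  where "tcoords c p v = (snd c p, v c)"

definition in_chart :: "('a, 'n) chart \<Rightarrow> ('a \<Rightarrow> 'b) \<Rightarrow> real^'n \<Rightarrow> 'b"
  where "in_chart c f x = f (chart_inv c x)"

definition in_tchart ::
  "('a, 'n::finite) chart set \<Rightarrow> ('a, 'n) chart \<Rightarrow> ('a \<Rightarrow> ('a, 'n) tvec \<Rightarrow> real)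
     \<Rightarrow> (real^'n) \<times> (real^'n) \<Rightarrow> real"
  where "in_tchart A c h z = h (chart_inv c (fst z)) (tvec_of A c (chart_inv c (fst z)) (snd z))"

definition smooth_function :: "('a, 'n::finite) chart set \<Rightarrow> ('a \<Rightarrow> real) \<Rightarrow> bool"
  where "smooth_function A f \<longleftrightarrow> (\<forall>c\<in>A. smooth_on (chart_img c) (in_chart c f))"

definition one_form_in ::
  "('a, 'n::finite) chart set \<Rightarrow> ('a, 'n) chart \<Rightarrow> ('a \<Rightarrow> ('a, 'n) tvec \<Rightarrow> real)
     \<Rightarrow> real^'n \<Rightarrow> real^'n \<Rightarrow> real"
  where "one_form_in A c \<xi> x X = in_tchart A c \<xi> (x, X)"

definition smooth_one_form ::
  "('a, 'n::finite) chart set \<Rightarrow> ('a \<Rightarrow> ('a, 'n) tvec \<Rightarrow> real) \<Rightarrow> bool"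
  where "smooth_one_form A \<xi> \<longleftrightarrow>
    (\<forall>c\<in>A. (\<forall>x\<in>chart_img c. linear (one_form_in A c \<xi> x)) \<and>
       (\<forall>X. smooth_on (chart_img c) (\<lambda>x. one_form_in A c \<xi> x X)))"

definition closed_one_form ::
  "('a, 'n::finite) chart set \<Rightarrow> ('a \<Rightarrow> ('a, 'n) tvec \<Rightarrow> real) \<Rightarrow> bool"
  where "closed_one_form A \<xi> \<longleftrightarrow>
    (\<forall>c\<in>A. \<forall>x\<in>chart_img c. \<forall>X Y. ext_deriv (one_form_in A c \<xi>) x X Y = 0)"

(* The coefficient of a positive density with respect to the coordinates of each chart. *)
definition positive_density ::
  "('a, 'n::finite) chart set \<Rightarrow> (('a, 'n) chart \<Rightarrow> 'a \<Rightarrow> real) \<Rightarrow> bool"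
  where "positive_density A \<mu> \<longleftrightarrow>
    (\<forall>c\<in>A. smooth_on (chart_img c) (in_chart c (\<mu> c)) \<and> (\<forall>p\<in>fst c. \<mu> c p > 0)) \<and>
    (\<forall>c\<in>A. \<forall>d\<in>A. \<forall>p\<in>fst c \<inter> fst d.
       \<mu> c p = \<mu> d p * \<bar>det (matrix (transition_deriv c d p))\<bar>)"


section \<open>Finsler geometry in natural coordinates\<close>

(* Points z = (x, y) are the natural coordinates of the tangent bundle; a tangent vector (a, b)
   at z stands for a^i d/dx^i + b^i d/dy^i. *)
type_synonym 'n tpoint = "(real^'n) \<times> (real^'n)"

definition dx :: "'n::finite \<Rightarrow> ('n tpoint \<Rightarrow> real) \<Rightarrow> 'n tpoint \<Rightarrow> real"
  where "dx i f z = frechet_derivative f (at z) (axis i 1, 0)"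

definition dy :: "'n::finite \<Rightarrow> ('n tpoint \<Rightarrow> real) \<Rightarrow> 'n tpoint \<Rightarrow> real"
  where "dy i f z = frechet_derivative f (at z) (0, axis i 1)"

definition fund_tensor :: "('n::finite tpoint \<Rightarrow> real) \<Rightarrow> 'n tpoint \<Rightarrow> real^'n^'n"
  where "fund_tensor F z = (\<chi> i j. (1/2) * dy j (dy i (\<lambda>z. (F z)\<^sup>2)) z)"

definition spray :: "('n::finite tpoint \<Rightarrow> real) \<Rightarrow> 'n \<Rightarrow> 'n tpoint \<Rightarrow> real"
  where "spray F i z = (1/4) * (\<Sum>l\<in>UNIV. matrix_inv (fund_tensor F z) $ i $ l *
    ((\<Sum>k\<in>UNIV. dy l (dx k (\<lambda>z. (F z)\<^sup>2)) z * snd z $ k) - dx l (\<lambda>z. (F z)\<^sup>2) z))"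

definition nonlin_conn :: "('n::finite tpoint \<Rightarrow> real) \<Rightarrow> 'n \<Rightarrow> 'n \<Rightarrow> 'n tpoint \<Rightarrow> real"
  where "nonlin_conn F i k = dy k (spray F i)"

definition delta_x :: "('n::finite tpoint \<Rightarrow> real) \<Rightarrow> 'n \<Rightarrow> 'n tpoint \<Rightarrow> 'n tpoint"
  where "delta_x F i z = (axis i 1, - (\<chi> k. nonlin_conn F k i z))"

definition reeb :: "('n::finite tpoint \<Rightarrow> real) \<Rightarrow> 'n tpoint \<Rightarrow> 'n tpoint"
  where "reeb F z = (\<Sum>i\<in>UNIV. (snd z $ i / F z) *\<^sub>R delta_x F i z)"

definition riemann_curv :: "('n::finite tpoint \<Rightarrow> real) \<Rightarrow> 'n \<Rightarrow> 'n \<Rightarrow> 'n tpoint \<Rightarrow> real"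
  where "riemann_curv F i k z =
      2 * dx k (spray F i) z
    - (\<Sum>j\<in>UNIV. snd z $ j * dx j (dy k (spray F i)) z)
    + 2 * (\<Sum>j\<in>UNIV. spray F j z * dy j (dy k (spray F i)) z)
    - (\<Sum>j\<in>UNIV. dy j (spray F i) z * dy k (spray F j) z)"

(* Frame indices are the numbers 1, ..., n, so that n is the distinguished last one and Greek
   indices run over 1, ..., n - 1; coordinate indices range over the type 'n. *)
definition adapted_frame ::
  "('n::finite tpoint \<Rightarrow> real) \<Rightarrow> 'n tpoint \<Rightarrow> (nat \<Rightarrow> real^'n) \<Rightarrow> bool"
  where "adapted_frame F z u \<longleftrightarrow>
    (\<forall>i\<in>{1..CARD('n)}. \<forall>j\<in>{1..CARD('n)}.
       (\<Sum>k\<in>UNIV. \<Sum>l\<in>UNIV. fund_tensor F z $ k $ l * u i $ k * u j $ l) = (if i = j then 1 else 0)) \<and>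
    u CARD('n) = (1 / F z) *\<^sub>R snd z"

definition frame_h ::
  "('n::finite tpoint \<Rightarrow> real) \<Rightarrow> (nat \<Rightarrow> real^'n) \<Rightarrow> 'n tpoint \<Rightarrow> nat \<Rightarrow> 'n tpoint"
  where "frame_h F u z i = (\<Sum>j\<in>UNIV. (u i $ j) *\<^sub>R delta_x F j z)"

definition frame_v ::
  "('n::finite tpoint \<Rightarrow> real) \<Rightarrow> (nat \<Rightarrow> real^'n) \<Rightarrow> 'n tpoint \<Rightarrow> nat \<Rightarrow> 'n tpoint"
  where "frame_v F u z \<alpha> = (0, - (F z *\<^sub>R u \<alpha>))"

(* berwald_conn F i j is the connection form with upper index i and lower index j. *)
definition berwald_conn ::
  "('n::finite tpoint \<Rightarrow> real) \<Rightarrow> 'n \<Rightarrow> 'n \<Rightarrow> 'n tpoint \<Rightarrow> 'n tpoint \<Rightarrow> real"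
  where "berwald_conn F i j z X = (\<Sum>k\<in>UNIV. dy j (dy k (spray F i)) z * fst X $ k)"

definition berwald_curv ::
  "('n::finite tpoint \<Rightarrow> real) \<Rightarrow> 'n \<Rightarrow> 'n \<Rightarrow> 'n tpoint \<Rightarrow> 'n tpoint \<Rightarrow> 'n tpoint \<Rightarrow> real"
  where "berwald_curv F i j z X Y = ext_deriv (berwald_conn F i j) z X Y
    - (\<Sum>k\<in>UNIV. wedge (berwald_conn F k j) (berwald_conn F i k) z X Y)"

(* berwald_P F u z i j k \<gamma> has upper index i and lower indices j, k, \<gamma>. It is the coefficient of
   \<omega>^k \<and> \<omega>^\<gamma>bar in the curvature form, i.e. its value on the frame vectors e_k, e_\<gamma>bar. The frame u
   being orthonormal, g_ab u_i^b is the inverse matrix of u_i^a. *)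
definition berwald_P ::
  "('n::finite tpoint \<Rightarrow> real) \<Rightarrow> (nat \<Rightarrow> real^'n) \<Rightarrow> 'n tpoint \<Rightarrow> nat \<Rightarrow> nat \<Rightarrow> nat \<Rightarrow> nat \<Rightarrow> real"
  where "berwald_P F u z i j k \<gamma> =
    (\<Sum>a\<in>UNIV. \<Sum>b\<in>UNIV. (fund_tensor F z *v u i) $ a * u j $ b *
       berwald_curv F a b z (frame_h F u z k) (frame_v F u z \<gamma>))"

definition mean_berwald ::
  "('n::finite tpoint \<Rightarrow> real) \<Rightarrow> (nat \<Rightarrow> real^'n) \<Rightarrow> 'n tpoint \<Rightarrow> nat \<Rightarrow> nat \<Rightarrow> real"
  where "mean_berwald F u z \<gamma> \<mu> = (\<Sum>i=1..CARD('n). berwald_P F u z i i \<gamma> \<mu>)"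

(* The trace is the same for all adapted frames. *)
definition berwald_scalar :: "('n::finite tpoint \<Rightarrow> real) \<Rightarrow> 'n tpoint \<Rightarrow> real"
  where "berwald_scalar F z =
    (let u = (SOME u. adapted_frame F z u) in \<Sum>\<gamma>=1..<CARD('n). mean_berwald F u z \<gamma> \<gamma>)"

definition distortion ::
  "('n::finite tpoint \<Rightarrow> real) \<Rightarrow> (real^'n \<Rightarrow> real) \<Rightarrow> 'n tpoint \<Rightarrow> real"
  where "distortion F \<sigma>\<^sub>0 z = ln (sqrt (det (fund_tensor F z)) / \<sigma>\<^sub>0 (fst z))"

definition S_curv ::
  "('n::finite tpoint \<Rightarrow> real) \<Rightarrow> (real^'n \<Rightarrow> real) \<Rightarrow> 'n tpoint \<Rightarrow> real"
  where "S_curv F \<sigma>\<^sub>0 z = frechet_derivative (distortion F \<sigma>\<^sub>0) (at z) (reeb F z)"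

definition pullback_form :: "(real^'n \<Rightarrow> real^'n \<Rightarrow> real) \<Rightarrow> 'n::finite tpoint \<Rightarrow> 'n tpoint \<Rightarrow> real"
  where "pullback_form w z X = w (fst z) (fst X)"

definition differential :: "(real^'n::finite \<Rightarrow> real) \<Rightarrow> real^'n \<Rightarrow> real^'n \<Rightarrow> real"
  where "differential f x X = frechet_derivative f (at x) X"


section \<open>Finsler manifolds\<close>

definition slit_tangent :: "'a topology \<Rightarrow> ('a, 'n::finite) chart set \<Rightarrow> ('a \<times> ('a, 'n) tvec) set"
  where "slit_tangent M A = {(p, v). p \<in> topspace M \<and> v \<in> tangent_space A p \<and> v \<noteq> (\<lambda>_. 0)}"

definition finsler_metric ::
  "'a topology \<Rightarrow> ('a, 'n::finite) chart set \<Rightarrow> ('a \<Rightarrow> ('a, 'n) tvec \<Rightarrow> real) \<Rightarrow> bool"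
  where "finsler_metric M A F \<longleftrightarrow>
    (\<forall>p\<in>topspace M. \<forall>v\<in>tangent_space A p.
       F p v \<ge> 0 \<and> (\<forall>t>0. F p (\<lambda>c. t *\<^sub>R v c) = t * F p v)) \<and>
    (\<forall>c\<in>A. continuous_on (chart_img c \<times> UNIV) (in_tchart A c F) \<and>
       smooth_on (chart_img c \<times> (UNIV - {0})) (in_tchart A c F) \<and>
       (\<forall>z \<in> chart_img c \<times> (UNIV - {0}). \<forall>w. w \<noteq> 0 \<longrightarrow>
          w \<bullet> (fund_tensor (in_tchart A c F) z *v w) > 0))"

definition sphere_bundle ::
  "'a topology \<Rightarrow> ('a, 'n::finite) chart set \<Rightarrow> ('a \<Rightarrow> ('a, 'n) tvec \<Rightarrow> real)
     \<Rightarrow> ('a \<times> ('a, 'n) tvec) set"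
  where "sphere_bundle M A F = {(p, v). p \<in> topspace M \<and> v \<in> tangent_space A p \<and> F p v = 1}"

(* Only the values of K on nonzero tangent vectors matter. *)
definition scalar_flag_curvature ::
  "'a topology \<Rightarrow> ('a, 'n::finite) chart set \<Rightarrow> ('a \<Rightarrow> ('a, 'n) tvec \<Rightarrow> real)
     \<Rightarrow> ('a \<Rightarrow> ('a, 'n) tvec \<Rightarrow> real) \<Rightarrow> bool"
  where "scalar_flag_curvature M A F K \<longleftrightarrow>
    (\<forall>(p, v)\<in>slit_tangent M A. \<forall>c\<in>A. p \<in> fst c \<longrightarrow>
       (let F\<^sub>c = in_tchart A c F; z = tcoords c p v in
        \<forall>i k. riemann_curv F\<^sub>c i k z =
          K p v * ((F\<^sub>c z)\<^sup>2 * (if i = k then 1 else 0) - F\<^sub>c z * dy k F\<^sub>c z * snd z $ i)))"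

definition isotropic_S_with ::
  "'a topology \<Rightarrow> ('a, 'n::finite) chart set \<Rightarrow> ('a \<Rightarrow> ('a, 'n) tvec \<Rightarrow> real)
     \<Rightarrow> (('a, 'n) chart \<Rightarrow> 'a \<Rightarrow> real) \<Rightarrow> ('a \<Rightarrow> real) \<Rightarrow> ('a \<Rightarrow> ('a, 'n) tvec \<Rightarrow> real) \<Rightarrow> bool"
  where "isotropic_S_with M A F \<mu> b \<xi> \<longleftrightarrow>
    (\<forall>(p, v)\<in>sphere_bundle M A F. \<forall>c\<in>A. p \<in> fst c \<longrightarrow>
       (let F\<^sub>c = in_tchart A c F; z = tcoords c p v in
        S_curv F\<^sub>c (in_chart c (\<mu> c)) z =
          1 / (real CARD('n) - 1) * b p + pullback_form (one_form_in A c \<xi>) z (reeb F\<^sub>c z)))"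

definition weakly_isotropic_S ::
  "'a topology \<Rightarrow> ('a, 'n::finite) chart set \<Rightarrow> ('a \<Rightarrow> ('a, 'n) tvec \<Rightarrow> real)
     \<Rightarrow> (('a, 'n) chart \<Rightarrow> 'a \<Rightarrow> real) \<Rightarrow> bool"
  where "weakly_isotropic_S M A F \<mu> \<longleftrightarrow>
    (\<exists>b \<xi>. smooth_function A b \<and> smooth_one_form A \<xi> \<and> isotropic_S_with M A F \<mu> b \<xi>)"

definition almost_isotropic_S ::
  "'a topology \<Rightarrow> ('a, 'n::finite) chart set \<Rightarrow> ('a \<Rightarrow> ('a, 'n) tvec \<Rightarrow> real)
     \<Rightarrow> (('a, 'n) chart \<Rightarrow> 'a \<Rightarrow> real) \<Rightarrow> bool"
  where "almost_isotropic_S M A F \<mu> \<longleftrightarrow>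
    (\<exists>b \<xi>. smooth_function A b \<and> smooth_one_form A \<xi> \<and> isotropic_S_with M A F \<mu> b \<xi> \<and>
       closed_one_form A \<xi>)"

definition isotropic_flag_with ::
  "'a topology \<Rightarrow> ('a, 'n::finite) chart set \<Rightarrow> ('a \<Rightarrow> ('a, 'n) tvec \<Rightarrow> real)
     \<Rightarrow> ('a \<Rightarrow> ('a, 'n) tvec \<Rightarrow> real) \<Rightarrow> ('a \<Rightarrow> real) \<Rightarrow> ('a \<Rightarrow> real) \<Rightarrow> bool"
  where "isotropic_flag_with M A F K f \<sigma> \<longleftrightarrow>
    (\<forall>(p, v)\<in>sphere_bundle M A F. \<forall>c\<in>A. p \<in> fst c \<longrightarrow>
       (let F\<^sub>c = in_tchart A c F; z = tcoords c p v in
        K p v = 3 / ((real CARD('n))\<^sup>2 - 1) *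
            pullback_form (differential (in_chart c f)) z (reeb F\<^sub>c z) + \<sigma> p))"

definition weakly_isotropic_flag ::
  "'a topology \<Rightarrow> ('a, 'n::finite) chart set \<Rightarrow> ('a \<Rightarrow> ('a, 'n) tvec \<Rightarrow> real)
     \<Rightarrow> ('a \<Rightarrow> ('a, 'n) tvec \<Rightarrow> real) \<Rightarrow> bool"
  where "weakly_isotropic_flag M A F K \<longleftrightarrow>
    (\<exists>f \<sigma>. smooth_function A f \<and> smooth_function A \<sigma> \<and> isotropic_flag_with M A F K f \<sigma>)"

definition berwald_scalar_up_to_const ::
  "'a topology \<Rightarrow> ('a, 'n::finite) chart set \<Rightarrow> ('a \<Rightarrow> ('a, 'n) tvec \<Rightarrow> real) \<Rightarrow> ('a \<Rightarrow> real) \<Rightarrow> bool"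
  where "berwald_scalar_up_to_const M A F f \<longleftrightarrow>
    (\<forall>C\<in>connected_components_of M. \<exists>r. \<forall>(p, v)\<in>sphere_bundle M A F. p \<in> C \<longrightarrow>
       (\<forall>c\<in>A. p \<in> fst c \<longrightarrow> f p - berwald_scalar (in_tchart A c F) (tcoords c p v) = r))"

end

theory Submission
  imports Defs
begin

text \<open>
  Let \<open>G\<close> be the geodesic spray, \<open>X = y^k d/dx^k - 2 G^k d/dy^k\<close> its vector field, and
  \<open>E_k f = X (df/dy^k) - df/dx^k\<close> the Euler-Lagrange operator along it. The theorem is read off
  from the value of \<open>E_k\<close> on the function \<open>F S\<close>, computed in two ways.

  First, \<open>F S\<close> and the divergence \<open>N = dG^m/dy^m\<close> differ by \<open>X (ln \<sigma>\<^sub>0)\<close> (\<open>S_curv_eq\<close>), and \<open>E_k\<close>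
  vanishes on \<open>X f\<close> for every function \<open>f\<close> of \<open>x\<close> alone (\<open>euler_lagrange_exact\<close>). A computation with an
  arbitrary spray (\<open>trace_curv_deriv\<close>) shows that \<open>- 3 E_k N\<close> is
  \<open>2 dR^m_k/dy^m + dR^m_m/dy^k\<close>. If the flag curvature is scalar, this expression is
  \<open>(n + 1) F^2 dK/dy^k\<close>, because \<open>K\<close> is homogeneous of degree 0 (\<open>curvature_derivative\<close>).

  Secondly, weak isotropy says \<open>F S = \<beta> F + \<xi>(y)\<close> with \<open>\<beta> = b/(n - 1)\<close>, on which \<open>E_k\<close> is explicit,
  because \<open>E_k F = 0\<close>: geodesics are extremals of \<open>F\<close>. Equating both and subtracting a term \<open>dh(y)/F\<close>
  for a function \<open>h\<close> of \<open>x\<close> gives, with \<open>\<theta> = d\<beta> - dh\<close>, the central equation (\<open>dy_flag_defect\<close>)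

    \<open>(n + 1)/3 F^2 d/dy^k [K - 3/(n + 1) dh(y)/F] = F \<theta>_k - dF/dy^k \<theta>(y) - y^m (d\<xi>)_mk\<close>.

  If \<open>d\<xi> = 0\<close>, take \<open>h = \<beta>\<close>: the bracket does not depend on \<open>y\<close>, since \<open>R^n\<close> without the origin is
  connected for \<open>n \<ge> 2\<close>, and it is the function \<open>\<sigma>\<close>. Conversely, let \<open>K\<close> be weakly isotropic with some \<open>c\<close>, and
  take \<open>h = c/(n - 1)\<close>: the right-hand side vanishes for all \<open>y\<close>. This forces \<open>\<theta> = 0\<close>, because
  otherwise the derivative of \<open>F\<close> in a direction \<open>w\<close> of the kernel of \<open>\<theta>\<close> would take the same value at
  \<open>w\<close> and at \<open>-w\<close>, although it is \<open>F(w) > 0\<close> at the former and \<open>-F(-w) < 0\<close> at the latter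
  (\<open>flag_defect_constant_converse\<close>). Then also \<open>d\<xi> = 0\<close>.

  The mean Berwald curvature is the fibre Hessian of \<open>N\<close>, which is \<open>\<beta>\<close> times that of \<open>F\<close>; its trace on
  the unit sphere gives \<open>e = (n - 1) \<beta> = b\<close> (\<open>berwald_scalar_eq\<close>). As \<open>\<theta> = 0\<close> means \<open>dc = db\<close>, the
  difference \<open>c - e\<close> is locally constant.
\<close>


section \<open>Directional derivatives and smooth functions\<close>

text \<open>
  The direction is the first argument, so that \<open>dir_deriv v\<close> is an operator on functions: iterated partial
  derivatives are compositions, and \<open>dx i\<close> and \<open>dy i\<close> are special cases.
\<close>

definition dir_deriv :: "'v::real_normed_vector \<Rightarrow> ('v \<Rightarrow> real) \<Rightarrow> 'v \<Rightarrow> real"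
  where "dir_deriv v f z = frechet_derivative f (at z) v"

lemma dir_deriv_eqI: "(f has_derivative f') (at z) \<Longrightarrow> dir_deriv v f z = f' v"
  unfolding dir_deriv_def by (metis frechet_derivative_at)

lemma has_derivative_dir_deriv: "f differentiable (at z) \<Longrightarrow> (f has_derivative (\<lambda>v. dir_deriv v f z)) (at z)"
  unfolding dir_deriv_def using frechet_derivative_works by blast

lemma linear_dir_deriv: "f differentiable (at z) \<Longrightarrow> linear (\<lambda>v. dir_deriv v f z)"
  using has_derivative_dir_deriv has_derivative_linear by blast

lemma dir_deriv_cong:
  assumes "open S" "z \<in> S" "\<And>x. x \<in> S \<Longrightarrow> f x = g x"
  shows "dir_deriv v f z = dir_deriv v g z"
proof (cases "f differentiable (at z)")
  case True
  then have "(g has_derivative (\<lambda>v. dir_deriv v f z)) (at z)"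
    using has_derivative_dir_deriv has_derivative_transform_within_open assms by blast
  then show ?thesis by (simp add: dir_deriv_eqI)
next
  case False
  then have *: "\<not> g differentiable (at z)"
    unfolding differentiable_def using has_derivative_transform_within_open[of g _ z UNIV S f] assms by metis
  have "\<And>f'. (f has_derivative f') (at z) \<longleftrightarrow> (g has_derivative f') (at z)"
    using False * unfolding differentiable_def by blast
  then show ?thesis by (simp add: dir_deriv_def frechet_derivative_def)
qed

lemma dir_deriv_const [simp]: "dir_deriv v (\<lambda>x. c) z = 0"
  by (simp add: dir_deriv_def)

lemma dir_deriv_add:
  "f differentiable (at z) \<Longrightarrow> g differentiable (at z) \<Longrightarrow>
    dir_deriv v (\<lambda>x. f x + g x) z = dir_deriv v f z + dir_deriv v g z"
  by (rule dir_deriv_eqI[where f' = "\<lambda>v. dir_deriv v f z + dir_deriv v g z"])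
     (intro has_derivative_add has_derivative_dir_deriv)

lemma dir_deriv_diff:
  "f differentiable (at z) \<Longrightarrow> g differentiable (at z) \<Longrightarrow>
    dir_deriv v (\<lambda>x. f x - g x) z = dir_deriv v f z - dir_deriv v g z"
  by (rule dir_deriv_eqI[where f' = "\<lambda>v. dir_deriv v f z - dir_deriv v g z"])
     (intro has_derivative_diff has_derivative_dir_deriv)

lemma dir_deriv_mult:
  "f differentiable (at z) \<Longrightarrow> g differentiable (at z) \<Longrightarrow>
    dir_deriv v (\<lambda>x. f x * g x) z = f z * dir_deriv v g z + dir_deriv v f z * g z"
  by (rule dir_deriv_eqI[where f' = "\<lambda>v. f z * dir_deriv v g z + dir_deriv v f z * g z"])
     (intro has_derivative_mult has_derivative_dir_deriv)

lemma dir_deriv_cmult: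
  "f differentiable (at z) \<Longrightarrow> dir_deriv v (\<lambda>x. c * f x) z = c * dir_deriv v f z"
  using dir_deriv_mult[of "\<lambda>_. c"] by simp

lemma dir_deriv_sum:
  "(\<And>i. i \<in> I \<Longrightarrow> f i differentiable (at z)) \<Longrightarrow>
    dir_deriv v (\<lambda>x. \<Sum>i\<in>I. f i x) z = (\<Sum>i\<in>I. dir_deriv v (f i) z)"
  by (rule dir_deriv_eqI[where f' = "\<lambda>v. \<Sum>i\<in>I. dir_deriv v (f i) z"])
     (intro has_derivative_sum has_derivative_dir_deriv)

lemma dir_deriv_inverse:
  assumes "f differentiable (at z)" "f z \<noteq> 0"
  shows "dir_deriv v (\<lambda>x. inverse (f x)) z = - (inverse (f z) * dir_deriv v f z * inverse (f z))"
  using Deriv.has_derivative_inverse[OF assms(2) has_derivative_dir_deriv[OF assms(1)]] by (rule dir_deriv_eqI)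

lemma dir_deriv_ln:
  assumes "f differentiable (at z)" "f z > 0"
  shows "dir_deriv v (\<lambda>x. ln (f x)) z = dir_deriv v f z * inverse (f z)"
  using has_derivative_ln[OF assms(2) has_derivative_dir_deriv[OF assms(1)]] by (rule dir_deriv_eqI)

lemma dir_deriv_bounded_linear: "bounded_linear f \<Longrightarrow> dir_deriv v f z = f v"
  using bounded_linear_imp_has_derivative dir_deriv_eqI by blast

lemma linear_axis_expand:
  fixes f :: "real^'n \<Rightarrow> real"
  assumes "linear f"
  shows "f v = (\<Sum>i\<in>UNIV. v $ i * f (axis i 1))"
proof -
  have "v = (\<Sum>i\<in>UNIV. v $ i *\<^sub>R axis i 1)"
    by (simp add: vec_eq_iff axis_def if_distrib[of "\<lambda>x. _ * x"] cong: if_cong)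
  then have "f v = f (\<Sum>i\<in>UNIV. v $ i *\<^sub>R axis i 1)" by simp
  then show ?thesis by (simp only: linear_sum[OF assms] linear_scale[OF assms] real_scaleR_def)
qed

lemma has_derivative_affine:
  "bounded_linear L \<Longrightarrow> ((\<lambda>x. a + L x) has_derivative L) (at x)"
  by (auto intro!: derivative_eq_intros bounded_linear_imp_has_derivative)

lemma dir_deriv_compose_affine:
  assumes "bounded_linear L" "f differentiable (at (a + L x))"
  shows "dir_deriv v (\<lambda>x. f (a + L x)) x = dir_deriv (L v) f (a + L x)"
proof -
  have "(f \<circ> (\<lambda>x. a + L x) has_derivative (\<lambda>v. dir_deriv v f (a + L x)) \<circ> L) (at x)"
    by (rule diff_chain_at[OF has_derivative_affine[OF assms(1)] has_derivative_dir_deriv[OF assms(2)]])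
  then show ?thesis by (simp add: dir_deriv_eqI o_def)
qed

lemma Ck_on_Suc:
  "Ck_on (Suc k) S f \<longleftrightarrow> (\<forall>x\<in>S. f differentiable (at x)) \<and> (\<forall>v. Ck_on k S (dir_deriv v f))"
  by (simp add: dir_deriv_def[abs_def])

lemma Ck_on_cong1:
  assumes "open S" "\<And>x. x \<in> S \<Longrightarrow> f x = g x" "Ck_on k S f"
  shows "Ck_on k S (g :: _ \<Rightarrow> real)"
  using assms(2,3)
proof (induction k arbitrary: f g)
  case 0
  then show ?case by (simp cong: continuous_on_cong)
next
  case (Suc k)
  show ?case unfolding Ck_on_Suc
  proof (intro conjI ballI allI)
    fix x assume x: "x \<in> S"
    have "(f has_derivative (\<lambda>v. dir_deriv v f x)) (at x)"
      using Suc.prems(2) x unfolding Ck_on_Suc by (auto intro: has_derivative_dir_deriv)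
    then show "g differentiable (at x)"
      using has_derivative_transform_within_open[OF _ \<open>open S\<close> x] Suc.prems(1)
      unfolding differentiable_def by blast
  next
    fix v
    have "\<And>x. x \<in> S \<Longrightarrow> dir_deriv v f x = dir_deriv v g x"
      using Suc.prems(1) \<open>open S\<close> by (intro dir_deriv_cong) auto
    with Suc.IH[of "dir_deriv v f" "dir_deriv v g"] Suc.prems(2) show "Ck_on k S (dir_deriv v g)"
      unfolding Ck_on_Suc by blast
  qed
qed

lemma Ck_on_Suc_imp: "Ck_on (Suc k) S f \<Longrightarrow> Ck_on k S (f :: _ \<Rightarrow> real)"
proof (induction k arbitrary: f)
  case 0
  then show ?case
    by (auto simp: intro!: continuous_at_imp_continuous_on differentiable_imp_continuous_within)
next
  case (Suc k)
  then show ?case unfolding Ck_on_Suc[of "Suc k"] Ck_on_Suc[of k S f] by blast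
qed

text \<open>
  The induction step of the closure properties below: a formula for the derivative near each point is enough,
  because on an open set it determines the directional derivatives as functions.
\<close>

lemma Ck_on_SucI:
  assumes "open S" "\<And>x. x \<in> S \<Longrightarrow> (f has_derivative f' x) (at x)"
    "\<And>v. Ck_on k S (\<lambda>x. f' x v)"
  shows "Ck_on (Suc k) S (f :: _ \<Rightarrow> real)"
  unfolding Ck_on_Suc
proof (intro conjI ballI allI)
  fix x assume "x \<in> S"
  then show "f differentiable (at x)" using assms(2) differentiable_def by blast
next
  fix v
  have "\<And>x. x \<in> S \<Longrightarrow> f' x v = dir_deriv v f x"
    using assms(2) dir_deriv_eqI by metis
  then show "Ck_on k S (dir_deriv v f)" using Ck_on_cong1[OF assms(1) _ assms(3)[of v]] by auto
qed

lemma Ck_on_const: "Ck_on k S (\<lambda>x. c :: real)"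
  by (induction k arbitrary: c) (auto simp: dir_deriv_def)

lemma Ck_on_add:
  assumes "open S"
  shows "Ck_on k S f \<Longrightarrow> Ck_on k S g \<Longrightarrow> Ck_on k S (\<lambda>x. f x + g x :: real)"
proof (induction k arbitrary: f g)
  case (Suc k)
  show ?case
  proof (rule Ck_on_SucI[OF assms])
    show "((\<lambda>x. f x + g x) has_derivative (\<lambda>v. dir_deriv v f x + dir_deriv v g x)) (at x)" if "x \<in> S" for x
      using Suc.prems that unfolding Ck_on_Suc by (intro has_derivative_add has_derivative_dir_deriv) auto
    show "Ck_on k S (\<lambda>x. dir_deriv v f x + dir_deriv v g x)" for v
      using Suc unfolding Ck_on_Suc by auto
  qed
qed (auto intro: continuous_intros)

lemma Ck_on_mult:
  assumes "open S"
  shows "Ck_on k S f \<Longrightarrow> Ck_on k S g \<Longrightarrow> Ck_on k S (\<lambda>x. f x * g x :: real)"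
proof (induction k arbitrary: f g)
  case (Suc k)
  show ?case
  proof (rule Ck_on_SucI[OF assms])
    show "((\<lambda>x. f x * g x) has_derivative (\<lambda>v. f x * dir_deriv v g x + dir_deriv v f x * g x)) (at x)"
      if "x \<in> S" for x
      using Suc.prems that unfolding Ck_on_Suc by (intro has_derivative_mult has_derivative_dir_deriv) auto
    show "Ck_on k S (\<lambda>x. f x * dir_deriv v g x + dir_deriv v f x * g x)" for v
      using Suc.prems Ck_on_Suc_imp[OF Suc.prems(1)] Ck_on_Suc_imp[OF Suc.prems(2)]
      unfolding Ck_on_Suc by (intro Ck_on_add[OF assms] Suc.IH) auto
  qed
qed (auto intro: continuous_intros)

lemma Ck_on_bounded_linear:
  assumes "open S" "bounded_linear f" shows "Ck_on k S (f :: _ \<Rightarrow> real)"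
proof (cases k)
  case 0
  then show ?thesis using assms by (simp add: linear_continuous_on)
next
  case (Suc m)
  show ?thesis unfolding Suc
    by (rule Ck_on_SucI[OF assms(1), where f' = "\<lambda>_. f"])
       (use assms in \<open>auto intro: bounded_linear_imp_has_derivative Ck_on_const\<close>)
qed

lemma Ck_on_inverse:
  assumes "open S" "\<And>x. x \<in> S \<Longrightarrow> f x \<noteq> 0"
  shows "Ck_on k S f \<Longrightarrow> Ck_on k S (\<lambda>x. inverse (f x) :: real)"
proof (induction k)
  case 0
  then show ?case using assms(2) by (auto intro!: continuous_intros)
next
  case (Suc k)
  have c: "Ck_on k S (\<lambda>x. inverse (f x))" using Suc Ck_on_Suc_imp by blast
  show ?case
  proof (rule Ck_on_SucI[OF assms(1)])
    show "((\<lambda>x. inverse (f x)) has_derivative (\<lambda>v. - (inverse (f x) * dir_deriv v f x * inverse (f x)))) (at x)"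
      if "x \<in> S" for x
      using Suc.prems that assms(2) unfolding Ck_on_Suc by (intro Deriv.has_derivative_inverse has_derivative_dir_deriv) auto
    show "Ck_on k S (\<lambda>x. - (inverse (f x) * dir_deriv v f x * inverse (f x)))" for v
      using Ck_on_mult[OF assms(1) Ck_on_const[of k S "-1"] Ck_on_mult[OF assms(1) Ck_on_mult[OF assms(1) c] c], of "dir_deriv v f"]
        Suc.prems unfolding Ck_on_Suc by simp
  qed
qed

lemma Ck_on_ln:
  assumes "open S" "\<And>x. x \<in> S \<Longrightarrow> f x > 0" "Ck_on k S f"
  shows "Ck_on k S (\<lambda>x. ln (f x) :: real)"
proof (cases k)
  case 0
  then show ?thesis using assms by (force intro!: continuous_intros)
next
  case (Suc m)
  note f = assms(3)[unfolded Suc]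
  show ?thesis unfolding Suc
  proof (rule Ck_on_SucI[OF assms(1)])
    show "((\<lambda>x. ln (f x)) has_derivative (\<lambda>v. dir_deriv v f x * inverse (f x))) (at x)"
      if "x \<in> S" for x
      using f that assms(2) unfolding Ck_on_Suc by (intro has_derivative_ln has_derivative_dir_deriv) auto
    show "Ck_on m S (\<lambda>x. dir_deriv v f x * inverse (f x))" for v
      using f assms(2) Ck_on_Suc_imp[OF f] unfolding Ck_on_Suc
      by (intro Ck_on_mult Ck_on_inverse assms(1)) force+
  qed
qed

text \<open>
  Affine substitutions cover all compositions that occur: functions of \<open>x\<close> viewed on the tangent
  bundle, restrictions to a fixed fibre or to a fixed \<open>y\<close>, and scalings of the fibres.
\<close>

lemma Ck_on_compose_affine:
  assumes "open T" "bounded_linear L" "\<And>x. x \<in> T \<Longrightarrow> a + L x \<in> S"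
  shows "Ck_on k S f \<Longrightarrow> Ck_on k T (\<lambda>x. f (a + L x) :: real)"
proof (induction k arbitrary: f)
  case 0
  have "continuous_on T (\<lambda>x. a + L x)"
    using assms(2) by (intro continuous_on_add continuous_on_const linear_continuous_on)
  moreover have "continuous_on ((\<lambda>x. a + L x) ` T) f"
    by (rule continuous_on_subset[of S]) (use 0 assms(3) in auto)
  ultimately have "continuous_on T (f \<circ> (\<lambda>x. a + L x))" by (rule continuous_on_compose)
  then show ?case by (simp add: o_def)
next
  case (Suc k)
  show ?case
  proof (rule Ck_on_SucI[OF assms(1)])
    fix x assume "x \<in> T"
    then have "(f \<circ> (\<lambda>x. a + L x) has_derivative (\<lambda>v. dir_deriv v f (a + L x)) \<circ> L) (at x)"
      using Suc.prems assms unfolding Ck_on_Suc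
      by (intro diff_chain_at has_derivative_affine has_derivative_dir_deriv) auto
    then show "((\<lambda>x. f (a + L x)) has_derivative (\<lambda>v. dir_deriv (L v) f (a + L x))) (at x)"
      by (simp add: o_def)
  next
    fix v show "Ck_on k T (\<lambda>x. dir_deriv (L v) f (a + L x))"
      using Suc unfolding Ck_on_Suc by blast
  qed
qed

lemma smooth_on_cong:
  "open S \<Longrightarrow> (\<And>x. x \<in> S \<Longrightarrow> f x = g x) \<Longrightarrow> smooth_on S f \<Longrightarrow> smooth_on S (g :: _ \<Rightarrow> real)"
  unfolding smooth_on_def using Ck_on_cong1 by blast

lemma smooth_on_differentiable: "smooth_on S f \<Longrightarrow> x \<in> S \<Longrightarrow> f differentiable (at x)"
  unfolding smooth_on_def by (metis Ck_on.simps(2))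

lemma smooth_on_dir_deriv: "smooth_on S f \<Longrightarrow> smooth_on S (dir_deriv v f)"
  unfolding smooth_on_def using Ck_on_Suc by blast

lemma smooth_on_continuous_on: "smooth_on S f \<Longrightarrow> continuous_on S f"
  unfolding smooth_on_def using Ck_on.simps(1) by blast

lemma smooth_on_const [simp]: "smooth_on S (\<lambda>x. c :: real)"
  by (simp add: smooth_on_def Ck_on_const)

lemma smooth_on_add:
  "open S \<Longrightarrow> smooth_on S f \<Longrightarrow> smooth_on S g \<Longrightarrow> smooth_on S (\<lambda>x. f x + g x :: real)"
  by (simp add: smooth_on_def Ck_on_add)

lemma smooth_on_mult:
  "open S \<Longrightarrow> smooth_on S f \<Longrightarrow> smooth_on S g \<Longrightarrow> smooth_on S (\<lambda>x. f x * g x :: real)"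
  by (simp add: smooth_on_def Ck_on_mult)

lemma smooth_on_minus:
  "open S \<Longrightarrow> smooth_on S f \<Longrightarrow> smooth_on S (\<lambda>x. - f x :: real)"
  using smooth_on_mult[of S "\<lambda>_. -1" f] by simp

lemma smooth_on_diff:
  "open S \<Longrightarrow> smooth_on S f \<Longrightarrow> smooth_on S g \<Longrightarrow> smooth_on S (\<lambda>x. f x - g x :: real)"
  using smooth_on_add[of S f "\<lambda>x. - g x"] smooth_on_minus[of S g] by simp

lemma smooth_on_sum:
  "open S \<Longrightarrow> (\<And>i. i \<in> I \<Longrightarrow> smooth_on S (f i)) \<Longrightarrow> smooth_on S (\<lambda>x. \<Sum>i\<in>I. f i x :: real)"
  by (induction I rule: infinite_finite_induct) (auto intro: smooth_on_add)

lemma smooth_on_prod: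
  "open S \<Longrightarrow> (\<And>i. i \<in> I \<Longrightarrow> smooth_on S (f i)) \<Longrightarrow> smooth_on S (\<lambda>x. \<Prod>i\<in>I. f i x :: real)"
  by (induction I rule: infinite_finite_induct) (auto intro: smooth_on_mult)

lemma smooth_on_power:
  "open S \<Longrightarrow> smooth_on S f \<Longrightarrow> smooth_on S (\<lambda>x. f x ^ m :: real)"
  by (induction m) (auto intro: smooth_on_mult)

lemma smooth_on_divide:
  assumes "open S" "smooth_on S f" "smooth_on S g" "\<And>x. x \<in> S \<Longrightarrow> g x \<noteq> 0"
  shows "smooth_on S (\<lambda>x. f x / g x :: real)"
proof -
  have "smooth_on S (\<lambda>x. inverse (g x))"
    using assms unfolding smooth_on_def by (blast intro: Ck_on_inverse)
  then show ?thesis unfolding divide_inverse using assms smooth_on_mult by blast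
qed

lemma smooth_on_ln:
  "open S \<Longrightarrow> smooth_on S f \<Longrightarrow> (\<And>x. x \<in> S \<Longrightarrow> f x > 0) \<Longrightarrow> smooth_on S (\<lambda>x. ln (f x) :: real)"
  by (simp add: smooth_on_def Ck_on_ln)

lemma smooth_on_bounded_linear:
  "open S \<Longrightarrow> bounded_linear f \<Longrightarrow> smooth_on S (f :: _ \<Rightarrow> real)"
  by (simp add: smooth_on_def Ck_on_bounded_linear)

lemma smooth_on_compose_affine:
  "smooth_on S f \<Longrightarrow> open T \<Longrightarrow> bounded_linear L \<Longrightarrow> (\<And>x. x \<in> T \<Longrightarrow> a + L x \<in> S) \<Longrightarrow>
    smooth_on T (\<lambda>x. f (a + L x) :: real)"
  unfolding smooth_on_def using Ck_on_compose_affine by blast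

lemma smooth_on_det:
  assumes "open S" "\<And>i j. smooth_on S (\<lambda>z. A z $ i $ j)"
  shows "smooth_on S (\<lambda>z. det (A z :: real^'n^'n))"
  unfolding det_def using assms by (intro smooth_on_sum smooth_on_mult smooth_on_prod) auto

text \<open>
  The mean value theorem is applied twice, in direction \<open>v\<close> to the difference of \<open>f\<close> along two
  parallel sides, and then in direction \<open>w\<close> to the derivative of \<open>f\<close> in direction \<open>v\<close>.
\<close>

lemma second_difference_mean_value:
  assumes S: "smooth_on S f" and h: "h > 0"
    and sub: "\<And>s t. 0 \<le> s \<Longrightarrow> s \<le> h \<Longrightarrow> 0 \<le> t \<Longrightarrow> t \<le> h \<Longrightarrow> x + s *\<^sub>R v + t *\<^sub>R w \<in> S"
  shows "\<exists>s t. 0 \<le> s \<and> s \<le> h \<and> 0 \<le> t \<and> t \<le> h \<and>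
    f (x + h *\<^sub>R v + h *\<^sub>R w) - f (x + h *\<^sub>R v) - f (x + h *\<^sub>R w) + f x
      = h * h * dir_deriv w (dir_deriv v f) (x + s *\<^sub>R v + t *\<^sub>R w)"
proof -
  have line: "((\<lambda>r. g (a + r *\<^sub>R u)) has_real_derivative dir_deriv u g (a + r *\<^sub>R u)) (at r)"
    if "smooth_on S g" "a + r *\<^sub>R u \<in> S" for g a u r
  proof -
    have "((\<lambda>r. a + r *\<^sub>R u) has_derivative (\<lambda>r. r *\<^sub>R u)) (at r)"
      by (auto intro!: derivative_eq_intros)
    from diff_chain_at[OF this has_derivative_dir_deriv[OF smooth_on_differentiable[OF that]]]
    have "((\<lambda>r. g (a + r *\<^sub>R u)) has_derivative (\<lambda>r'. dir_deriv (r' *\<^sub>R u) g (a + r *\<^sub>R u))) (at r)"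
      by (simp add: o_def)
    moreover have "dir_deriv (r' *\<^sub>R u) g (a + r *\<^sub>R u) = dir_deriv u g (a + r *\<^sub>R u) * r'" for r'
      using linear_cmul[OF linear_dir_deriv[OF smooth_on_differentiable[OF that]]] by simp
    ultimately show ?thesis by (simp add: has_field_derivative_def)
  qed
  let ?p = "\<lambda>r. f ((x + h *\<^sub>R w) + r *\<^sub>R v) - f (x + r *\<^sub>R v)"
  have "((?p) has_real_derivative
      (dir_deriv v f ((x + h *\<^sub>R w) + r *\<^sub>R v) - dir_deriv v f (x + r *\<^sub>R v))) (at r)" if "0 \<le> r" "r \<le> h" for r
    using that h sub[of r h] sub[of r 0]
    by (intro DERIV_diff line[OF S]) (auto simp: algebra_simps)
  from MVT2[of 0 h ?p, OF h this] obtain s where s: "0 < s" "s < h"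
    "?p h - ?p 0 = h * (dir_deriv v f ((x + h *\<^sub>R w) + s *\<^sub>R v) - dir_deriv v f (x + s *\<^sub>R v))" by auto
  let ?q = "\<lambda>r. dir_deriv v f ((x + s *\<^sub>R v) + r *\<^sub>R w)"
  have "(?q has_real_derivative dir_deriv w (dir_deriv v f) ((x + s *\<^sub>R v) + r *\<^sub>R w)) (at r)"
    if "0 \<le> r" "r \<le> h" for r
    using that s sub[of s r] by (intro line smooth_on_dir_deriv[OF S]) auto
  from MVT2[of 0 h ?q, OF h this] obtain t where t: "0 < t" "t < h"
    "?q h - ?q 0 = h * dir_deriv w (dir_deriv v f) ((x + s *\<^sub>R v) + t *\<^sub>R w)" by auto
  show ?thesis
    using s t by (intro exI[of _ s] exI[of _ t]) (auto simp: algebra_simps)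
qed

text \<open>
  The second difference is symmetric in \<open>v\<close> and \<open>w\<close>, so both mixed derivatives take a common
  value at points arbitrarily close to \<open>z\<close>, and they are continuous there.
\<close>

lemma dir_deriv_commute:
  assumes "open S" "smooth_on S f" "z \<in> S"
  shows "dir_deriv v (dir_deriv w f) z = dir_deriv w (dir_deriv v f) z"
proof (rule ccontr)
  let ?a = "dir_deriv v (dir_deriv w f)" and ?b = "dir_deriv w (dir_deriv v f)"
  assume ne: "?a z \<noteq> ?b z"
  define e where "e = \<bar>?a z - ?b z\<bar> / 2"
  have e: "e > 0" using ne by (simp add: e_def)
  have "continuous (at z) ?a" "continuous (at z) ?b"
    using assms smooth_on_dir_deriv smooth_on_continuous_on continuous_on_eq_continuous_at by blast+
  then obtain d1 d2 where d: "d1 > 0" "d2 > 0"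
    "\<And>y. dist y z < d1 \<Longrightarrow> dist (?a y) (?a z) < e" "\<And>y. dist y z < d2 \<Longrightarrow> dist (?b y) (?b z) < e"
    unfolding continuous_at_eps_delta using e by (metis dist_commute)
  obtain d3 where d3: "d3 > 0" "\<And>y. dist y z < d3 \<Longrightarrow> y \<in> S"
    using assms open_dist by metis
  define d' where "d' = min d1 (min d2 d3)"
  \<comment> \<open>small enough for the whole parallelogram to lie within \<open>d'\<close> of \<open>z\<close>\<close>
  define h where "h = d' / (2 * (1 + norm v + norm w))"
  have nn: "1 + norm v + norm w > 0" by (smt (verit) norm_ge_zero)
  have d'0: "d' > 0" using d d3 by (simp add: d'_def)
  have h: "h > 0" using nn d'0 by (simp add: h_def)
  have near: "dist (z + s *\<^sub>R v + t *\<^sub>R w) z < d'" if "0 \<le> s" "s \<le> h" "0 \<le> t" "t \<le> h" for s t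
  proof -
    have "dist (z + s *\<^sub>R v + t *\<^sub>R w) z = norm (s *\<^sub>R v + t *\<^sub>R w)" by (simp add: dist_norm add.assoc)
    also have "\<dots> \<le> s * norm v + t * norm w"
      using norm_triangle_ineq[of "s *\<^sub>R v" "t *\<^sub>R w"] that by simp
    also have "\<dots> \<le> h * norm v + h * norm w"
      using that by (intro add_mono mult_right_mono) auto
    also have "\<dots> \<le> h * (1 + norm v + norm w)" using h by (simp add: algebra_simps)
    also have "\<dots> = d' / 2" using nn unfolding h_def by (simp only: times_divide_eq_left) (simp add: field_simps)
    finally show ?thesis using d'0 by simp
  qed
  have near': "dist (z + t *\<^sub>R w + s *\<^sub>R v) z < d'" if "0 \<le> s" "s \<le> h" "0 \<le> t" "t \<le> h" for s t
    using near[OF that] by (simp add: algebra_simps)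
  obtain s t where 1: "0 \<le> s" "s \<le> h" "0 \<le> t" "t \<le> h"
    "f (z + h *\<^sub>R v + h *\<^sub>R w) - f (z + h *\<^sub>R v) - f (z + h *\<^sub>R w) + f z
      = h * h * ?b (z + s *\<^sub>R v + t *\<^sub>R w)"
    using second_difference_mean_value[OF assms(2) h, of z v w] near d3 by (auto simp: d'_def)
  obtain s' t' where 2: "0 \<le> s'" "s' \<le> h" "0 \<le> t'" "t' \<le> h"
    "f (z + h *\<^sub>R w + h *\<^sub>R v) - f (z + h *\<^sub>R w) - f (z + h *\<^sub>R v) + f z
      = h * h * ?a (z + t' *\<^sub>R w + s' *\<^sub>R v)"
    using second_difference_mean_value[OF assms(2) h, of z w v] near' d3 by (auto simp: d'_def)
  have "h * h * ?b (z + s *\<^sub>R v + t *\<^sub>R w) = h * h * ?a (z + t' *\<^sub>R w + s' *\<^sub>R v)"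
    using 1(5) 2(5) by (simp add: algebra_simps)
  then have "?b (z + s *\<^sub>R v + t *\<^sub>R w) = ?a (z + t' *\<^sub>R w + s' *\<^sub>R v)" using h by simp
  moreover have "dist (?b (z + s *\<^sub>R v + t *\<^sub>R w)) (?b z) < e"
    using near[OF 1(1-4)] by (intro d) (simp add: d'_def)
  moreover have "dist (?a (z + t' *\<^sub>R w + s' *\<^sub>R v)) (?a z) < e"
    using near'[OF 2(1-4)] by (intro d) (simp add: d'_def)
  ultimately show False unfolding e_def dist_real_def by (smt (verit) field_sum_of_halves)
qed


section \<open>Homogeneous functions on the slit tangent bundle of a coordinate domain\<close>

lemma dx_dir_deriv: "dx i = dir_deriv (axis i 1, 0)"
  by (simp add: fun_eq_iff dx_def dir_deriv_def)

lemma dy_dir_deriv: "dy i = dir_deriv (0, axis i 1)"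
  by (simp add: fun_eq_iff dy_def dir_deriv_def)

locale tangent_domain =
  fixes U :: "(real^'n::finite) set"
  assumes open_U: "open U"
begin

abbreviation slit :: "'n tpoint set" where "slit \<equiv> U \<times> (UNIV - {0})"

abbreviation smooth :: "('n tpoint \<Rightarrow> real) \<Rightarrow> bool" where "smooth \<equiv> smooth_on slit"

lemma open_slit: "open slit"
  by (simp add: open_U open_Times open_Diff)

lemma smooth_coord: "smooth (\<lambda>z. snd z $ i)"
  by (intro smooth_on_bounded_linear open_slit bounded_linear_compose[OF bounded_linear_vec_nth bounded_linear_snd])

lemma smooth_fst: "smooth_on U f \<Longrightarrow> smooth (\<lambda>z. f (fst z))"
  using smooth_on_compose_affine[of U f slit fst 0] open_slit by (auto simp: bounded_linear_fst)

lemma smooth_dx: "smooth f \<Longrightarrow> smooth (dx i f)"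
  by (simp add: dx_dir_deriv smooth_on_dir_deriv)

lemma smooth_dy: "smooth f \<Longrightarrow> smooth (dy i f)"
  by (simp add: dy_dir_deriv smooth_on_dir_deriv)

lemmas smooth_intros = smooth_on_add[OF open_slit] smooth_on_mult[OF open_slit] smooth_on_diff[OF open_slit]
  smooth_on_sum[OF open_slit] smooth_on_minus[OF open_slit] smooth_on_power[OF open_slit] smooth_on_const
  smooth_coord smooth_fst smooth_dx smooth_dy smooth_on_dir_deriv

lemma smooth_differentiable: "smooth f \<Longrightarrow> z \<in> slit \<Longrightarrow> f differentiable (at z)"
  by (rule smooth_on_differentiable)

lemma dir_deriv_coord: "dir_deriv v (\<lambda>z::'n tpoint. snd z $ i) z = snd v $ i"
  by (rule dir_deriv_bounded_linear) (intro bounded_linear_compose[OF bounded_linear_vec_nth bounded_linear_snd])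

lemma dir_deriv_fst: "smooth_on U f \<Longrightarrow> z \<in> slit \<Longrightarrow> dir_deriv v (\<lambda>z. f (fst z)) z = dir_deriv (fst v) f (fst z)"
  using dir_deriv_compose_affine[of fst f 0 z v] by (auto simp: bounded_linear_fst smooth_on_differentiable)

lemma dy_fst: "smooth_on U f \<Longrightarrow> z \<in> slit \<Longrightarrow> dy i (\<lambda>z. f (fst z)) z = 0"
  by (auto simp: dy_dir_deriv dir_deriv_fst intro!: linear_0[OF linear_dir_deriv] smooth_on_differentiable)

lemma dx_fst: "smooth_on U f \<Longrightarrow> z \<in> slit \<Longrightarrow> dx i (\<lambda>z. f (fst z)) z = dir_deriv (axis i 1) f (fst z)"
  by (simp add: dx_dir_deriv dir_deriv_fst)

lemma dir_deriv_coord_expand: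
  assumes "smooth f" "z \<in> slit"
  shows "dir_deriv v f z = (\<Sum>j\<in>UNIV. fst v $ j * dx j f z) + (\<Sum>j\<in>UNIV. snd v $ j * dy j f z)"
proof -
  note l = linear_dir_deriv[OF smooth_differentiable[OF assms]]
  have "v = (\<Sum>j\<in>UNIV. fst v $ j *\<^sub>R (axis j 1, 0)) + (\<Sum>j\<in>UNIV. snd v $ j *\<^sub>R (0, axis j 1))"
    by (simp add: prod_eq_iff fst_sum snd_sum)
       (simp add: vec_eq_iff axis_def if_distrib[of "\<lambda>x. _ * x"] cong: if_cong)
  then have "dir_deriv v f z = dir_deriv ((\<Sum>j\<in>UNIV. fst v $ j *\<^sub>R (axis j 1, 0)) + (\<Sum>j\<in>UNIV. snd v $ j *\<^sub>R (0, axis j 1))) f z"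
    by simp
  then show ?thesis
    by (simp only: linear_add[OF l] linear_sum[OF l] linear_scale[OF l] dx_dir_deriv dy_dir_deriv real_scaleR_def)
qed

lemma dir_deriv_slit_cong: "z \<in> slit \<Longrightarrow> (\<And>x. x \<in> slit \<Longrightarrow> f x = g x) \<Longrightarrow> dir_deriv v f z = dir_deriv v g z"
  using dir_deriv_cong[OF open_slit] by blast

lemma dx_slit_cong: "z \<in> slit \<Longrightarrow> (\<And>x. x \<in> slit \<Longrightarrow> f x = g x) \<Longrightarrow> dx i f z = dx i g z"
  unfolding dx_dir_deriv by (rule dir_deriv_slit_cong)

lemma dy_slit_cong: "z \<in> slit \<Longrightarrow> (\<And>x. x \<in> slit \<Longrightarrow> f x = g x) \<Longrightarrow> dy i f z = dy i g z"
  unfolding dy_dir_deriv by (rule dir_deriv_slit_cong)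

lemma dir_deriv_commute_slit: "smooth f \<Longrightarrow> z \<in> slit \<Longrightarrow> dir_deriv v (dir_deriv w f) z = dir_deriv w (dir_deriv v f) z"
  using dir_deriv_commute[OF open_slit] by blast

lemma dy_commute: "smooth f \<Longrightarrow> z \<in> slit \<Longrightarrow> dy i (dy j f) z = dy j (dy i f) z"
  unfolding dy_dir_deriv by (rule dir_deriv_commute_slit)

lemma dx_dy_commute: "smooth f \<Longrightarrow> z \<in> slit \<Longrightarrow> dx i (dy j f) z = dy j (dx i f) z"
  unfolding dy_dir_deriv dx_dir_deriv by (rule dir_deriv_commute_slit)

text \<open>
  Natural numbers suffice as degrees: a derivative in \<open>y\<close> is only ever taken of a function of positive degree
  when homogeneity of the result matters, down to the fundamental tensor in degree 0.
\<close>

definition homog :: "nat \<Rightarrow> ('n tpoint \<Rightarrow> real) \<Rightarrow> bool"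
  where "homog r f \<longleftrightarrow> (\<forall>x\<in>U. \<forall>y. y \<noteq> 0 \<longrightarrow> (\<forall>t>0. f (x, t *\<^sub>R y) = t ^ r * f (x, y)))"

lemma homogD: "homog r f \<Longrightarrow> z \<in> slit \<Longrightarrow> t > 0 \<Longrightarrow> f (fst z, t *\<^sub>R snd z) = t ^ r * f z"
  by (cases z) (simp add: homog_def)

text \<open>
  The chain rule for the scaling \<open>(x, y) \<mapsto> (x, t y)\<close>, which fixes horizontal directions and multiplies vertical
  ones by \<open>t\<close>: derivatives in \<open>x\<close> keep the degree, derivatives in \<open>y\<close> lower it by one.
\<close>

lemma homog_dir_deriv_scale:
  assumes "homog r f" "smooth f" "z \<in> slit" "t > 0"
  shows "dir_deriv (fst v, t *\<^sub>R snd v) f (fst z, t *\<^sub>R snd z) = t ^ r * dir_deriv v f z"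
proof -
  let ?L = "\<lambda>z::'n tpoint. (fst z, t *\<^sub>R snd z)"
  have L: "bounded_linear ?L"
    by (intro bounded_linear_Pair bounded_linear_fst bounded_linear_compose[OF bounded_linear_scaleR_right bounded_linear_snd])
  have zW: "0 + ?L z \<in> slit" using assms by auto
  have "dir_deriv v (\<lambda>z. f (0 + ?L z)) z = dir_deriv (?L v) f (0 + ?L z)"
    by (rule dir_deriv_compose_affine[OF L smooth_differentiable[OF assms(2) zW]])
  moreover have "dir_deriv v (\<lambda>z. f (0 + ?L z)) z = dir_deriv v (\<lambda>z. t ^ r * f z) z"
    using homogD[OF assms(1) _ assms(4)] assms(3) by (intro dir_deriv_slit_cong) simp_all
  moreover have "\<dots> = t ^ r * dir_deriv v f z" by (rule dir_deriv_cmult[OF smooth_differentiable[OF assms(2,3)]])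
  ultimately show ?thesis by simp
qed

lemma homog_dx: "homog r f \<Longrightarrow> smooth f \<Longrightarrow> homog r (dx i f)"
  unfolding dx_dir_deriv homog_def[of r "dir_deriv (axis i 1, 0) f"]
proof (intro ballI allI impI)
  fix x y :: "real^'n" and t :: real
  assume "homog r f" "smooth f" "x \<in> U" "y \<noteq> 0" "t > 0"
  then show "dir_deriv (axis i 1, 0) f (x, t *\<^sub>R y) = t ^ r * dir_deriv (axis i 1, 0) f (x, y)"
    using homog_dir_deriv_scale[of r f "(x, y)" t "(axis i 1, 0)"] by simp
qed

lemma homog_dy:
  assumes "homog (Suc r) f" "smooth f"
  shows "homog r (dy i f)"
  unfolding homog_def dy_dir_deriv
proof (intro ballI allI impI)
  fix x y :: "real^'n" and t :: real assume *: "x \<in> U" "y \<noteq> 0" "t > 0"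
  have "dir_deriv (0, t *\<^sub>R axis i 1) f (x, t *\<^sub>R y) = t ^ Suc r * dir_deriv (0, axis i 1) f (x, y)"
    using homog_dir_deriv_scale[OF assms, of "(x, y)" t "(0, axis i 1)"] * by simp
  moreover have "dir_deriv (0, t *\<^sub>R axis i 1) f (x, t *\<^sub>R y) = t * dir_deriv (0, axis i 1) f (x, t *\<^sub>R y)"
    using linear_scale[OF linear_dir_deriv[OF smooth_differentiable[OF assms(2), of "(x, t *\<^sub>R y)"]], of t "(0, axis i 1)"] * by simp
  ultimately show "dir_deriv (0, axis i 1) f (x, t *\<^sub>R y) = t ^ r * dir_deriv (0, axis i 1) f (x, y)"
    using * by simp
qed

lemma homog_mult: "homog r f \<Longrightarrow> homog s g \<Longrightarrow> homog (r + s) (\<lambda>z. f z * g z)"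
  by (simp add: homog_def power_add)

lemma homog_add: "homog r f \<Longrightarrow> homog r g \<Longrightarrow> homog r (\<lambda>z. f z + g z)"
  by (simp add: homog_def algebra_simps)

lemma homog_diff: "homog r f \<Longrightarrow> homog r g \<Longrightarrow> homog r (\<lambda>z. f z - g z)"
  by (simp add: homog_def algebra_simps)

lemma homog_cmult: "homog r f \<Longrightarrow> homog r (\<lambda>z. c * f z)"
  by (simp add: homog_def algebra_simps)

lemma homog_sum: "(\<And>i. i \<in> I \<Longrightarrow> homog r (f i)) \<Longrightarrow> homog r (\<lambda>z. \<Sum>i\<in>I. f i z)"
  by (simp add: homog_def sum_distrib_left)

lemma homog_coord: "homog 1 (\<lambda>z. snd z $ i)"
  by (simp add: homog_def)

text \<open>
  Both sides are the derivative of \<open>t \<mapsto> f (x, t y)\<close> at \<open>t = 1\<close>.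
\<close>

lemma euler_homogeneous:
  assumes "homog r f" "smooth f" "z \<in> slit"
  shows "(\<Sum>j\<in>UNIV. snd z $ j * dy j f z) = real r * f z"
proof -
  obtain x y where z: "z = (x, y)" "x \<in> U" "y \<noteq> 0" using assms(3) by auto
  let ?L = "\<lambda>t::real. (0 :: real^'n, t *\<^sub>R y)"
  have L: "bounded_linear ?L"
    by (intro bounded_linear_Pair bounded_linear_zero bounded_linear_scaleR_left)
  have "dir_deriv 1 (\<lambda>t. f ((x, 0) + ?L t)) 1 = dir_deriv (?L 1) f ((x, 0) + ?L 1)"
    using assms z by (intro dir_deriv_compose_affine[OF L] smooth_differentiable) auto
  also have "\<dots> = (\<Sum>j\<in>UNIV. snd z $ j * dy j f z)"
    using dir_deriv_coord_expand[OF assms(2,3), of "(0, y)"] z by simp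
  finally have 1: "dir_deriv 1 (\<lambda>t. f ((x, 0) + ?L t)) 1 = (\<Sum>j\<in>UNIV. snd z $ j * dy j f z)" .
  have "dir_deriv 1 (\<lambda>t. f ((x, 0) + ?L t)) 1 = dir_deriv 1 (\<lambda>t. t ^ r * f z) (1::real)"
    by (rule dir_deriv_cong[of "{0<..}"]) (use assms(1) z in \<open>auto simp: homog_def\<close>)
  also have "\<dots> = real r * f z"
    by (rule dir_deriv_eqI[where f' = "\<lambda>h. real r * h * f z" and v = 1, simplified])
       (auto intro!: derivative_eq_intros simp: algebra_simps)
  finally show ?thesis using 1 by simp
qed

end


section \<open>The curvature of a spray\<close>

locale spray_domain = tangent_domain U for U :: "(real^'n::finite) set" +
  fixes G :: "'n \<Rightarrow> 'n tpoint \<Rightarrow> real"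
  assumes smooth_G: "smooth (G i)"
begin

definition spray_vec :: "'n tpoint \<Rightarrow> 'n tpoint"
  where "spray_vec z = (snd z, - (2 *\<^sub>R (\<chi> j. G j z)))"

definition spray_deriv :: "('n tpoint \<Rightarrow> real) \<Rightarrow> 'n tpoint \<Rightarrow> real"
  where "spray_deriv f z = dir_deriv (spray_vec z) f z"

lemma spray_deriv_expand:
  assumes "smooth f" "z \<in> slit"
  shows "spray_deriv f z = (\<Sum>j\<in>UNIV. snd z $ j * dx j f z) - 2 * (\<Sum>j\<in>UNIV. G j z * dy j f z)"
  unfolding spray_deriv_def dir_deriv_coord_expand[OF assms]
  by (simp add: spray_vec_def sum_negf sum_distrib_left mult.assoc)

lemma smooth_spray_deriv: "smooth f \<Longrightarrow> smooth (spray_deriv f)"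
  by (rule smooth_on_cong[OF open_slit spray_deriv_expand[symmetric]]) (auto intro!: smooth_intros smooth_G)

lemma spray_deriv_coord: "spray_deriv (\<lambda>z. snd z $ i) z = - 2 * G i z"
  by (simp add: spray_deriv_def dir_deriv_coord spray_vec_def)

lemma spray_deriv_slit_cong: "z \<in> slit \<Longrightarrow> (\<And>x. x \<in> slit \<Longrightarrow> f x = g x) \<Longrightarrow> spray_deriv f z = spray_deriv g z"
  unfolding spray_deriv_def by (rule dir_deriv_slit_cong)

lemma spray_deriv_fst: "smooth_on U f \<Longrightarrow> z \<in> slit \<Longrightarrow> spray_deriv (\<lambda>z. f (fst z)) z = dir_deriv (snd z) f (fst z)"
  unfolding spray_deriv_def by (simp add: dir_deriv_fst spray_vec_def)

text \<open>
  The constant field \<open>v\<close> commutes with the spray up to the derivative of the coefficients of the spray.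
\<close>

lemma dir_deriv_spray_deriv:
  assumes "smooth f" "z \<in> slit"
  shows "dir_deriv v (spray_deriv f) z = spray_deriv (dir_deriv v f) z + (\<Sum>j\<in>UNIV. snd v $ j * dx j f z)
    - 2 * (\<Sum>j\<in>UNIV. dir_deriv v (G j) z * dy j f z)"
proof -
  note d = smooth_differentiable[OF _ assms(2)]
  have "dir_deriv v (spray_deriv f) z =
    dir_deriv v (\<lambda>z. (\<Sum>j\<in>UNIV. snd z $ j * dx j f z) - 2 * (\<Sum>j\<in>UNIV. G j z * dy j f z)) z"
    using assms by (intro dir_deriv_slit_cong spray_deriv_expand)
  also have "\<dots> = dir_deriv v (\<lambda>z. \<Sum>j\<in>UNIV. snd z $ j * dx j f z) z
      - 2 * dir_deriv v (\<lambda>z. \<Sum>j\<in>UNIV. G j z * dy j f z) z"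
  proof -
    have 1: "smooth (\<lambda>z. \<Sum>j\<in>UNIV. snd z $ j * dx j f z)" by (intro smooth_intros assms(1))
    have 2: "smooth (\<lambda>z. \<Sum>j\<in>UNIV. G j z * dy j f z)" by (intro smooth_intros smooth_G assms(1))
    have 3: "smooth (\<lambda>z. 2 * (\<Sum>j\<in>UNIV. G j z * dy j f z))" by (intro smooth_intros smooth_G assms(1))
    show ?thesis by (simp only: dir_deriv_diff[OF d[OF 1] d[OF 3]] dir_deriv_cmult[OF d[OF 2]])
  qed
  also have "dir_deriv v (\<lambda>z. \<Sum>j\<in>UNIV. snd z $ j * dx j f z) z
      = (\<Sum>j\<in>UNIV. snd z $ j * dir_deriv v (dx j f) z + snd v $ j * dx j f z)"
    using assms(1) by (subst dir_deriv_sum, intro d smooth_intros, simp)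
      (intro sum.cong refl, subst dir_deriv_mult, (intro d smooth_intros, simp?)+, simp add: dir_deriv_coord)
  also have "dir_deriv v (\<lambda>z. \<Sum>j\<in>UNIV. G j z * dy j f z) z
      = (\<Sum>j\<in>UNIV. G j z * dir_deriv v (dy j f) z + dir_deriv v (G j) z * dy j f z)"
    by (subst dir_deriv_sum, intro d smooth_intros smooth_G assms(1))
      (intro sum.cong refl dir_deriv_mult d smooth_intros smooth_G assms(1))
  finally show ?thesis
    unfolding spray_deriv_expand[OF smooth_on_dir_deriv[OF assms(1)] assms(2)]
    using dir_deriv_commute_slit[OF assms]
    by (simp add: dx_dir_deriv dy_dir_deriv sum.distrib algebra_simps)
qed

lemma dy_spray_deriv:
  assumes "smooth f" "z \<in> slit"
  shows "dy k (spray_deriv f) z = spray_deriv (dy k f) z + dx k f z - 2 * (\<Sum>j\<in>UNIV. dy k (G j) z * dy j f z)"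
  using dir_deriv_spray_deriv[OF assms, of "(0, axis k 1)"]
  by (simp add: dy_dir_deriv axis_def if_distrib[of "\<lambda>x. x * _"] cong: if_cong)

lemma dx_spray_deriv:
  assumes "smooth f" "z \<in> slit"
  shows "dx k (spray_deriv f) z = spray_deriv (dx k f) z - 2 * (\<Sum>j\<in>UNIV. dx k (G j) z * dy j f z)"
  using dir_deriv_spray_deriv[OF assms, of "(axis k 1, 0)"] by (simp add: dx_dir_deriv)

lemma spray_deriv_add: "smooth f \<Longrightarrow> smooth g \<Longrightarrow> z \<in> slit \<Longrightarrow> spray_deriv (\<lambda>z. f z + g z) z = spray_deriv f z + spray_deriv g z"
  by (simp add: spray_deriv_def dir_deriv_add smooth_differentiable)

lemma spray_deriv_diff: "smooth f \<Longrightarrow> smooth g \<Longrightarrow> z \<in> slit \<Longrightarrow> spray_deriv (\<lambda>z. f z - g z) z = spray_deriv f z - spray_deriv g z"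
  by (simp add: spray_deriv_def dir_deriv_diff smooth_differentiable)

lemma spray_deriv_mult: "smooth f \<Longrightarrow> smooth g \<Longrightarrow> z \<in> slit \<Longrightarrow> spray_deriv (\<lambda>z. f z * g z) z = f z * spray_deriv g z + spray_deriv f z * g z"
  by (simp add: spray_deriv_def dir_deriv_mult smooth_differentiable)

lemma spray_deriv_cmult: "smooth f \<Longrightarrow> z \<in> slit \<Longrightarrow> spray_deriv (\<lambda>z. c * f z) z = c * spray_deriv f z"
  by (simp add: spray_deriv_def dir_deriv_cmult smooth_differentiable)

lemma spray_deriv_sum: "(\<And>i. i \<in> I \<Longrightarrow> smooth (f i)) \<Longrightarrow> z \<in> slit \<Longrightarrow> spray_deriv (\<lambda>z. \<Sum>i\<in>I. f i z) z = (\<Sum>i\<in>I. spray_deriv (f i) z)"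
  by (simp add: spray_deriv_def dir_deriv_sum smooth_differentiable)

definition spray_div :: "'n tpoint \<Rightarrow> real"
  where "spray_div z = (\<Sum>m\<in>UNIV. dy m (G m) z)"

text \<open>
  The Riemann curvature of the spray, with its terms of second order in \<open>G\<close> collected into the derivative of
  \<open>dG^i/dy^k\<close> along the spray.
\<close>

definition spray_curv :: "'n \<Rightarrow> 'n \<Rightarrow> 'n tpoint \<Rightarrow> real"
  where "spray_curv i k z = 2 * dx k (G i) z - spray_deriv (dy k (G i)) z - (\<Sum>j\<in>UNIV. dy j (G i) z * dy k (G j) z)"

text \<open>
  For coefficients that are homogeneous of degree 2, this is \<open>f_{.k|m} y^m - f_{|k}\<close> in terms of the
  horizontal covariant derivative of the Berwald connection; the connection terms of the two summands cancel.
\<close>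

definition euler_lagrange :: "'n \<Rightarrow> ('n tpoint \<Rightarrow> real) \<Rightarrow> 'n tpoint \<Rightarrow> real"
  where "euler_lagrange k f z = spray_deriv (dy k f) z - dx k f z"

lemma smooth_div: "smooth spray_div"
  unfolding spray_div_def[abs_def] by (intro smooth_intros smooth_G)

lemma smooth_spray_curv: "smooth (spray_curv i k)"
  unfolding spray_curv_def[abs_def] by (intro smooth_intros smooth_spray_deriv smooth_G)

lemma dir_deriv_div: "z \<in> slit \<Longrightarrow> dir_deriv v spray_div z = (\<Sum>m\<in>UNIV. dir_deriv v (dy m (G m)) z)"
  unfolding spray_div_def[abs_def] by (intro dir_deriv_sum smooth_differentiable smooth_intros smooth_G)

lemma dy_div: "z \<in> slit \<Longrightarrow> dy k spray_div z = (\<Sum>m\<in>UNIV. dy m (dy k (G m)) z)"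
  using dir_deriv_div[of z "(0, axis k 1)"] dy_commute[OF smooth_G] by (simp add: dy_dir_deriv)

lemma dir_deriv_spray_curv:
  assumes "z \<in> slit"
  shows "dir_deriv v (spray_curv i k) z = 2 * dir_deriv v (dx k (G i)) z - dir_deriv v (spray_deriv (dy k (G i))) z
    - (\<Sum>j\<in>UNIV. dy j (G i) z * dir_deriv v (dy k (G j)) z + dir_deriv v (dy j (G i)) z * dy k (G j) z)"
proof -
  note d = smooth_differentiable[OF _ assms]
  have "dir_deriv v (spray_curv i k) z = dir_deriv v (\<lambda>z. 2 * dx k (G i) z) z - dir_deriv v (spray_deriv (dy k (G i))) z
    - dir_deriv v (\<lambda>z. \<Sum>j\<in>UNIV. dy j (G i) z * dy k (G j) z) z"
    unfolding spray_curv_def[abs_def]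
    by (subst dir_deriv_diff, (intro d smooth_intros smooth_spray_deriv smooth_G)+,
        subst dir_deriv_diff, (intro d smooth_intros smooth_spray_deriv smooth_G)+, rule refl)
  also have "dir_deriv v (\<lambda>z. 2 * dx k (G i) z) z = 2 * dir_deriv v (dx k (G i)) z"
    by (intro dir_deriv_cmult d smooth_intros smooth_G)
  also have "dir_deriv v (\<lambda>z. \<Sum>j\<in>UNIV. dy j (G i) z * dy k (G j) z) z
    = (\<Sum>j\<in>UNIV. dir_deriv v (\<lambda>z. dy j (G i) z * dy k (G j) z) z)"
    by (intro dir_deriv_sum d smooth_intros smooth_G)
  also have "\<dots> = (\<Sum>j\<in>UNIV. dy j (G i) z * dir_deriv v (dy k (G j)) z + dir_deriv v (dy j (G i)) z * dy k (G j) z)"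
    by (intro sum.cong refl dir_deriv_mult d smooth_intros smooth_G)
  finally show ?thesis .
qed

text \<open>
  Both traces are expanded with the commutation rule for the spray and a vertical derivative. Besides the two terms
  of the Euler-Lagrange operator there remain a term \<open>Q\<close> with one horizontal derivative and the two quadratic
  expressions \<open>T\<close> and \<open>P\<close>; their coefficients are \<open>-1, 1, -1\<close> in the first trace and
  \<open>2, -2, 2\<close> in the second, so that they cancel in the combination.
\<close>

lemma trace_curv_deriv:
  assumes z: "z \<in> slit"
  shows "2 * (\<Sum>m\<in>UNIV. dy m (spray_curv m k) z) + (\<Sum>m\<in>UNIV. dy k (spray_curv m m) z) = - 3 * euler_lagrange k spray_div z"
proof -
  define T where "T = (\<Sum>m\<in>UNIV. \<Sum>j\<in>UNIV. dy m (G j) z * dy j (dy k (G m)) z)"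
  define P where "P = (\<Sum>j\<in>UNIV. dy k (G j) z * dy j spray_div z)"
  define Q where "Q = (\<Sum>m\<in>UNIV. dx m (dy k (G m)) z)"
  note com = dy_commute[OF smooth_G z]
  note com2 = dy_commute[OF smooth_dy[OF smooth_G] z]
  have XD: "spray_deriv (dy k spray_div) z = (\<Sum>m\<in>UNIV. spray_deriv (dy m (dy k (G m))) z)"
    by (subst spray_deriv_slit_cong[OF z dy_div]) (auto intro!: spray_deriv_sum z smooth_intros smooth_G)
  have xD: "dx k spray_div z = (\<Sum>m\<in>UNIV. dy m (dx k (G m)) z)"
    using dir_deriv_div[OF z, of "(axis k 1, 0)"] dx_dy_commute[OF smooth_G z] by (simp add: dx_dir_deriv)
  have yD: "dy j spray_div z = (\<Sum>m\<in>UNIV. dy m (dy j (G m)) z)" for j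
    by (rule dy_div[OF z])
  have T': "(\<Sum>m\<in>UNIV. \<Sum>j\<in>UNIV. dy j (G m) z * dy m (dy k (G j)) z) = T"
    unfolding T_def by (rule sum.swap)
  have P': "(\<Sum>m\<in>UNIV. \<Sum>j\<in>UNIV. dy m (dy j (G m)) z * dy k (G j) z) = P"
    unfolding P_def yD by (subst sum.swap) (simp add: sum_distrib_left mult.commute)
  have B: "(\<Sum>m\<in>UNIV. dy m (spray_curv m k) z) = 2 * dx k spray_div z - spray_deriv (dy k spray_div) z - Q + T - P"
  proof -
    have "dy m (spray_curv m k) z = 2 * dy m (dx k (G m)) z
        - (spray_deriv (dy m (dy k (G m))) z + dx m (dy k (G m)) z - 2 * (\<Sum>j\<in>UNIV. dy m (G j) z * dy j (dy k (G m)) z))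
        - ((\<Sum>j\<in>UNIV. dy j (G m) z * dy m (dy k (G j)) z) + (\<Sum>j\<in>UNIV. dy m (dy j (G m)) z * dy k (G j) z))" for m
      using dir_deriv_spray_curv[OF z, of "(0, axis m 1)" m k] dy_spray_deriv[OF smooth_dy[OF smooth_G] z, of m k m]
      by (simp add: dy_dir_deriv[of m] sum.distrib)
    then have "(\<Sum>m\<in>UNIV. dy m (spray_curv m k) z) = 2 * (\<Sum>m\<in>UNIV. dy m (dx k (G m)) z)
        - ((\<Sum>m\<in>UNIV. spray_deriv (dy m (dy k (G m))) z) + Q - 2 * T) - (T + P)"
      unfolding T'[symmetric] P'[symmetric]
      by (simp add: sum.distrib sum_subtractf sum_distrib_left T' T_def Q_def)
    then show ?thesis unfolding XD xD by simp
  qed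
  have T'': "(\<Sum>m\<in>UNIV. \<Sum>j\<in>UNIV. dy j (G m) z * dy k (dy m (G j)) z) = T"
    using T' by (simp add: com[of k])
  have T''': "(\<Sum>m\<in>UNIV. \<Sum>j\<in>UNIV. dy k (dy j (G m)) z * dy m (G j) z) = T"
    unfolding T_def by (simp add: com[of k] mult.commute)
  have A: "(\<Sum>m\<in>UNIV. dy k (spray_curv m m) z)
    = 2 * Q - spray_deriv (dy k spray_div) z - dx k spray_div z + 2 * P - 2 * T"
  proof -
    have c: "spray_deriv (dy k (dy m (G m))) z = spray_deriv (dy m (dy k (G m))) z" for m
      by (rule spray_deriv_slit_cong[OF z]) (rule dy_commute[OF smooth_G])
    have "dy k (spray_curv m m) z = 2 * dx m (dy k (G m)) z
        - (spray_deriv (dy m (dy k (G m))) z + dy m (dx k (G m)) z - 2 * (\<Sum>j\<in>UNIV. dy k (G j) z * dy m (dy j (G m)) z))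
        - ((\<Sum>j\<in>UNIV. dy j (G m) z * dy k (dy m (G j)) z) + (\<Sum>j\<in>UNIV. dy k (dy j (G m)) z * dy m (G j) z))" for m
      using dir_deriv_spray_curv[OF z, of "(0, axis k 1)" m m] dy_spray_deriv[OF smooth_dy[OF smooth_G] z, of k m m]
      by (simp add: dy_dir_deriv[of k] sum.distrib c[unfolded dy_dir_deriv[of k]]
          dx_dy_commute[OF smooth_G z, of _ k, unfolded dy_dir_deriv[of k]] dx_dy_commute[OF smooth_G z] com[of _ m])
    then have "(\<Sum>m\<in>UNIV. dy k (spray_curv m m) z) = 2 * Q - ((\<Sum>m\<in>UNIV. spray_deriv (dy m (dy k (G m))) z)
        + (\<Sum>m\<in>UNIV. dy m (dx k (G m)) z)
        - 2 * (\<Sum>m\<in>UNIV. \<Sum>j\<in>UNIV. dy m (dy j (G m)) z * dy k (G j) z))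
        - ((\<Sum>m\<in>UNIV. \<Sum>j\<in>UNIV. dy j (G m) z * dy k (dy m (G j)) z)
          + (\<Sum>m\<in>UNIV. \<Sum>j\<in>UNIV. dy k (dy j (G m)) z * dy m (G j) z))"
      by (simp add: sum.distrib sum_subtractf sum_distrib_left[symmetric] Q_def mult.commute[of "dy k (G _) z"])
    then show ?thesis unfolding XD xD P' T'' T''' by simp
  qed
  show ?thesis unfolding A B euler_lagrange_def by simp
qed

lemma euler_lagrange_slit_cong: "z \<in> slit \<Longrightarrow> (\<And>x. x \<in> slit \<Longrightarrow> f x = h x) \<Longrightarrow> euler_lagrange k f z = euler_lagrange k h z"
  unfolding euler_lagrange_def using spray_deriv_slit_cong[of z "dy k f" "dy k h"] dx_slit_cong[of z f h] dy_slit_cong[of _ f h] by simp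

lemma euler_lagrange_add:
  assumes "smooth f" "smooth h" "z \<in> slit"
  shows "euler_lagrange k (\<lambda>z. f z + h z) z = euler_lagrange k f z + euler_lagrange k h z"
proof -
  have "spray_deriv (dy k (\<lambda>z. f z + h z)) z = spray_deriv (\<lambda>z. dy k f z + dy k h z) z"
    using assms by (intro spray_deriv_slit_cong) (simp_all add: dy_dir_deriv dir_deriv_add smooth_differentiable)
  also have "\<dots> = spray_deriv (dy k f) z + spray_deriv (dy k h) z"
    using assms by (intro spray_deriv_add smooth_dy)
  finally show ?thesis
    using assms by (simp add: euler_lagrange_def dx_dir_deriv dir_deriv_add smooth_differentiable)
qed

text \<open>
  A total derivative along the spray is a null Lagrangian.
\<close>

lemma euler_lagrange_exact:
  assumes "smooth_on U f" "z \<in> slit"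
  shows "euler_lagrange k (spray_deriv (\<lambda>z. f (fst z))) z = 0"
proof -
  let ?f = "\<lambda>z::'n tpoint. f (fst z)"
  have s: "smooth ?f" using assms(1) by (rule smooth_fst)
  have v: "dy j ?f z = 0" if "z \<in> slit" for j z by (rule dy_fst[OF assms(1) that])
  have 1: "dy k (spray_deriv ?f) z = dx k ?f z" if "z \<in> slit" for z
  proof -
    have "spray_deriv (dy k ?f) z = spray_deriv (\<lambda>z. 0) z" by (intro spray_deriv_slit_cong that v)
    then show ?thesis using dy_spray_deriv[OF s that, of k] v[OF that] by (simp add: spray_deriv_def)
  qed
  have "spray_deriv (dy k (spray_deriv ?f)) z = spray_deriv (dx k ?f) z" by (intro spray_deriv_slit_cong assms(2) 1)
  then show ?thesis using dx_spray_deriv[OF s assms(2), of k] v[OF assms(2)] by (simp add: euler_lagrange_def)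
qed

text \<open>
  On a one-form the Euler-Lagrange operator is the contraction of the exterior derivative with \<open>y\<close>: the
  spray coefficients only enter through vertical derivatives, and those of \<open>a_k\<close> vanish.
\<close>

lemma euler_lagrange_linear:
  assumes "\<And>i. smooth_on U (a i)" "z \<in> slit"
  shows "euler_lagrange k (\<lambda>z. \<Sum>i\<in>UNIV. a i (fst z) * snd z $ i) z
    = (\<Sum>m\<in>UNIV. snd z $ m * (dir_deriv (axis m 1) (a k) (fst z) - dir_deriv (axis k 1) (a m) (fst z)))"
proof -
  let ?a = "\<lambda>i z. a i (fst (z::'n tpoint))"
  have s: "smooth (?a i)" for i using assms(1) by (rule smooth_fst)
  have p: "dir_deriv v (\<lambda>z. \<Sum>i\<in>UNIV. ?a i z * snd z $ i) z
      = (\<Sum>i\<in>UNIV. ?a i z * snd v $ i + dir_deriv v (?a i) z * snd z $ i)" if z: "z \<in> slit" for v z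
    by (subst dir_deriv_sum, intro smooth_differentiable[OF _ z] smooth_intros assms(1), intro sum.cong refl, subst dir_deriv_mult,
        (intro smooth_differentiable[OF _ z] smooth_intros assms(1))+, simp add: dir_deriv_coord)
  have "dy k (\<lambda>z. \<Sum>i\<in>UNIV. ?a i z * snd z $ i) z = ?a k z" if "z \<in> slit" for z
    using p[OF that, of "(0, axis k 1)"] dy_fst[OF assms(1) that, of k]
    by (simp add: dy_dir_deriv axis_def if_distrib[of "\<lambda>x. _ * x"] cong: if_cong)
  then have "spray_deriv (dy k (\<lambda>z. \<Sum>i\<in>UNIV. ?a i z * snd z $ i)) z = spray_deriv (?a k) z"
    by (intro spray_deriv_slit_cong assms(2))
  also have "\<dots> = (\<Sum>m\<in>UNIV. snd z $ m * dir_deriv (axis m 1) (a k) (fst z))"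
    using assms by (simp add: spray_deriv_expand[OF s assms(2)] dx_fst dy_fst)
  moreover have "dx k (\<lambda>z. \<Sum>i\<in>UNIV. ?a i z * snd z $ i) z
      = (\<Sum>m\<in>UNIV. snd z $ m * dir_deriv (axis k 1) (a m) (fst z))"
    using p[OF assms(2), of "(axis k 1, 0)"] assms by (simp add: dx_dir_deriv dir_deriv_fst mult.commute)
  ultimately show ?thesis by (simp add: euler_lagrange_def sum_subtractf right_diff_distrib)
qed

lemma smooth_directional: "smooth_on U h \<Longrightarrow> smooth (\<lambda>z. dir_deriv (snd z) h (fst z))"
  by (rule smooth_on_cong[OF open_slit spray_deriv_fst]) (auto intro: smooth_spray_deriv smooth_fst)

lemma dy_directional:
  assumes h: "smooth_on U h" and z: "z \<in> slit"
  shows "dy k (\<lambda>z. dir_deriv (snd z) h (fst z)) z = dir_deriv (axis k 1) h (fst z)"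
proof -
  have s: "smooth (\<lambda>z. h (fst z))" using h by (rule smooth_fst)
  have "dy k (\<lambda>z. dir_deriv (snd z) h (fst z)) z = dy k (spray_deriv (\<lambda>z. h (fst z))) z"
    by (intro dy_slit_cong z) (simp add: spray_deriv_fst[OF h])
  also have "\<dots> = spray_deriv (dy k (\<lambda>z. h (fst z))) z + dx k (\<lambda>z. h (fst z)) z
      - 2 * (\<Sum>j\<in>UNIV. dy k (G j) z * dy j (\<lambda>z. h (fst z)) z)"
    by (rule dy_spray_deriv[OF s z])
  also have "spray_deriv (dy k (\<lambda>z. h (fst z))) z = spray_deriv (\<lambda>z. 0) z"
    by (intro spray_deriv_slit_cong z dy_fst h)
  finally show ?thesis using h z by (simp add: dy_fst dx_fst spray_deriv_def)
qed

lemma homog_div: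
  assumes "\<And>i. homog 2 (G i)" shows "homog 1 spray_div"
  unfolding spray_div_def[abs_def]
  by (intro homog_sum homog_dy[OF _ smooth_G]) (use assms in \<open>simp only: Suc_1\<close>)

end


section \<open>Positive definite matrices, determinants and orthonormal frames\<close>

lemma pos_def_invertible:
  fixes A :: "real^'n^'n"
  assumes "\<And>w. w \<noteq> 0 \<Longrightarrow> w \<bullet> (A *v w) > 0"
  shows "invertible A"
  unfolding invertible_left_inverse matrix_left_invertible_ker
  using assms by (metis inner_zero_right less_irrefl)

text \<open>
  The segment from the identity to \<open>A\<close> consists of positive definite, hence invertible, matrices, so the
  determinant keeps the sign that it has at the identity.
\<close>

lemma pos_def_det_pos:
  fixes A :: "real^'n^'n"
  assumes "\<And>w. w \<noteq> 0 \<Longrightarrow> w \<bullet> (A *v w) > 0"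
  shows "det A > 0"
proof (rule ccontr)
  assume "\<not> det A > 0"
  let ?h = "\<lambda>t. det ((1 - t) *\<^sub>R mat 1 + t *\<^sub>R A)"
  have c: "continuous_on {0..1} ?h"
    unfolding det_def by (simp add: scaleR_vec_def) (intro continuous_intros)
  have "\<exists>t\<ge>0. t \<le> 1 \<and> ?h t = 0"
    by (rule IVT2'[OF _ _ _ c]) (use \<open>\<not> det A > 0\<close> in auto)
  then obtain t where t: "0 \<le> t" "t \<le> 1" "?h t = 0" by blast
  have "invertible ((1 - t) *\<^sub>R mat 1 + t *\<^sub>R A)"
  proof (rule pos_def_invertible)
    fix w :: "real^'n" assume w: "w \<noteq> 0"
    have "w \<bullet> (((1 - t) *\<^sub>R mat 1 + t *\<^sub>R A) *v w) = (1 - t) * (w \<bullet> w) + t * (w \<bullet> (A *v w))"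
      by (simp add: matrix_vector_mult_add_rdistrib scaleR_matrix_vector_assoc[symmetric] inner_add_right)
    moreover have "w \<bullet> w > 0" "w \<bullet> (A *v w) > 0" using w assms by auto
    ultimately show "w \<bullet> (((1 - t) *\<^sub>R mat 1 + t *\<^sub>R A) *v w) > 0"
      using t by (cases "t = 0") (auto intro: add_nonneg_pos)
  qed
  then show False using t(3) invertible_det_nz by blast
qed

lemma matrix_inv_mult:
  fixes A :: "real^'n^'n"
  assumes "invertible A"
  shows "A ** matrix_inv A = mat 1" "matrix_inv A ** A = mat 1"
  using someI_ex[OF assms[unfolded invertible_def]] unfolding matrix_inv_def by auto

text \<open>
  Cramer's rule for the columns of the inverse, which shows that the inverse depends smoothly on the matrix.
\<close>

lemma matrix_inv_component:
  fixes A :: "real^'n^'n"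
  assumes "invertible A"
  shows "matrix_inv A $ i $ l = det (\<chi> a b. if b = i then axis l 1 $ a else A $ a $ b) / det A"
proof -
  have "A *v (matrix_inv A *v axis l 1) = axis l 1"
    by (simp add: matrix_vector_mul_assoc matrix_inv_mult[OF assms])
  then have "matrix_inv A *v axis l 1 = (\<chi> k. det (\<chi> a b. if b = k then axis l 1 $ a else A $ a $ b) / det A)"
    using cramer assms invertible_det_nz by blast
  moreover have "(matrix_inv A *v axis l 1) $ i = matrix_inv A $ i $ l"
    by (simp add: matrix_vector_mult_basis column_def)
  ultimately show ?thesis by simp
qed

text \<open>
  In the Leibniz formula, a permutation other than the identity moves at least two indices. After differentiation of
  one factor, an entry off the diagonal of the identity matrix is still left, so the term vanishes.
\<close>

lemma dir_deriv_det_at_identity: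
  fixes B :: "'v::real_normed_vector \<Rightarrow> real^'n^'n"
  assumes "\<And>i j. (\<lambda>z. B z $ i $ j) differentiable (at z)" "B z = mat 1"
  shows "dir_deriv v (\<lambda>z. det (B z)) z = (\<Sum>i\<in>UNIV. dir_deriv v (\<lambda>z. B z $ i $ i) z)"
    and "(\<lambda>z. det (B z)) differentiable (at z)"
proof -
  let ?P = "{p. p permutes (UNIV :: 'n set)}"
  let ?d = "\<lambda>v p. \<Sum>i\<in>UNIV. dir_deriv v (\<lambda>z. B z $ i $ p i) z * (\<Prod>j\<in>UNIV - {i}. B z $ j $ p j)"
  have "((\<lambda>z. \<Prod>i\<in>UNIV. B z $ i $ p i) has_derivative (\<lambda>v. ?d v p)) (at z)" for p
    by (rule has_derivative_prod) (intro has_derivative_dir_deriv assms)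
  then have D: "((\<lambda>z. det (B z)) has_derivative (\<lambda>v. \<Sum>p\<in>?P. of_int (sign p) * ?d v p)) (at z)"
    unfolding det_def by (intro has_derivative_sum has_derivative_mult_right)
  then show "(\<lambda>z. det (B z)) differentiable (at z)" using differentiable_def by blast
  have zero: "?d v p = 0" if p: "p \<in> ?P" "p \<noteq> id" for p
  proof (rule sum.neutral, intro ballI)
    fix i
    obtain a where a: "p a \<noteq> a" using p by fastforce
    then have "p (p a) \<noteq> p a" using p by (metis mem_Collect_eq permutes_inv_eq)
    with a obtain j where "j \<noteq> i" "p j \<noteq> j" by metis
    then have "(\<Prod>j\<in>UNIV - {i}. B z $ j $ p j) = 0"
      using assms(2) by (intro prod_zero) (auto simp: mat_def intro!: bexI[of _ j])
    then show "dir_deriv v (\<lambda>z. B z $ i $ p i) z * (\<Prod>j\<in>UNIV - {i}. B z $ j $ p j) = 0" by simp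
  qed
  have "dir_deriv v (\<lambda>z. det (B z)) z = (\<Sum>p\<in>?P. of_int (sign p) * ?d v p)"
    using D by (rule dir_deriv_eqI)
  also have "\<dots> = (\<Sum>p\<in>{id}. of_int (sign p) * ?d v p)"
    by (rule sum.mono_neutral_right) (use zero in \<open>auto simp: finite_permutations permutes_id\<close>)
  also have "\<dots> = (\<Sum>i\<in>UNIV. dir_deriv v (\<lambda>z. B z $ i $ i) z)"
    using assms(2) by (simp add: sign_id mat_def)
  finally show "dir_deriv v (\<lambda>z. det (B z)) z = (\<Sum>i\<in>UNIV. dir_deriv v (\<lambda>z. B z $ i $ i) z)" .
qed

text \<open>
  Jacobi's formula, reduced to the identity matrix by \<open>det (A z') = det (A z) * det ((A z)^{-1} (A z'))\<close>.
\<close>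

lemma dir_deriv_det:
  fixes A :: "'v::real_normed_vector \<Rightarrow> real^'n^'n"
  assumes d: "\<And>i j. (\<lambda>z. A z $ i $ j) differentiable (at z)" and inv: "invertible (A z)"
  shows "dir_deriv v (\<lambda>z. det (A z)) z
    = det (A z) * (\<Sum>i\<in>UNIV. \<Sum>l\<in>UNIV. matrix_inv (A z) $ i $ l * dir_deriv v (\<lambda>z. A z $ l $ i) z)"
proof -
  define C where "C = matrix_inv (A z)"
  \<comment> \<open>normalised to be the identity at the given point only\<close>
  let ?B = "\<lambda>z. C ** A z"
  have B: "?B z = mat 1" by (simp add: C_def matrix_inv_mult[OF inv])
  have Bc: "?B z $ i $ j = (\<Sum>l\<in>UNIV. C $ i $ l * A z $ l $ j)" for z i j
    by (simp add: matrix_matrix_mult_def)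
  have dB: "(\<lambda>z. ?B z $ i $ j) differentiable (at z)" for i j
    unfolding Bc by (intro differentiable_sum ballI differentiable_mult differentiable_const d finite)
  have "A z' = A z ** ?B z'" for z'
    by (simp add: matrix_mul_assoc C_def matrix_inv_mult[OF inv])
  then have "det (A z') = det (A z) * det (?B z')" for z'
    by (metis det_mul)
  then have "(\<lambda>z. det (A z)) = (\<lambda>z'. det (A z) * det (?B z'))" by (rule ext)
  then have "dir_deriv v (\<lambda>z. det (A z)) z = dir_deriv v (\<lambda>z'. det (A z) * det (?B z')) z" by metis
  also have "\<dots> = det (A z) * (\<Sum>i\<in>UNIV. dir_deriv v (\<lambda>z. ?B z $ i $ i) z)"
    using dir_deriv_det_at_identity[OF dB B] by (simp add: dir_deriv_cmult)
  finally have 1: "dir_deriv v (\<lambda>z. det (A z)) z = det (A z) * (\<Sum>i\<in>UNIV. dir_deriv v (\<lambda>z. ?B z $ i $ i) z)" .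
  have "dir_deriv v (\<lambda>z. ?B z $ i $ i) z = (\<Sum>l\<in>UNIV. C $ i $ l * dir_deriv v (\<lambda>z. A z $ l $ i) z)" for i
    unfolding Bc
    by (subst dir_deriv_sum, intro differentiable_mult differentiable_const d)
       (intro sum.cong refl dir_deriv_cmult d)
  with 1 show ?thesis by (simp add: C_def)
qed

text \<open>
  Both \<open>w\<close> and \<open>-w\<close> are limits of points of the plane of \<open>v\<close> and \<open>w\<close> off the line through \<open>w\<close>.
\<close>

lemma limit_along_line:
  fixes \<phi> :: "real^'n \<Rightarrow> real" and v w :: "real^'n"
  assumes cont: "continuous_on (UNIV - {0}) \<phi>" and w: "w \<noteq> 0"
    and eq: "\<And>t s. t \<noteq> 0 \<Longrightarrow> \<phi> (s *\<^sub>R w + t *\<^sub>R v) = c" 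
  shows "\<phi> w = c" "\<phi> (- w) = c"
proof -
  have "\<phi> (s *\<^sub>R w) = c" if "s \<noteq> 0" for s
  proof -
    have "continuous (at (s *\<^sub>R w)) \<phi>"
      using cont w that by (simp add: continuous_on_eq_continuous_at open_Diff)
    then have "isCont \<phi> (s *\<^sub>R w + 0 *\<^sub>R v)" by simp
    then have "isCont (\<lambda>t. \<phi> (s *\<^sub>R w + t *\<^sub>R v)) 0"
      by (intro isCont_o2[where g = \<phi> and f = "\<lambda>t. s *\<^sub>R w + t *\<^sub>R v"] continuous_intros)
    then have "(\<lambda>t. \<phi> (s *\<^sub>R w + t *\<^sub>R v)) \<midarrow>0\<rightarrow> \<phi> (s *\<^sub>R w)" by (simp add: isCont_def)
    moreover have "(\<lambda>t. \<phi> (s *\<^sub>R w + t *\<^sub>R v)) \<midarrow>0\<rightarrow> c"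
      by (rule tendsto_eventually) (auto simp: eventually_at_filter eq)
    ultimately show ?thesis using LIM_unique by blast
  qed
  from this[of 1] this[of "-1"] show "\<phi> w = c" "\<phi> (- w) = c" by auto
qed

lemma sum_frame_form: "(\<Sum>k\<in>UNIV. \<Sum>l\<in>UNIV. A $ k $ l * u $ k * v $ l) = u \<bullet> (A *v (v::real^'n))"
  by (simp add: inner_vec_def matrix_vector_mult_def sum_distrib_left mult_ac)

text \<open>
  The Gram-Schmidt process: as long as there are fewer vectors than dimensions, some nonzero \<open>w\<close> is
  orthogonal to the images of all of them under \<open>A\<close>.
\<close>

lemma orthonormal_frame_extension:
  fixes A :: "real^'n^'n"
  assumes pd: "\<And>w. w \<noteq> 0 \<Longrightarrow> w \<bullet> (A *v w) > 0"
    and sym: "\<And>v w. v \<bullet> (A *v w) = w \<bullet> (A *v v)"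
    and v: "v \<bullet> (A *v v) = 1"
    and J: "finite J" "a \<notin> J" "card J < CARD('n)"
  shows "\<exists>u. u a = v \<and> (\<forall>i\<in>insert a J. \<forall>j\<in>insert a J. u i \<bullet> (A *v u j) = (if i = j then 1 else 0))"
  using J
proof (induction J rule: finite_induct)
  case empty
  then show ?case using v by (intro exI[of _ "\<lambda>_. v"]) auto
next
  case (insert b J)
  have "\<exists>u. u a = v \<and> (\<forall>i\<in>insert a J. \<forall>j\<in>insert a J. u i \<bullet> (A *v u j) = (if i = j then 1 else 0))"
    using insert.prems insert.hyps by (intro insert.IH) auto
  then obtain u where u: "u a = v"
    "\<And>i j. i \<in> insert a J \<Longrightarrow> j \<in> insert a J \<Longrightarrow> u i \<bullet> (A *v u j) = (if i = j then 1 else 0)"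
    by blast
  let ?S = "(\<lambda>i. A *v u i) ` insert a J"
  have "dim ?S \<le> card ?S" using insert by (intro dim_le_card') auto
  also have "\<dots> \<le> card (insert a J)" by (rule card_image_le) (use insert in auto)
  also have "\<dots> < DIM(real^'n)" using insert by simp
  finally obtain w where w: "w \<noteq> 0" "\<And>x. x \<in> span ?S \<Longrightarrow> orthogonal w x"
    using orthogonal_to_subspace_exists by blast
  have w0: "w \<bullet> (A *v u i) = 0" if "i \<in> insert a J" for i
    using w(2)[of "A *v u i"] that by (auto simp: orthogonal_def intro: span_base)
  define r where "r = sqrt (w \<bullet> (A *v w))"
  have r: "r > 0" "r * r = w \<bullet> (A *v w)" using pd[OF w(1)] by (auto simp: r_def)
  let ?w = "(1 / r) *\<^sub>R w"
  have ww: "?w \<bullet> (A *v ?w) = 1"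
    using r(1) by (simp add: matrix_vector_mult_scaleR r(2)[symmetric])
  have wi: "?w \<bullet> (A *v u i) = 0" "u i \<bullet> (A *v ?w) = 0" if "i \<in> insert a J" for i
    using w0[OF that] sym[of "u i" ?w] by auto
  have ab: "a \<noteq> b" "b \<notin> J" using insert by auto
  show ?case
  proof (intro exI[of _ "u(b := ?w)"] conjI ballI)
    show "(u(b := ?w)) a = v" using ab u by simp
    fix i j assume "i \<in> insert a (insert b J)" "j \<in> insert a (insert b J)"
    then show "(u(b := ?w)) i \<bullet> (A *v (u(b := ?w)) j) = (if i = j then 1 else 0)"
      using ab u(2) ww wi by (cases "i = b"; cases "j = b") auto
  qed
qed

text \<open>
  If \<open>P\<close> has the frame vectors as columns, orthonormality says that \<open>A P\<close> is a right inverse of the transpose of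
  \<open>P\<close>, hence also a left inverse. Frame indices are numbers and coordinate indices are elements of a
  type, so the columns are labelled through a bijection.
\<close>

lemma orthonormal_frame_completeness:
  fixes A :: "real^'n^'n" and u :: "nat \<Rightarrow> real^'n"
  assumes "\<And>i j. i \<in> {1..CARD('n)} \<Longrightarrow> j \<in> {1..CARD('n)} \<Longrightarrow> u i \<bullet> (A *v u j) = (if i = j then 1 else 0)"
  shows "(\<Sum>i=1..CARD('n). (A *v u i) $ a * u i $ b) = (if a = b then 1 else 0)"
proof -
  obtain h where h: "bij_betw h (UNIV :: 'n set) {1..CARD('n)}"
    by (metis finite_same_card_bij finite_atLeastAtMost finite card_atLeastAtMost diff_Suc_1)
  define P where "P = (\<chi> k i. u (h i) $ k)"
  have col: "column i P = u (h i)" for i by (simp add: P_def column_def vec_eq_iff)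
  have hI: "h i \<in> {1..CARD('n)}" for i using h bij_betwE by blast
  have "transpose P ** (A ** P) = mat 1"
  proof -
    have "(transpose P ** (A ** P)) $ i $ j = u (h i) \<bullet> (A *v u (h j))" for i j
      by (simp add: matrix_matrix_mult_def transpose_def P_def inner_vec_def matrix_vector_mult_def)
    then show ?thesis
      using assms[OF hI hI] h by (simp add: vec_eq_iff mat_def bij_betw_def inj_eq)
  qed
  then have "(A ** P) ** transpose P = mat 1" using matrix_left_right_inverse by blast
  then have "((A ** P) ** transpose P) $ a $ b = (if a = b then 1 else 0)" by (simp add: mat_def)
  moreover have "((A ** P) ** transpose P) $ a $ b = (\<Sum>i\<in>UNIV. (A *v u (h i)) $ a * u (h i) $ b)"
    by (simp add: matrix_matrix_mult_def transpose_def P_def matrix_vector_mult_def)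
  moreover have "\<dots> = (\<Sum>i=1..CARD('n). (A *v u i) $ a * u i $ b)"
    by (rule sum.reindex_bij_betw[OF h])
  ultimately show ?thesis by simp
qed


section \<open>The spray and the S-curvature of a Finsler metric\<close>

locale finsler_chart = tangent_domain U for U :: "(real^'n::finite) set" +
  fixes F :: "'n tpoint \<Rightarrow> real"
  assumes smooth_F: "smooth_on (U \<times> (UNIV - {0})) F"
    and F_nonneg: "x \<in> U \<Longrightarrow> F (x, y) \<ge> 0"
    and F_scale: "x \<in> U \<Longrightarrow> t > 0 \<Longrightarrow> F (x, t *\<^sub>R y) = t * F (x, y)"
    and pos_def: "z \<in> U \<times> (UNIV - {0}) \<Longrightarrow> w \<noteq> 0 \<Longrightarrow> w \<bullet> (fund_tensor F z *v w) > 0"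
begin

abbreviation L :: "'n tpoint \<Rightarrow> real" where "L \<equiv> \<lambda>z. (F z)\<^sup>2"
abbreviation g :: "'n tpoint \<Rightarrow> real^'n^'n" where "g \<equiv> fund_tensor F"

lemma homog_F: "homog 1 F"
  by (simp add: homog_def F_scale)

lemma smooth_L: "smooth L"
  by (intro smooth_intros smooth_F)

lemma homog_L: "homog 2 L"
  by (auto simp: homog_def F_scale power_mult_distrib)

lemma homog_dy_L: "homog 1 (dy i L)"
  by (rule homog_dy[OF _ smooth_L]) (use homog_L in \<open>simp only: Suc_1\<close>)

lemma g_component: "g z $ i $ j = (1/2) * dy j (dy i L) z"
  by (simp add: fund_tensor_def)

lemma g_symmetric: "z \<in> slit \<Longrightarrow> g z $ i $ j = g z $ j $ i"
  by (simp add: g_component dy_commute[OF smooth_L])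

lemma smooth_g: "smooth (\<lambda>z. g z $ i $ j)"
  unfolding g_component by (intro smooth_intros smooth_L)

lemma homog_g: "homog 0 (\<lambda>z. g z $ i $ j)"
  unfolding g_component by (rule homog_cmult, rule homog_dy) (use homog_dy_L in \<open>auto intro!: smooth_dy smooth_L\<close>)

lemma g_mult_y: "z \<in> slit \<Longrightarrow> (g z *v snd z) $ i = (1/2) * dy i L z"
  using euler_homogeneous[OF homog_dy_L smooth_dy[OF smooth_L], of z i]
  by (simp add: matrix_vector_mult_def g_component sum_divide_distrib[symmetric] mult.commute)

lemma g_yy: "z \<in> slit \<Longrightarrow> snd z \<bullet> (g z *v snd z) = L z"
  using euler_homogeneous[OF homog_L smooth_L, of z]
  by (simp add: inner_vec_def g_mult_y sum_divide_distrib[symmetric])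

lemma F_pos:
  assumes "z \<in> slit" shows "F z > 0"
proof -
  have "L z > 0" using pos_def[OF assms, of "snd z"] g_yy[OF assms] assms by auto
  moreover have "F z \<ge> 0" using F_nonneg[of "fst z" "snd z"] assms by auto
  ultimately show ?thesis by (metis less_eq_real_def power_zero_numeral less_irrefl)
qed

lemma dir_deriv_L: "z \<in> slit \<Longrightarrow> dir_deriv v L z = 2 * F z * dir_deriv v F z"
  using dir_deriv_mult[of F z F v] smooth_differentiable[OF smooth_F] by (simp add: power2_eq_square)

lemma dy_L: "z \<in> slit \<Longrightarrow> dy i L z = 2 * F z * dy i F z"
  by (simp add: dy_dir_deriv dir_deriv_L)

lemma dx_L: "z \<in> slit \<Longrightarrow> dx i L z = 2 * F z * dx i F z"
  by (simp add: dx_dir_deriv dir_deriv_L)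

lemma g_mult_y_F: "z \<in> slit \<Longrightarrow> (g z *v snd z) $ i = F z * dy i F z"
  by (simp add: g_mult_y dy_L)

lemma g_FF:
  assumes "z \<in> slit"
  shows "g z $ i $ j = F z * dy j (dy i F) z + dy i F z * dy j F z"
proof -
  have "dy j (dy i L) z = dy j (\<lambda>z. 2 * (F z * dy i F z)) z"
    using assms by (intro dy_slit_cong) (simp_all add: dy_L)
  also have "\<dots> = 2 * dy j (\<lambda>z. F z * dy i F z) z"
    unfolding dy_dir_deriv by (intro dir_deriv_cmult smooth_differentiable[OF _ assms] smooth_intros smooth_F)
  also have "dy j (\<lambda>z. F z * dy i F z) z = F z * dy j (dy i F) z + dy j F z * dy i F z"
    unfolding dy_dir_deriv by (intro dir_deriv_mult smooth_differentiable[OF _ assms] smooth_intros smooth_F)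
  finally show ?thesis by (simp add: g_component)
qed

lemma g_invertible: "z \<in> slit \<Longrightarrow> invertible (g z)"
  using pos_def pos_def_invertible by blast

lemma det_g_pos: "z \<in> slit \<Longrightarrow> det (g z) > 0"
  using pos_def pos_def_det_pos by blast

lemma smooth_det_g: "smooth (\<lambda>z. det (g z))"
  by (intro smooth_on_det open_slit smooth_g)

lemma smooth_ginv: "smooth (\<lambda>z. matrix_inv (g z) $ i $ l)"
proof (rule smooth_on_cong[OF open_slit])
  show "smooth (\<lambda>z. det (\<chi> a b. if b = i then axis l 1 $ a else g z $ a $ b) / det (g z))"
  proof (intro smooth_on_divide open_slit smooth_on_det smooth_g)
    show "smooth (\<lambda>z. (\<chi> a b. if b = i then axis l 1 $ a else g z $ a $ b) $ a $ b)" for a b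
      by (cases "b = i") (simp_all add: smooth_g)
  qed (use det_g_pos in force)
qed (simp add: matrix_inv_component g_invertible)

lemma smooth_spray: "smooth (spray F i)"
  unfolding spray_def[abs_def] by (intro smooth_intros smooth_ginv smooth_L)

lemma homog_spray: "homog 2 (spray F i)"
proof -
  have gg: "g (x, t *\<^sub>R y) = g (x, y)" if "x \<in> U" "y \<noteq> 0" "t > 0" for x y t
    using homog_g that by (auto simp: homog_def vec_eq_iff)
  have "homog 0 (\<lambda>z. matrix_inv (g z) $ i $ l)" for l
    by (simp add: homog_def gg)
  moreover have "homog 2 (\<lambda>z. (\<Sum>k\<in>UNIV. dy l (dx k L) z * snd z $ k) - dx l L z)" for l
  proof (intro homog_diff homog_sum homog_dx homog_L smooth_L)
    show "homog 2 (\<lambda>z. dy l (dx k L) z * snd z $ k)" for k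
      using homog_mult[OF homog_dy[of 1 "dx k L" l] homog_coord[of k]] homog_dx[OF homog_L smooth_L, of k] smooth_L smooth_dx
      by (simp add: numeral_2_eq_2)
  qed
  ultimately have "homog (0 + 2) (\<lambda>z. matrix_inv (g z) $ i $ l * ((\<Sum>k\<in>UNIV. dy l (dx k L) z * snd z $ k) - dx l L z))" for l
    by (rule homog_mult)
  then show ?thesis unfolding spray_def[abs_def] by (intro homog_cmult homog_sum) (simp only: add_0)
qed

end

sublocale finsler_chart \<subseteq> spray_domain U "spray F"
  by unfold_locales (rule smooth_spray)

context finsler_chart
begin

lemma nonlin_conn_y: "z \<in> slit \<Longrightarrow> (\<Sum>i\<in>UNIV. snd z $ i * nonlin_conn F k i z) = 2 * spray F k z"
  using euler_homogeneous[OF homog_spray smooth_spray] by (simp add: nonlin_conn_def)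

lemma reeb_eq: "z \<in> slit \<Longrightarrow> reeb F z = (1 / F z) *\<^sub>R spray_vec z"
proof -
  assume z: "z \<in> slit"
  have 1: "fst (reeb F z) = (1 / F z) *\<^sub>R snd z"
    by (simp add: reeb_def delta_x_def fst_sum vec_eq_iff axis_def if_distrib[of "\<lambda>x. _ * x"] cong: if_cong)
  have "snd (reeb F z) $ k = - ((\<Sum>i\<in>UNIV. snd z $ i * nonlin_conn F k i z) / F z)" for k
    by (simp add: reeb_def delta_x_def snd_sum sum_divide_distrib sum_negf)
  then have "snd (reeb F z) = (1 / F z) *\<^sub>R snd (spray_vec z)"
    by (simp add: vec_eq_iff spray_vec_def nonlin_conn_y[OF z])
  with 1 show ?thesis by (simp add: prod_eq_iff spray_vec_def)
qed

text \<open>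
  The definition of the spray coefficients, solved for \<open>g G\<close>: geodesics are the extremals of the
  energy \<open>F^2\<close>.
\<close>

lemma euler_lagrange_L:
  assumes z: "z \<in> slit" shows "euler_lagrange l L z = 0"
proof -
  let ?b = "\<chi> l. (\<Sum>k\<in>UNIV. dy l (dx k L) z * snd z $ k) - dx l L z"
  have G: "(\<chi> i. spray F i z) = (1/4) *\<^sub>R (matrix_inv (g z) *v ?b)"
    by (simp add: vec_eq_iff spray_def matrix_vector_mult_def)
  have "g z *v (\<chi> i. spray F i z) = (1/4) *\<^sub>R ?b"
    unfolding G by (simp add: scaleR_matrix_vector_assoc[symmetric] matrix_vector_mult_scaleR matrix_vector_mul_assoc matrix_inv_mult[OF g_invertible[OF z]])
  then have "(g z *v (\<chi> i. spray F i z)) $ l = (1/4) * ?b $ l" by simp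
  moreover have "(g z *v (\<chi> i. spray F i z)) $ l = (1/2) * (\<Sum>j\<in>UNIV. spray F j z * dy j (dy l L) z)"
    by (simp add: matrix_vector_mult_def g_component mult.commute sum_divide_distrib)
  ultimately have "2 * (\<Sum>j\<in>UNIV. spray F j z * dy j (dy l L) z) = ?b $ l" by simp
  then show ?thesis
    unfolding euler_lagrange_def spray_deriv_expand[OF smooth_dy[OF smooth_L] z] using dx_dy_commute[OF smooth_L z]
    by (simp add: mult.commute)
qed

text \<open>
  Conservation of energy: the Euler-Lagrange equation is contracted with \<open>y\<close>, and homogeneity turns the
  derivative of \<open>y^l dL/dy^l\<close> along the spray into that of \<open>2 L\<close>.
\<close>

lemma spray_deriv_L:
  assumes z: "z \<in> slit" shows "spray_deriv L z = 0"
proof -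
  have "spray_deriv (\<lambda>z. \<Sum>l\<in>UNIV. snd z $ l * dy l L z) z = spray_deriv (\<lambda>z. 2 * L z) z"
    using euler_homogeneous[OF homog_L smooth_L] by (intro spray_deriv_slit_cong z) simp
  also have "\<dots> = 2 * spray_deriv L z" by (rule spray_deriv_cmult[OF smooth_L z])
  finally have 1: "spray_deriv (\<lambda>z. \<Sum>l\<in>UNIV. snd z $ l * dy l L z) z = 2 * spray_deriv L z" .
  have "spray_deriv (\<lambda>z. \<Sum>l\<in>UNIV. snd z $ l * dy l L z) z = (\<Sum>l\<in>UNIV. spray_deriv (\<lambda>z. snd z $ l * dy l L z) z)"
    by (intro spray_deriv_sum z smooth_intros smooth_L)
  also have "\<dots> = (\<Sum>l\<in>UNIV. snd z $ l * spray_deriv (dy l L) z + spray_deriv (\<lambda>z. snd z $ l) z * dy l L z)"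
    by (intro sum.cong refl spray_deriv_mult z smooth_intros smooth_L)
  also have "\<dots> = (\<Sum>l\<in>UNIV. snd z $ l * dx l L z) - 2 * (\<Sum>l\<in>UNIV. spray F l z * dy l L z)"
    using euler_lagrange_L[OF z] by (simp add: euler_lagrange_def spray_deriv_coord sum.distrib sum_negf sum_subtractf sum_distrib_left mult.assoc)
  also have "\<dots> = spray_deriv L z" by (rule spray_deriv_expand[OF smooth_L z, symmetric])
  finally show ?thesis using 1 by simp
qed

lemma spray_deriv_F: "z \<in> slit \<Longrightarrow> spray_deriv F z = 0"
  using spray_deriv_L[of z] F_pos[of z] by (simp add: spray_deriv_def dir_deriv_L)

lemma euler_lagrange_F:
  assumes z: "z \<in> slit" shows "euler_lagrange k F z = 0"
proof -
  have "spray_deriv (dy k L) z = spray_deriv (\<lambda>z. 2 * (F z * dy k F z)) z"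
    by (intro spray_deriv_slit_cong z) (simp add: dy_L)
  also have "\<dots> = 2 * spray_deriv (\<lambda>z. F z * dy k F z) z"
    by (intro spray_deriv_cmult z smooth_intros smooth_F)
  also have "spray_deriv (\<lambda>z. F z * dy k F z) z = F z * spray_deriv (dy k F) z + spray_deriv F z * dy k F z"
    by (intro spray_deriv_mult z smooth_intros smooth_F)
  finally have "2 * F z * spray_deriv (dy k F) z = 2 * F z * dx k F z"
    using euler_lagrange_L[OF z, of k] spray_deriv_F[OF z] dx_L[OF z] by (simp add: euler_lagrange_def)
  then show ?thesis using F_pos[OF z] by (simp add: euler_lagrange_def)
qed

text \<open>
  The Euler-Lagrange equation is differentiated in \<open>y\<close> and symmetrised; the mixed derivatives in \<open>x\<close>
  and \<open>y\<close> cancel.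
\<close>

lemma spray_deriv_g:
  assumes z: "z \<in> slit"
  shows "spray_deriv (\<lambda>z. g z $ k $ l) z
    = (\<Sum>j\<in>UNIV. dy k (spray F j) z * g z $ j $ l) + (\<Sum>j\<in>UNIV. dy l (spray F j) z * g z $ j $ k)"
proof -
  have *: "spray_deriv (dy k (dy l L)) z = dy k (dx l L) z - dx k (dy l L) z + 2 * (\<Sum>j\<in>UNIV. dy k (spray F j) z * dy j (dy l L) z)" for k l
  proof -
    have "dy k (spray_deriv (dy l L)) z = dy k (dx l L) z"
      using euler_lagrange_L by (intro dy_slit_cong z) (simp add: euler_lagrange_def)
    then show ?thesis using dy_spray_deriv[OF smooth_dy[OF smooth_L] z, of k l] by simp
  qed
  \<comment> \<open>symmetry of the Hessian allows averaging the identity over both orders\<close>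
  have c: "spray_deriv (dy k (dy l L)) z = spray_deriv (dy l (dy k L)) z"
    by (intro spray_deriv_slit_cong z dy_commute smooth_L)
  have "2 * spray_deriv (dy l (dy k L)) z = spray_deriv (dy k (dy l L)) z + spray_deriv (dy l (dy k L)) z" using c by simp
  also have "\<dots> = 2 * (\<Sum>j\<in>UNIV. dy k (spray F j) z * dy j (dy l L) z) + 2 * (\<Sum>j\<in>UNIV. dy l (spray F j) z * dy j (dy k L) z)"
    unfolding * using dx_dy_commute[OF smooth_L z] by simp
  finally have "spray_deriv (dy l (dy k L)) z
    = (\<Sum>j\<in>UNIV. dy k (spray F j) z * dy j (dy l L) z) + (\<Sum>j\<in>UNIV. dy l (spray F j) z * dy j (dy k L) z)" by simp
  moreover have "spray_deriv (\<lambda>z. g z $ k $ l) z = (1/2) * spray_deriv (dy l (dy k L)) z"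
    unfolding g_component by (intro spray_deriv_cmult z smooth_intros smooth_L)
  moreover have 3: "(\<Sum>j\<in>UNIV. dy a (spray F j) z * g z $ j $ b) = (1/2) * (\<Sum>j\<in>UNIV. dy a (spray F j) z * dy j (dy b L) z)" for a b
    by (simp add: sum_distrib_left g_component dy_commute[OF smooth_L z, of b])
  ultimately show ?thesis unfolding 3 by (simp add: distrib_left)
qed

lemma spray_deriv_det_g:
  assumes z: "z \<in> slit"
  shows "spray_deriv (\<lambda>z. det (g z)) z = 2 * det (g z) * spray_div z"
proof -
  let ?h = "matrix_inv (g z)" and ?N = "\<lambda>k j. dy k (spray F j) z"
  note inv = matrix_inv_mult[OF g_invertible[OF z]]
  have "spray_deriv (\<lambda>z. det (g z)) z = det (g z) * (\<Sum>i\<in>UNIV. \<Sum>l\<in>UNIV. ?h $ i $ l * spray_deriv (\<lambda>z. g z $ l $ i) z)"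
    unfolding spray_deriv_def by (rule dir_deriv_det) (auto intro!: smooth_differentiable[OF smooth_g] z g_invertible)
  also have "(\<Sum>i\<in>UNIV. \<Sum>l\<in>UNIV. ?h $ i $ l * spray_deriv (\<lambda>z. g z $ l $ i) z)
    = (\<Sum>i\<in>UNIV. \<Sum>l\<in>UNIV. \<Sum>j\<in>UNIV. ?N l j * (g z $ j $ i * ?h $ i $ l))
    + (\<Sum>i\<in>UNIV. \<Sum>l\<in>UNIV. \<Sum>j\<in>UNIV. ?N i j * (?h $ i $ l * g z $ l $ j))"
    unfolding spray_deriv_g[OF z]
    by (simp add: distrib_left sum.distrib sum_distrib_left g_symmetric[OF z] mult.commute mult.left_commute)
  also have "(\<Sum>i\<in>UNIV. \<Sum>l\<in>UNIV. \<Sum>j\<in>UNIV. ?N l j * (g z $ j $ i * ?h $ i $ l))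
    = (\<Sum>l\<in>UNIV. \<Sum>j\<in>UNIV. ?N l j * (g z ** ?h) $ j $ l)"
    by (rule trans[OF sum.swap], rule sum.cong[OF refl], rule trans[OF sum.swap])
       (simp add: matrix_matrix_mult_def sum_distrib_left)
  also have "\<dots> = spray_div z"
    unfolding inv by (simp add: mat_def spray_div_def if_distrib[of "\<lambda>x. _ * x"] cong: if_cong)
  also have "(\<Sum>i\<in>UNIV. \<Sum>l\<in>UNIV. \<Sum>j\<in>UNIV. ?N i j * (?h $ i $ l * g z $ l $ j))
    = (\<Sum>i\<in>UNIV. \<Sum>j\<in>UNIV. ?N i j * (?h ** g z) $ i $ j)"
    by (rule sum.cong[OF refl], rule trans[OF sum.swap]) (simp add: matrix_matrix_mult_def sum_distrib_left)
  also have "\<dots> = spray_div z"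
    unfolding inv by (simp add: mat_def spray_div_def if_distrib[of "\<lambda>x. _ * x"] cong: if_cong)
  finally show ?thesis by simp
qed

text \<open>
  The distortion is \<open>1/2 ln (det g) - ln \<sigma>\<^sub>0\<close>, and by Jacobi's formula the first term grows along the spray at the rate
  given by the divergence of the spray coefficients.
\<close>

lemma S_curv_eq:
  assumes s: "smooth_on U s" "\<And>x. x \<in> U \<Longrightarrow> s x > 0" and z: "z \<in> slit"
  shows "F z * S_curv F s z = spray_div z - spray_deriv (\<lambda>z. ln (s (fst z))) z"
proof -
  let ?l = "\<lambda>z::'n tpoint. ln (s (fst z))"
  have sl: "smooth ?l" by (rule smooth_fst[of "\<lambda>x. ln (s x)"]) (intro smooth_on_ln open_U s)
  have sd: "smooth (\<lambda>z. ln (det (g z)))" by (intro smooth_on_ln open_slit smooth_det_g det_g_pos)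
  have eq: "distortion F s z = (1/2) * ln (det (g z)) - ?l z" if "z \<in> slit" for z
    using det_g_pos[OF that] s(2)[of "fst z"] that
    by (auto simp: distortion_def ln_div ln_sqrt)
  have "smooth (distortion F s)"
    by (rule smooth_on_cong[OF open_slit eq[symmetric]], assumption, intro smooth_intros sd sl)
  then have "S_curv F s z = (1 / F z) * spray_deriv (distortion F s) z"
    using linear_scale[OF linear_dir_deriv[OF smooth_differentiable[OF _ z]], of "distortion F s" "1 / F z" "spray_vec z"]
    by (simp add: S_curv_def dir_deriv_def[symmetric] spray_deriv_def reeb_eq[OF z])
  moreover have "spray_deriv (distortion F s) z = spray_deriv (\<lambda>z. (1/2) * ln (det (g z)) - ?l z) z"
    by (intro spray_deriv_slit_cong z eq)
  moreover have "\<dots> = spray_deriv (\<lambda>z. (1/2) * ln (det (g z))) z - spray_deriv ?l z"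
    by (intro spray_deriv_diff z sl smooth_intros sd)
  moreover have "spray_deriv (\<lambda>z. (1/2) * ln (det (g z))) z = (1/2) * spray_deriv (\<lambda>z. ln (det (g z))) z"
    by (intro spray_deriv_cmult z sd)
  moreover have "spray_deriv (\<lambda>z. ln (det (g z))) z = spray_deriv (\<lambda>z. det (g z)) z * inverse (det (g z))"
    unfolding spray_deriv_def by (intro dir_deriv_ln smooth_differentiable[OF smooth_det_g] z det_g_pos)
  ultimately show ?thesis
    using det_g_pos[OF z] F_pos[OF z] by (simp add: spray_deriv_det_g[OF z])
qed

lemma riemann_curv_eq: "z \<in> slit \<Longrightarrow> riemann_curv F i k z = spray_curv i k z"
  by (simp add: riemann_curv_def spray_curv_def spray_deriv_expand[OF smooth_dy[OF smooth_spray]])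

lemma homog_riemann: "homog 2 (riemann_curv F i k)"
proof -
  have G1: "homog 1 (dy k (spray F i))" for i k
    by (rule homog_dy[OF _ smooth_spray]) (use homog_spray in \<open>simp only: Suc_1\<close>)
  have 1: "homog 2 (\<lambda>z. snd z $ j * dx j (dy k (spray F i)) z)" for j
    using homog_mult[OF homog_coord homog_dx[OF G1 smooth_dy[OF smooth_spray]]] by (simp only: one_add_one)
  have 2: "homog 2 (\<lambda>z. spray F j z * dy j (dy k (spray F i)) z)" for j
    using homog_mult[OF homog_spray[of j] homog_dy[of 0 "dy k (spray F i)" j]] G1 smooth_dy[OF smooth_spray] by simp
  have 3: "homog 2 (\<lambda>z. dy j (spray F i) z * dy k (spray F j) z)" for j
    using homog_mult[OF G1[of j i] G1[of k j]] by (simp only: one_add_one)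
  show ?thesis unfolding riemann_curv_def[abs_def]
    by (intro homog_diff homog_add homog_cmult homog_sum 1 2 3 homog_dx homog_spray smooth_spray)
qed

lemma F_nonzero: "z \<in> slit \<Longrightarrow> F z \<noteq> 0"
  using F_pos[of z] by simp

lemma F_euler: "z \<in> slit \<Longrightarrow> (\<Sum>j\<in>UNIV. snd z $ j * dy j F z) = F z"
  using euler_homogeneous[OF homog_F smooth_F] by simp

lemma dyF_euler: "z \<in> slit \<Longrightarrow> (\<Sum>j\<in>UNIV. snd z $ j * dy j (dy k F) z) = 0"
  using euler_homogeneous[OF homog_dy[of 0 F k] smooth_dy[OF smooth_F]] homog_F smooth_F by simp

lemma g_sym_form:
  assumes "z \<in> slit" shows "v \<bullet> (g z *v w) = w \<bullet> (g z *v v)"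
proof -
  have t: "transpose (g z) = g z"
    using g_symmetric[OF assms] by (simp add: transpose_def vec_eq_iff)
  have "v \<bullet> (g z *v w) = (transpose (g z) *v v) \<bullet> w"
    by (simp only: transpose_matrix_vector dot_lmul_matrix)
  then show ?thesis by (simp only: t inner_commute)
qed

lemma adapted_frame_exists:
  assumes z: "z \<in> slit" shows "\<exists>u. adapted_frame F z u"
proof -
  have "(1 / F z) *\<^sub>R snd z \<bullet> (g z *v ((1 / F z) *\<^sub>R snd z)) = 1"
    using F_nonzero[OF z] by (simp add: matrix_vector_mult_scaleR g_yy[OF z] power2_eq_square)
  from orthonormal_frame_extension[OF pos_def[OF z] g_sym_form[OF z] this, of "{1..<CARD('n)}" "CARD('n)"]
  obtain u where u: "u CARD('n) = (1 / F z) *\<^sub>R snd z"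
    "\<forall>i\<in>insert CARD('n) {1..<CARD('n)}. \<forall>j\<in>insert CARD('n) {1..<CARD('n)}. u i \<bullet> (g z *v u j) = (if i = j then 1 else 0)"
    using zero_less_card_finite[where 'a = 'n] by auto
  have "insert CARD('n) {1..<CARD('n)} = {1..CARD('n)}"
    using zero_less_card_finite[where 'a = 'n] by auto
  with u(2) have "\<forall>i\<in>{1..CARD('n)}. \<forall>j\<in>{1..CARD('n)}. u i \<bullet> (g z *v u j) = (if i = j then 1 else 0)"
    by (simp only:)
  with u(1) have "adapted_frame F z u" unfolding adapted_frame_def sum_frame_form by blast
  then show ?thesis by blast
qed

text \<open>
  On a vertical vector \<open>Y\<close> the connection forms vanish, so only one half of the exterior derivative remains. The
  trace of the connection coefficients is a vertical derivative of the divergence.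
\<close>

lemma berwald_curv_trace:
  assumes z: "z \<in> slit" and Y: "fst Y = 0"
  shows "(\<Sum>i\<in>UNIV. berwald_curv F i i z V Y)
    = - (\<Sum>k\<in>UNIV. \<Sum>j\<in>UNIV. fst V $ k * snd Y $ j * dy j (dy k spray_div) z)"
proof -
  have c0: "berwald_conn F i j q Y = 0" for i j q using Y by (simp add: berwald_conn_def)
  have "berwald_curv F i i z V Y = - (\<Sum>k\<in>UNIV. fst V $ k * dir_deriv Y (dy i (dy k (spray F i))) z)" for i
  proof -
    have "berwald_curv F i i z V Y = - dir_deriv Y (\<lambda>q. berwald_conn F i i q V) z"
      by (simp add: berwald_curv_def ext_deriv_def wedge_def c0 dir_deriv_def)
    also have "dir_deriv Y (\<lambda>q. berwald_conn F i i q V) z = dir_deriv Y (\<lambda>q. \<Sum>k\<in>UNIV. fst V $ k * dy i (dy k (spray F i)) q) z"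
      by (simp add: berwald_conn_def mult.commute)
    also have "\<dots> = (\<Sum>k\<in>UNIV. dir_deriv Y (\<lambda>q. fst V $ k * dy i (dy k (spray F i)) q) z)"
      by (intro dir_deriv_sum smooth_differentiable[OF _ z] smooth_intros smooth_spray)
    also have "\<dots> = (\<Sum>k\<in>UNIV. fst V $ k * dir_deriv Y (dy i (dy k (spray F i))) z)"
      by (intro sum.cong refl dir_deriv_cmult smooth_differentiable[OF _ z] smooth_intros smooth_spray)
    finally show ?thesis .
  qed
  then have "(\<Sum>i\<in>UNIV. berwald_curv F i i z V Y) = - (\<Sum>i\<in>UNIV. \<Sum>k\<in>UNIV. fst V $ k * dir_deriv Y (dy i (dy k (spray F i))) z)"
    by (simp add: sum_negf)
  also have "(\<Sum>i\<in>UNIV. \<Sum>k\<in>UNIV. fst V $ k * dir_deriv Y (dy i (dy k (spray F i))) z)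
    = (\<Sum>k\<in>UNIV. \<Sum>i\<in>UNIV. fst V $ k * dir_deriv Y (dy i (dy k (spray F i))) z)" by (rule sum.swap)
  also have "\<dots> = (\<Sum>k\<in>UNIV. fst V $ k * dir_deriv Y (dy k spray_div) z)"
  proof (rule sum.cong[OF refl])
    fix k
    have "dir_deriv Y (dy k spray_div) z = dir_deriv Y (\<lambda>z. \<Sum>i\<in>UNIV. dy i (dy k (spray F i)) z) z"
      by (intro dir_deriv_slit_cong z dy_div)
    also have "\<dots> = (\<Sum>i\<in>UNIV. dir_deriv Y (dy i (dy k (spray F i))) z)"
      by (intro dir_deriv_sum smooth_differentiable[OF _ z] smooth_intros smooth_spray)
    finally show "(\<Sum>i\<in>UNIV. fst V $ k * dir_deriv Y (dy i (dy k (spray F i))) z) = fst V $ k * dir_deriv Y (dy k spray_div) z"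
      by (simp add: sum_distrib_left)
  qed
  also have "\<dots> = (\<Sum>k\<in>UNIV. \<Sum>j\<in>UNIV. fst V $ k * snd Y $ j * dy j (dy k spray_div) z)"
    using Y by (simp add: dir_deriv_coord_expand[OF smooth_dy[OF smooth_div] z] sum_distrib_left mult.assoc)
  finally show ?thesis .
qed

end


section \<open>Scalar flag curvature and isotropic S-curvature in coordinates\<close>

locale scalar_curved_chart = finsler_chart U F
  for U :: "(real^'n::finite) set" and F :: "'n tpoint \<Rightarrow> real" +
  fixes \<kappa> :: "'n tpoint \<Rightarrow> real"
  assumes card: "CARD('n) \<ge> 2"
    and scalar: "\<And>z i k. z \<in> U \<times> (UNIV - {0}) \<Longrightarrow> riemann_curv F i k z
      = \<kappa> z * ((F z)\<^sup>2 * (if i = k then 1 else 0) - F z * dy k F z * snd z $ i)"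
begin

lemma trace_riemann:
  assumes "z \<in> slit"
  shows "(\<Sum>m\<in>UNIV. riemann_curv F m m z) = (real CARD('n) - 1) * (\<kappa> z * L z)"
proof -
  have "(\<Sum>m\<in>UNIV. riemann_curv F m m z)
      = real CARD('n) * (\<kappa> z * L z) - \<kappa> z * F z * (\<Sum>m\<in>UNIV. snd z $ m * dy m F z)"
    by (simp add: scalar[OF assms] right_diff_distrib sum_subtractf sum_distrib_left mult_ac)
  then show ?thesis unfolding F_euler[OF assms] by (simp add: power2_eq_square algebra_simps)
qed

lemma \<kappa>_eq:
  assumes "z \<in> slit" shows "\<kappa> z = (\<Sum>m\<in>UNIV. riemann_curv F m m z) / ((real CARD('n) - 1) * L z)"
  using trace_riemann[OF assms] F_pos[OF assms] card by (simp add: field_simps)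

lemma smooth_\<kappa>: "smooth \<kappa>"
proof (rule smooth_on_cong[OF open_slit \<kappa>_eq[symmetric]])
  show "smooth (\<lambda>z. (\<Sum>m\<in>UNIV. riemann_curv F m m z) / ((real CARD('n) - 1) * L z))"
  proof (intro smooth_on_divide open_slit smooth_intros smooth_F)
    show "smooth (riemann_curv F m m)" for m
      by (rule smooth_on_cong[OF open_slit riemann_curv_eq[symmetric] smooth_spray_curv])
    show "(real CARD('n) - 1) * L z \<noteq> 0" if "z \<in> slit" for z
      using F_pos[OF that] card by simp
  qed
qed

lemma homog_\<kappa>: "homog 0 \<kappa>"
  unfolding homog_def
proof (intro ballI allI impI)
  fix x y :: "real^'n" and t :: real assume *: "x \<in> U" "y \<noteq> 0" "t > 0"
  then show "\<kappa> (x, t *\<^sub>R y) = t ^ 0 * \<kappa> (x, y)"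
    using homog_sum[where f = "\<lambda>m. riemann_curv F m m", OF homog_riemann, of UNIV] homog_L
    by (subst (1 2) \<kappa>_eq) (auto simp: homog_def)
qed

text \<open>
  The traces of \<open>trace_curv_deriv\<close>, evaluated on \<open>R^i_k = \<kappa> (F^2 \<delta>_ik - F F_k y^i)\<close>. By Euler's relations
  for \<open>F\<close>, \<open>F_k\<close> and \<open>\<kappa>\<close>, all undifferentiated terms in \<open>\<kappa>\<close> cancel.
\<close>

lemma curvature_derivative:
  assumes z: "z \<in> slit"
  shows "(real CARD('n) + 1) * L z * dy k \<kappa> z = - 3 * euler_lagrange k spray_div z"
proof -
  note d = smooth_differentiable[OF _ z]
  let ?n = "real CARD('n)"
  have A: "(\<Sum>m\<in>UNIV. dy k (spray_curv m m) z) = (?n - 1) * (dy k \<kappa> z * L z + 2 * \<kappa> z * F z * dy k F z)"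
  proof -
    have "(\<Sum>m\<in>UNIV. dy k (spray_curv m m) z) = dy k (\<lambda>z. \<Sum>m\<in>UNIV. spray_curv m m z) z"
      unfolding dy_dir_deriv by (intro dir_deriv_sum[symmetric] d smooth_spray_curv)
    also have "\<dots> = dy k (\<lambda>z. (?n - 1) * (\<kappa> z * L z)) z"
      using trace_riemann by (intro dy_slit_cong z) (simp add: riemann_curv_eq)
    also have "\<dots> = (?n - 1) * dy k (\<lambda>z. \<kappa> z * L z) z"
      unfolding dy_dir_deriv by (intro dir_deriv_cmult d smooth_intros smooth_\<kappa> smooth_F)
    also have "dy k (\<lambda>z. \<kappa> z * L z) z = \<kappa> z * dy k L z + dy k \<kappa> z * L z"
      unfolding dy_dir_deriv by (intro dir_deriv_mult d smooth_\<kappa> smooth_L)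
    finally show ?thesis by (simp add: dy_L[OF z] algebra_simps)
  qed
  have "dy m (spray_curv m k) z = (if m = k then \<kappa> z * (2 * F z * dy m F z) + dy m \<kappa> z * L z else 0)
      - (dy m \<kappa> z * F z * dy k F z * snd z $ m + \<kappa> z * dy m F z * dy k F z * snd z $ m
         + \<kappa> z * F z * dy m (dy k F) z * snd z $ m + \<kappa> z * F z * dy k F z)" for m
  proof -
    let ?c = "if m = k then 1 else 0 :: real"
    have "dy m (spray_curv m k) z = dy m (\<lambda>z. ?c * (\<kappa> z * L z) - \<kappa> z * F z * dy k F z * snd z $ m) z"
      by (intro dy_slit_cong z) (simp add: riemann_curv_eq[symmetric] scalar algebra_simps)
    also have "\<dots> = dy m (\<lambda>z. ?c * (\<kappa> z * L z)) z - dy m (\<lambda>z. \<kappa> z * F z * dy k F z * snd z $ m) z"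
      unfolding dy_dir_deriv by (intro dir_deriv_diff d smooth_intros smooth_\<kappa> smooth_F)
    also have "dy m (\<lambda>z. ?c * (\<kappa> z * L z)) z = ?c * dy m (\<lambda>z. \<kappa> z * L z) z"
      unfolding dy_dir_deriv by (intro dir_deriv_cmult d smooth_intros smooth_\<kappa> smooth_F)
    also have "dy m (\<lambda>z. \<kappa> z * L z) z = \<kappa> z * dy m L z + dy m \<kappa> z * L z"
      unfolding dy_dir_deriv by (intro dir_deriv_mult d smooth_\<kappa> smooth_L)
    also have "dy m (\<lambda>z. \<kappa> z * F z * dy k F z * snd z $ m) z
        = \<kappa> z * F z * dy k F z * dy m (\<lambda>z. snd z $ m) z + dy m (\<lambda>z. \<kappa> z * F z * dy k F z) z * snd z $ m"
      unfolding dy_dir_deriv by (intro dir_deriv_mult d smooth_intros smooth_\<kappa> smooth_F)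
    also have "dy m (\<lambda>z. snd z $ m) z = 1" by (simp add: dy_dir_deriv dir_deriv_coord)
    also have "dy m (\<lambda>z. \<kappa> z * F z * dy k F z) z
        = \<kappa> z * F z * dy m (dy k F) z + dy m (\<lambda>z. \<kappa> z * F z) z * dy k F z"
      unfolding dy_dir_deriv by (intro dir_deriv_mult d smooth_intros smooth_\<kappa> smooth_F)
    also have "dy m (\<lambda>z. \<kappa> z * F z) z = \<kappa> z * dy m F z + dy m \<kappa> z * F z"
      unfolding dy_dir_deriv by (intro dir_deriv_mult d smooth_\<kappa> smooth_F)
    finally show ?thesis by (simp add: dy_L[OF z] algebra_simps)
  qed
  then have "(\<Sum>m\<in>UNIV. dy m (spray_curv m k) z) = \<kappa> z * (2 * F z * dy k F z) + dy k \<kappa> z * L z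
      - (F z * dy k F z * (\<Sum>m\<in>UNIV. snd z $ m * dy m \<kappa> z) + \<kappa> z * dy k F z * (\<Sum>m\<in>UNIV. snd z $ m * dy m F z)
         + \<kappa> z * F z * (\<Sum>m\<in>UNIV. snd z $ m * dy m (dy k F) z) + ?n * (\<kappa> z * F z * dy k F z))"
    by (simp add: sum_subtractf sum.distrib sum_distrib_left mult_ac)
  then have B: "(\<Sum>m\<in>UNIV. dy m (spray_curv m k) z) = dy k \<kappa> z * L z - (?n - 1) * (\<kappa> z * F z * dy k F z)"
    unfolding F_euler[OF z] dyF_euler[OF z] euler_homogeneous[OF homog_\<kappa> smooth_\<kappa> z] by (simp add: algebra_simps)
  show ?thesis
    unfolding trace_curv_deriv[OF z, symmetric] A B by (simp add: algebra_simps)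
qed

text \<open>
  What remains of the flag curvature after the contribution of a one-form \<open>dh\<close>. With
  \<open>h = c/(n - 1)\<close> it is the difference of \<open>K\<close> and \<open>3/(n^2 - 1) dc(G)\<close>, written for vectors \<open>y\<close> of
  any length.
\<close>

definition flag_defect :: "(real^'n \<Rightarrow> real) \<Rightarrow> 'n tpoint \<Rightarrow> real"
  where "flag_defect h z = \<kappa> z - 3 / (real CARD('n) + 1) * (dir_deriv (snd z) h (fst z) / F z)"

lemma smooth_flag_defect: "smooth_on U h \<Longrightarrow> smooth (flag_defect h)"
  unfolding flag_defect_def[abs_def]
  by (intro smooth_on_diff open_slit smooth_\<kappa> smooth_on_mult smooth_on_const smooth_on_divide smooth_directional smooth_F)
     (assumption | rule F_nonzero)+

end

text \<open>
  Weakly isotropic S-curvature, multiplied by \<open>F\<close> and expressed through the divergence of the spray: \<open>l\<close>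
  stands for \<open>ln \<sigma>\<^sub>0\<close>, \<open>\<beta>\<close> for \<open>b/(n - 1)\<close>, and \<open>a\<close> for the coefficients of \<open>\<xi>\<close>.
\<close>

locale isotropic_S_chart = scalar_curved_chart U F \<kappa>
  for U :: "(real^'n::finite) set" and F \<kappa> :: "'n tpoint \<Rightarrow> real" +
  fixes l \<beta> :: "real^'n \<Rightarrow> real" and a :: "'n \<Rightarrow> real^'n \<Rightarrow> real"
  assumes l: "smooth_on U l" and \<beta>: "smooth_on U \<beta>" and a: "\<And>i. smooth_on U (a i)"
    and div: "\<And>z. z \<in> slit \<Longrightarrow> spray_div z = spray_deriv (\<lambda>z. l (fst z)) z + (\<beta> (fst z) * F z + (\<Sum>i\<in>UNIV. a i (fst z) * snd z $ i))"
begin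

lemma euler_lagrange_div:
  assumes z: "z \<in> slit"
  shows "euler_lagrange k spray_div z = dir_deriv (snd z) \<beta> (fst z) * dy k F z - dir_deriv (axis k 1) \<beta> (fst z) * F z
    + (\<Sum>m\<in>UNIV. snd z $ m * (dir_deriv (axis m 1) (a k) (fst z) - dir_deriv (axis k 1) (a m) (fst z)))"
proof -
  have sl: "smooth (\<lambda>z. l (fst z))" using l by (rule smooth_fst)
  have "euler_lagrange k spray_div z = euler_lagrange k (\<lambda>z. spray_deriv (\<lambda>z. l (fst z)) z + (\<beta> (fst z) * F z + (\<Sum>i\<in>UNIV. a i (fst z) * snd z $ i))) z"
    by (intro euler_lagrange_slit_cong z div)
  also have "\<dots> = euler_lagrange k (spray_deriv (\<lambda>z. l (fst z))) z + euler_lagrange k (\<lambda>z. \<beta> (fst z) * F z + (\<Sum>i\<in>UNIV. a i (fst z) * snd z $ i)) z"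
    by (intro euler_lagrange_add smooth_spray_deriv sl smooth_intros smooth_F \<beta> a z)
  also have "euler_lagrange k (\<lambda>z. \<beta> (fst z) * F z + (\<Sum>i\<in>UNIV. a i (fst z) * snd z $ i)) z
    = euler_lagrange k (\<lambda>z. \<beta> (fst z) * F z) z + euler_lagrange k (\<lambda>z. \<Sum>i\<in>UNIV. a i (fst z) * snd z $ i) z"
    by (intro euler_lagrange_add smooth_intros smooth_F \<beta> a z)
  also have "euler_lagrange k (\<lambda>z. \<beta> (fst z) * F z) z = dir_deriv (snd z) \<beta> (fst z) * dy k F z - dir_deriv (axis k 1) \<beta> (fst z) * F z"
  proof -
    have "dy k (\<lambda>z. \<beta> (fst z) * F z) z = \<beta> (fst z) * dy k F z + dy k (\<lambda>z. \<beta> (fst z)) z * F z" if "z \<in> slit" for z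
      unfolding dy_dir_deriv by (intro dir_deriv_mult smooth_differentiable[OF _ that] smooth_intros \<beta> smooth_F)
    then have "spray_deriv (dy k (\<lambda>z. \<beta> (fst z) * F z)) z = spray_deriv (\<lambda>z. \<beta> (fst z) * dy k F z) z"
      using dy_fst[OF \<beta>] by (intro spray_deriv_slit_cong z) simp
    also have "\<dots> = \<beta> (fst z) * spray_deriv (dy k F) z + spray_deriv (\<lambda>z. \<beta> (fst z)) z * dy k F z"
      by (intro spray_deriv_mult z smooth_intros \<beta> smooth_F)
    moreover have "dx k (\<lambda>z. \<beta> (fst z) * F z) z = \<beta> (fst z) * dx k F z + dx k (\<lambda>z. \<beta> (fst z)) z * F z"
      unfolding dx_dir_deriv by (intro dir_deriv_mult smooth_differentiable[OF _ z] smooth_intros \<beta> smooth_F)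
    ultimately show ?thesis
      using euler_lagrange_F[OF z, of k] by (simp add: euler_lagrange_def spray_deriv_fst[OF \<beta> z] dx_fst[OF \<beta> z])
  qed
  finally show ?thesis by (simp add: euler_lagrange_exact[OF l z] euler_lagrange_linear[OF a z])
qed

lemma dy_flag_defect:
  assumes h: "smooth_on U h" and z: "z \<in> slit"
  shows "(real CARD('n) + 1) / 3 * L z * dy k (flag_defect h) z
    = F z * (dir_deriv (axis k 1) \<beta> (fst z) - dir_deriv (axis k 1) h (fst z))
      - dy k F z * (dir_deriv (snd z) \<beta> (fst z) - dir_deriv (snd z) h (fst z))
      - (\<Sum>m\<in>UNIV. snd z $ m * (dir_deriv (axis m 1) (a k) (fst z) - dir_deriv (axis k 1) (a m) (fst z)))"
proof -
  let ?e = "\<lambda>z::'n tpoint. dir_deriv (snd z) h (fst z)" and ?c = "3 / (real CARD('n) + 1)"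
  note d = smooth_differentiable[OF _ z]
  have F0: "F z \<noteq> 0" using F_pos[OF z] by simp
  have si: "smooth (\<lambda>z. inverse (F z))"
    unfolding inverse_eq_divide
    by (intro smooth_on_divide open_slit smooth_F smooth_on_const) (rule F_nonzero)
  have "dy k (flag_defect h) z = dy k (\<lambda>z. \<kappa> z - ?c * (?e z * inverse (F z))) z"
    by (simp add: flag_defect_def[abs_def] divide_inverse)
  also have "\<dots> = dy k \<kappa> z - dy k (\<lambda>z. ?c * (?e z * inverse (F z))) z"
    unfolding dy_dir_deriv by (intro dir_deriv_diff d smooth_intros smooth_\<kappa> si smooth_directional h)
  also have "dy k (\<lambda>z. ?c * (?e z * inverse (F z))) z = ?c * dy k (\<lambda>z. ?e z * inverse (F z)) z"
    unfolding dy_dir_deriv by (intro dir_deriv_cmult d smooth_intros smooth_\<kappa> si smooth_directional h)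
  also have "dy k (\<lambda>z. ?e z * inverse (F z)) z = ?e z * dy k (\<lambda>z. inverse (F z)) z + dy k ?e z * inverse (F z)"
    unfolding dy_dir_deriv by (intro dir_deriv_mult d si smooth_directional h)
  also have "dy k (\<lambda>z. inverse (F z)) z = - (inverse (F z) * dy k F z * inverse (F z))"
    unfolding dy_dir_deriv by (intro dir_deriv_inverse d smooth_F F0)
  also have "dy k ?e z = dir_deriv (axis k 1) h (fst z)" by (rule dy_directional[OF h z])
  finally have q: "dy k (flag_defect h) z = dy k \<kappa> z - ?c * (?e z * - (inverse (F z) * dy k F z * inverse (F z))
      + dir_deriv (axis k 1) h (fst z) * inverse (F z))" .
  have "s = r - c * (e * - (inverse w * f * inverse w) + t * inverse w) \<Longrightarrow> w \<noteq> 0 \<Longrightarrow>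
      w\<^sup>2 * s = w\<^sup>2 * r - c * (w * t - f * e)" for s r c e w f t :: real
    by (simp add: field_simps power2_eq_square)
  from this[OF q F0] have D: "L z * dy k (flag_defect h) z
      = L z * dy k \<kappa> z - ?c * (F z * dir_deriv (axis k 1) h (fst z) - dy k F z * ?e z)" .
  have K: "(real CARD('n) + 1) / 3 * (L z * dy k \<kappa> z) = - euler_lagrange k spray_div z"
    using curvature_derivative[OF z, of k] by (simp add: field_simps)
  have "(real CARD('n) + 1) / 3 * L z * dy k (flag_defect h) z = (real CARD('n) + 1) / 3 * (L z * dy k (flag_defect h) z)"
    by simp
  also have "\<dots> = (real CARD('n) + 1) / 3 * (L z * dy k \<kappa> z)
      - ((real CARD('n) + 1) / 3 * ?c) * (F z * dir_deriv (axis k 1) h (fst z) - dy k F z * ?e z)"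
    unfolding D by (simp only: right_diff_distrib mult.assoc)
  also have "(real CARD('n) + 1) / 3 * ?c = 1" by (simp add: field_simps) 
  finally show ?thesis unfolding K euler_lagrange_div[OF z] by (simp add: algebra_simps)
qed

text \<open>
  For closed \<open>\<xi>\<close> and \<open>h = \<beta>\<close> the right-hand side of \<open>dy_flag_defect\<close> is zero, and the complement of the
  origin in the fibre is connected.
\<close>

lemma flag_defect_constant:
  assumes closed: "\<And>m k. dir_deriv (axis m 1) (a k) x = dir_deriv (axis k 1) (a m) x"
    and x: "x \<in> U" and y: "y \<noteq> 0" "y' \<noteq> 0"
  shows "flag_defect \<beta> (x, y) = flag_defect \<beta> (x, y')"
proof -
  let ?Q = "flag_defect \<beta>"
  have s: "smooth ?Q" by (rule smooth_flag_defect[OF \<beta>])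
  have 0: "dy k ?Q (x, y) = 0" if "y \<noteq> 0" for y k
  proof -
    have z: "(x, y) \<in> slit" using x that by simp
    show ?thesis
      using dy_flag_defect[OF \<beta> z, of k] F_nonzero[OF z] closed by simp
  qed
  have L: "bounded_linear (\<lambda>y::real^'n. (0 :: real^'n, y))"
    by (intro bounded_linear_Pair bounded_linear_zero bounded_linear_ident)
  have "((\<lambda>y. ?Q (x, y)) has_derivative (\<lambda>h. 0)) (at y)" if "y \<noteq> 0" for y
  proof -
    have z: "(x, y) \<in> slit" using x that by simp
    have "(?Q has_derivative (\<lambda>v. dir_deriv v ?Q (x, y))) (at ((x, 0) + (0, y)))"
      using has_derivative_dir_deriv[OF smooth_differentiable[OF s z]] by simp
    from diff_chain_at[OF has_derivative_affine[OF L] this]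
    have "((\<lambda>y. ?Q (x, y)) has_derivative (\<lambda>h. dir_deriv (0, h) ?Q (x, y))) (at y)"
      by (simp add: o_def)
    moreover have "dir_deriv (0, h) ?Q (x, y) = 0" for h
      using dir_deriv_coord_expand[OF s z, of "(0, h)"] 0[OF that] by simp
    ultimately show ?thesis by simp
  qed
  moreover have "connected (- {0 :: real^'n})"
    by (rule connected_punctured_universe) (use card in simp)
  moreover have "open (- {0 :: real^'n})" by (rule open_Compl) simp
  ultimately show ?thesis
    using has_derivative_zero_unique_connected[of "- {0}" "\<lambda>y. ?Q (x, y)" y y'] y
    by auto
qed

text \<open>
  Constancy makes the right-hand side of \<open>dy_flag_defect\<close> vanish on a whole fibre. Contracted with
  a vector \<open>w\<close> in the kernel of \<open>\<theta>\<close>, it says that \<open>\<theta>(y)\<close> times the derivative of \<open>F\<close> in direction \<open>w\<close>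
  is linear in \<open>y\<close>, and a multiple of \<open>\<theta>(y)\<close> on the plane of \<open>w\<close> and a transversal \<open>v\<close>. Hence this
  derivative is constant there, up to the points \<open>w\<close> and \<open>-w\<close> by continuity, which is incompatible with the positivity of \<open>F\<close> at \<open>w\<close> and \<open>-w\<close>.
\<close>

lemma flag_defect_constant_converse:
  assumes h: "smooth_on U h" and x: "x \<in> U"
    and const: "\<And>y. y \<noteq> 0 \<Longrightarrow> flag_defect h (x, y) = r"
  shows "dir_deriv v \<beta> x = dir_deriv v h x"
    and "dir_deriv (axis m 1) (a k) x = dir_deriv (axis k 1) (a m) x"
proof -
  define \<theta> where "\<theta> = (\<chi> k. dir_deriv (axis k 1) \<beta> x - dir_deriv (axis k 1) h x)"
  define B where "B m k = dir_deriv (axis m 1) (a k) x - dir_deriv (axis k 1) (a m) x" for m k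
  have skew: "B m k = - B k m" for m k by (simp add: B_def)
  have lin: "dir_deriv v f x = (\<Sum>k\<in>UNIV. v $ k * dir_deriv (axis k 1) f x)" if "smooth_on U f" for v f
    by (rule linear_axis_expand[OF linear_dir_deriv[OF smooth_on_differentiable[OF that x]]])
  have \<theta>: "dir_deriv v \<beta> x - dir_deriv v h x = \<theta> \<bullet> v" for v
    unfolding lin[OF \<beta>, of v] lin[OF h, of v]
    by (simp add: \<theta>_def inner_vec_def sum_subtractf algebra_simps)
  have zero: "dy k (flag_defect h) (x, y) = 0" if "y \<noteq> 0" for k y
  proof -
    have L: "bounded_linear (\<lambda>y::real^'n. (0 :: real^'n, y))"
      by (intro bounded_linear_Pair bounded_linear_zero bounded_linear_ident)
    have "dir_deriv (axis k 1) (\<lambda>y. flag_defect h ((x, 0) + (0, y))) y = dir_deriv (0, axis k 1) (flag_defect h) ((x, 0) + (0, y))"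
      using x that by (intro dir_deriv_compose_affine[OF L] smooth_differentiable[OF smooth_flag_defect[OF h]]) simp
    moreover have "dir_deriv (axis k 1) (\<lambda>y. flag_defect h ((x, 0) + (0, y))) y = dir_deriv (axis k 1) (\<lambda>y. r) y"
      by (rule dir_deriv_cong[of "- {0}"]) (use that const in auto)
    ultimately show ?thesis by (simp add: dy_dir_deriv)
  qed
  have eq: "F (x, y) * \<theta> $ k - dy k F (x, y) * (\<theta> \<bullet> y) = (\<Sum>m\<in>UNIV. y $ m * B m k)" if "y \<noteq> 0" for y k
    using dy_flag_defect[OF h, of "(x, y)" k] zero[OF that, of k] x that
    by (simp add: \<theta> B_def inner_axis)
  have "\<theta> = 0"
  proof (rule ccontr)
    assume ne: "\<theta> \<noteq> 0"
    obtain w where w: "w \<noteq> 0" "orthogonal \<theta> w"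
      using orthogonal_to_vector_exists[of \<theta>] card by auto
    define \<phi> where "\<phi> y = (\<Sum>k\<in>UNIV. w $ k * dy k F (x, y))" for y
    define c where "c = - (\<Sum>k\<in>UNIV. \<Sum>m\<in>UNIV. w $ k * \<theta> $ m * B m k) / (\<theta> \<bullet> \<theta>)"
    \<comment> \<open>by skew symmetry the component of \<open>y\<close> along \<open>w\<close> does not contribute\<close>
    have ww: "(\<Sum>k\<in>UNIV. \<Sum>m\<in>UNIV. w $ k * w $ m * B m k) = 0" (is "?s = 0")
    proof -
      have "?s = (\<Sum>m\<in>UNIV. \<Sum>k\<in>UNIV. w $ k * w $ m * B m k)" by (rule sum.swap)
      also have "\<dots> = - ?s"
        by (simp add: sum_negf[symmetric]) (intro sum.cong refl, subst skew, simp)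
      finally show ?thesis by simp
    qed
    \<comment> \<open>\<open>\<theta>\<close> itself serves as the transversal vector \<open>v\<close>\<close>
    have "\<phi> (s *\<^sub>R w + t *\<^sub>R \<theta>) = c" if "t \<noteq> 0" for s t
    proof -
      let ?y = "s *\<^sub>R w + t *\<^sub>R \<theta>"
      have ty: "\<theta> \<bullet> ?y = t * (\<theta> \<bullet> \<theta>)"
        using w(2) by (simp add: orthogonal_def inner_add_right)
      have y: "?y \<noteq> 0" using ty ne that by (metis inner_eq_zero_iff inner_zero_right mult_eq_0_iff)
      have "(\<Sum>k\<in>UNIV. w $ k * (F (x, ?y) * \<theta> $ k - dy k F (x, ?y) * (\<theta> \<bullet> ?y)))
        = (\<Sum>k\<in>UNIV. \<Sum>m\<in>UNIV. w $ k * ?y $ m * B m k)"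
        unfolding eq[OF y] by (simp add: sum_distrib_left mult.assoc)
      moreover have "(\<Sum>k\<in>UNIV. w $ k * (F (x, ?y) * \<theta> $ k - dy k F (x, ?y) * (\<theta> \<bullet> ?y)))
        = F (x, ?y) * (\<theta> \<bullet> w) - (\<theta> \<bullet> ?y) * \<phi> ?y"
        by (simp add: right_diff_distrib sum_subtractf inner_vec_def \<phi>_def sum_distrib_left mult_ac)
      moreover have "(\<Sum>k\<in>UNIV. \<Sum>m\<in>UNIV. w $ k * ?y $ m * B m k)
        = s * (\<Sum>k\<in>UNIV. \<Sum>m\<in>UNIV. w $ k * w $ m * B m k) + t * (\<Sum>k\<in>UNIV. \<Sum>m\<in>UNIV. w $ k * \<theta> $ m * B m k)"
        by (simp add: distrib_left distrib_right sum.distrib sum_distrib_left mult_ac)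
      ultimately have "- (t * (\<theta> \<bullet> \<theta>) * \<phi> ?y) = t * (\<Sum>k\<in>UNIV. \<Sum>m\<in>UNIV. w $ k * \<theta> $ m * B m k)"
        using w(2) ty ww by (simp add: orthogonal_def)
      then have "t * (- ((\<theta> \<bullet> \<theta>) * \<phi> ?y)) = t * (\<Sum>k\<in>UNIV. \<Sum>m\<in>UNIV. w $ k * \<theta> $ m * B m k)"
        by (simp only: mult.assoc mult_minus_right)
      then have "- ((\<theta> \<bullet> \<theta>) * \<phi> ?y) = (\<Sum>k\<in>UNIV. \<Sum>m\<in>UNIV. w $ k * \<theta> $ m * B m k)"
        by (rule mult_left_cancel[OF that, THEN iffD1])
      then have "c = (\<theta> \<bullet> \<theta>) * \<phi> ?y / (\<theta> \<bullet> \<theta>)" unfolding c_def by (metis minus_minus)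
      then show ?thesis using ne by (metis inner_eq_zero_iff nonzero_mult_div_cancel_left)
    qed
    moreover have "continuous_on (UNIV - {0}) \<phi>"
    proof -
      have "continuous_on (UNIV - {0}) (dy k F \<circ> Pair x)" for k
      proof (rule continuous_on_compose)
        show "continuous_on (Pair x ` (UNIV - {0})) (dy k F)"
          by (rule continuous_on_subset[OF smooth_on_continuous_on[OF smooth_dy[OF smooth_F]]]) (use x in auto)
      qed (intro continuous_intros)
      then show ?thesis unfolding \<phi>_def[abs_def] o_def by (intro continuous_intros)
    qed
    ultimately have \<phi>w: "\<phi> w = c" "\<phi> (- w) = c"
      using limit_along_line[of \<phi> w \<theta> c] w(1) by auto
    have "\<phi> w = F (x, w)"
      using F_euler[of "(x, w)"] x w(1) by (simp add: \<phi>_def)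
    moreover have "\<phi> (- w) = - F (x, - w)"
      using F_euler[of "(x, - w)"] x w(1) by (simp add: \<phi>_def sum_negf)
    moreover have "F (x, w) > 0" "F (x, - w) > 0" using x w(1) by (auto intro!: F_pos)
    ultimately show False using \<phi>w by simp
  qed
  then show "dir_deriv v \<beta> x = dir_deriv v h x" using \<theta>[of v] by simp
  have "B m k = 0"
  proof -
    have "axis m (1::real) \<noteq> 0" by (simp add: axis_eq_0_iff)
    from eq[OF this, of k] \<open>\<theta> = 0\<close> show ?thesis
      by (simp add: axis_def if_distrib[of "\<lambda>x. x * _"] cong: if_cong)
  qed
  then show "dir_deriv (axis m 1) (a k) x = dir_deriv (axis k 1) (a m) x" by (simp add: B_def)
qed

text \<open>
  Only the term \<open>\<beta> F\<close> of the divergence is not linear in \<open>y\<close>.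
\<close>

lemma dy_dy_div:
  assumes z: "z \<in> slit"
  shows "dy j (dy k spray_div) z = \<beta> (fst z) * dy j (dy k F) z"
proof -
  have sl: "smooth (\<lambda>z. l (fst z))" using l by (rule smooth_fst)
  have 1: "dy k spray_div z = dir_deriv (axis k 1) l (fst z) + (\<beta> (fst z) * dy k F z + a k (fst z))" if z: "z \<in> slit" for z k
  proof -
    note d = smooth_differentiable[OF _ z]
    have "dy k spray_div z = dy k (\<lambda>z. dir_deriv (snd z) l (fst z) + (\<beta> (fst z) * F z + (\<Sum>i\<in>UNIV. a i (fst z) * snd z $ i))) z"
      by (intro dy_slit_cong z) (simp add: div spray_deriv_fst[OF l])
    also have "\<dots> = dy k (\<lambda>z. dir_deriv (snd z) l (fst z)) z + dy k (\<lambda>z. \<beta> (fst z) * F z + (\<Sum>i\<in>UNIV. a i (fst z) * snd z $ i)) z"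
      unfolding dy_dir_deriv by (intro dir_deriv_add d smooth_directional l smooth_intros \<beta> a smooth_F)
    also have "dy k (\<lambda>z. \<beta> (fst z) * F z + (\<Sum>i\<in>UNIV. a i (fst z) * snd z $ i)) z
        = dy k (\<lambda>z. \<beta> (fst z) * F z) z + dy k (\<lambda>z. (\<Sum>i\<in>UNIV. a i (fst z) * snd z $ i)) z"
      unfolding dy_dir_deriv by (intro dir_deriv_add d smooth_intros \<beta> a smooth_F)
    also have "dy k (\<lambda>z. \<beta> (fst z) * F z) z = \<beta> (fst z) * dy k F z + dy k (\<lambda>z. \<beta> (fst z)) z * F z"
      unfolding dy_dir_deriv by (intro dir_deriv_mult d smooth_intros \<beta> a smooth_F)
    also have "dy k (\<lambda>z. (\<Sum>i\<in>UNIV. a i (fst z) * snd z $ i)) z = (\<Sum>i\<in>UNIV. dy k (\<lambda>z. a i (fst z) * snd z $ i) z)"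
      unfolding dy_dir_deriv by (intro dir_deriv_sum d smooth_intros \<beta> a smooth_F)
    also have "\<dots> = (\<Sum>i\<in>UNIV. a i (fst z) * dy k (\<lambda>z. snd z $ i) z + dy k (\<lambda>z. a i (fst z)) z * snd z $ i)"
      unfolding dy_dir_deriv by (intro sum.cong refl dir_deriv_mult d smooth_intros \<beta> a smooth_F)
    also have "\<dots> = a k (fst z)"
      using dy_fst[OF a z] by (simp add: dy_dir_deriv dir_deriv_coord axis_def if_distrib[of "\<lambda>x. _ * x"] cong: if_cong)
    finally show ?thesis by (simp add: dy_directional[OF l z] dy_fst[OF \<beta> z])
  qed
  have sl': "smooth_on U (dir_deriv (axis k 1) l)" using l by (rule smooth_on_dir_deriv)
  note d = smooth_differentiable[OF _ z]
  have "dy j (dy k spray_div) z = dy j (\<lambda>z. dir_deriv (axis k 1) l (fst z) + (\<beta> (fst z) * dy k F z + a k (fst z))) z"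
    by (intro dy_slit_cong z 1)
  also have "\<dots> = dy j (\<lambda>z. dir_deriv (axis k 1) l (fst z)) z + dy j (\<lambda>z. \<beta> (fst z) * dy k F z + a k (fst z)) z"
    unfolding dy_dir_deriv[of j] by (intro dir_deriv_add d smooth_intros sl' \<beta> a smooth_F)
  also have "dy j (\<lambda>z. \<beta> (fst z) * dy k F z + a k (fst z)) z = dy j (\<lambda>z. \<beta> (fst z) * dy k F z) z + dy j (\<lambda>z. a k (fst z)) z"
    unfolding dy_dir_deriv[of j] by (intro dir_deriv_add d smooth_intros sl' \<beta> a smooth_F)
  also have "dy j (\<lambda>z. \<beta> (fst z) * dy k F z) z = \<beta> (fst z) * dy j (dy k F) z + dy j (\<lambda>z. \<beta> (fst z)) z * dy k F z"
    unfolding dy_dir_deriv[of j] by (intro dir_deriv_mult d smooth_intros \<beta> smooth_F)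
  finally show ?thesis by (simp add: dy_fst[OF sl' z] dy_fst[OF \<beta> z] dy_fst[OF a z])
qed

text \<open>
  By \<open>F F_kj = g_kj - F_k F_j\<close>, the fibre Hessian of \<open>F\<close> times \<open>F\<close> restricts to the metric on the vectors
  orthogonal to \<open>y\<close>, so each of the \<open>n - 1\<close> frame vectors contributes \<open>\<beta>\<close> to the trace.
\<close>

lemma berwald_scalar_eq:
  assumes z: "z \<in> slit"
  shows "berwald_scalar F z = (real CARD('n) - 1) * \<beta> (fst z)"
proof -
  define u where "u = (SOME u. adapted_frame F z u)"
  have u: "adapted_frame F z u"
    unfolding u_def using adapted_frame_exists[OF z] by (rule someI_ex)
  have on: "u i \<bullet> (g z *v u j) = (if i = j then 1 else 0)" if "i \<in> {1..CARD('n)}" "j \<in> {1..CARD('n)}" for i j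
    using u that unfolding adapted_frame_def sum_frame_form by blast
  have un: "u CARD('n) = (1 / F z) *\<^sub>R snd z" using u by (simp add: adapted_frame_def)
  have mb: "mean_berwald F u z \<gamma> \<mu> = F z * (\<Sum>k\<in>UNIV. \<Sum>j\<in>UNIV. u \<gamma> $ k * u \<mu> $ j * (\<beta> (fst z) * dy j (dy k F) z))" for \<gamma> \<mu>
  proof -
    let ?R = "\<lambda>a b. berwald_curv F a b z (frame_h F u z \<gamma>) (frame_v F u z \<mu>)"
    have fh: "fst (frame_h F u z \<gamma>) = u \<gamma>"
      by (simp add: frame_h_def delta_x_def fst_sum vec_eq_iff axis_def if_distrib[of "\<lambda>x. _ * x"] cong: if_cong)
    have "mean_berwald F u z \<gamma> \<mu> = (\<Sum>i=1..CARD('n). \<Sum>a\<in>UNIV. \<Sum>b\<in>UNIV. (g z *v u i) $ a * u i $ b * ?R a b)"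
      by (simp add: mean_berwald_def berwald_P_def)
    also have "\<dots> = (\<Sum>a\<in>UNIV. \<Sum>b\<in>UNIV. (\<Sum>i=1..CARD('n). (g z *v u i) $ a * u i $ b) * ?R a b)"
      by (rule trans[OF sum.swap], rule sum.cong[OF refl], rule trans[OF sum.swap]) (simp add: sum_distrib_right)
    also have "\<dots> = (\<Sum>a\<in>UNIV. ?R a a)"
    proof -
      have "(\<Sum>i=1..CARD('n). (g z *v u i) $ a * u i $ b) = (if a = b then 1 else 0)" for a b
        by (rule orthonormal_frame_completeness[OF on])
      then show ?thesis by (simp only:) (simp add: if_distrib[of "\<lambda>x. x * _"] cong: if_cong)
    qed
    also have "\<dots> = - (\<Sum>k\<in>UNIV. \<Sum>j\<in>UNIV. u \<gamma> $ k * (- (F z * u \<mu> $ j)) * (\<beta> (fst z) * dy j (dy k F) z))"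
      by (subst berwald_curv_trace[OF z]) (simp_all add: frame_v_def fh dy_dy_div[OF z])
    also have "\<dots> = F z * (\<Sum>k\<in>UNIV. \<Sum>j\<in>UNIV. u \<gamma> $ k * u \<mu> $ j * (\<beta> (fst z) * dy j (dy k F) z))"
      unfolding sum_distrib_left sum_negf[symmetric] by (intro sum.cong refl) simp
    finally show ?thesis .
  qed
  have "mean_berwald F u z \<gamma> \<gamma> = \<beta> (fst z)" if \<gamma>: "\<gamma> \<in> {1..<CARD('n)}" for \<gamma>
  proof -
    let ?p = "\<Sum>k\<in>UNIV. u \<gamma> $ k * dy k F z"
    have "F z * ?p = u \<gamma> \<bullet> (g z *v snd z)"
      by (simp add: inner_vec_def g_mult_y_F[OF z] sum_distrib_left mult_ac)
    also have "\<dots> = F z * (u \<gamma> \<bullet> (g z *v u CARD('n)))"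
      using F_nonzero[OF z] by (simp add: un matrix_vector_mult_scaleR)
    also have "\<dots> = 0" using on[of \<gamma> "CARD('n)"] \<gamma> by simp
    finally have p: "?p = 0" using F_nonzero[OF z] by simp
    have "(\<Sum>k\<in>UNIV. \<Sum>j\<in>UNIV. u \<gamma> $ k * u \<gamma> $ j * (F z * dy j (dy k F) z))
      = (\<Sum>k\<in>UNIV. \<Sum>j\<in>UNIV. g z $ k $ j * u \<gamma> $ k * u \<gamma> $ j) - ?p * ?p"
      unfolding sum_product by (simp add: g_FF[OF z] sum_subtractf[symmetric] algebra_simps)
    also have "\<dots> = 1" unfolding sum_frame_form p using on[of \<gamma> \<gamma>] \<gamma> by simp
    finally have "(\<Sum>k\<in>UNIV. \<Sum>j\<in>UNIV. u \<gamma> $ k * u \<gamma> $ j * (F z * dy j (dy k F) z)) = 1" .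
    moreover have "mean_berwald F u z \<gamma> \<gamma>
      = \<beta> (fst z) * (\<Sum>k\<in>UNIV. \<Sum>j\<in>UNIV. u \<gamma> $ k * u \<gamma> $ j * (F z * dy j (dy k F) z))"
      unfolding mb sum_distrib_left by (intro sum.cong refl) simp
    ultimately show ?thesis by simp
  qed
  then have "(\<Sum>\<gamma>=1..<CARD('n). mean_berwald F u z \<gamma> \<gamma>) = (\<Sum>\<gamma>=1..<CARD('n). \<beta> (fst z))"
    by (rule sum.cong[OF refl])
  also have "\<dots> = (real CARD('n) - 1) * \<beta> (fst z)"
    using card by (simp add: of_nat_diff)
  finally have "(\<Sum>\<gamma>=1..<CARD('n). mean_berwald F u z \<gamma> \<gamma>) = (real CARD('n) - 1) * \<beta> (fst z)" .
  then show ?thesis by (simp add: berwald_scalar_def u_def Let_def)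
qed

end


section \<open>Tangent vectors and functions on a smooth manifold\<close>

locale smooth_atlas =
  fixes M :: "'a topology" and A :: "('a, 'n::finite) chart set"
  assumes manifold: "smooth_manifold M A"
begin

lemma chart_open: "c \<in> A \<Longrightarrow> openin M (fst c)" "c \<in> A \<Longrightarrow> open (chart_img c)"
  and chart_homeo: "c \<in> A \<Longrightarrow> homeomorphic_map (subtopology M (fst c)) (top_of_set (chart_img c)) (snd c)"
  and transition_smooth: "c \<in> A \<Longrightarrow> d \<in> A \<Longrightarrow> smooth_on (snd c ` (fst c \<inter> fst d)) (snd d \<circ> chart_inv c)"
  and atlas_covers: "(\<Union>c\<in>A. fst c) = topspace M"
  using manifold unfolding smooth_manifold_def by auto

lemma topspace_chart: "c \<in> A \<Longrightarrow> topspace (subtopology M (fst c)) = fst c"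
  using chart_open openin_subset by (metis topspace_subtopology_subset)

lemma chart_inj: "c \<in> A \<Longrightarrow> inj_on (snd c) (fst c)"
  using chart_homeo topspace_chart homeomorphic_imp_injective_map by metis

lemma chart_inv_left: "c \<in> A \<Longrightarrow> p \<in> fst c \<Longrightarrow> chart_inv c (snd c p) = p"
  by (simp add: chart_inv_def chart_inj)

lemma chart_inv_right: "x \<in> chart_img c \<Longrightarrow> snd c (chart_inv c x) = x" "x \<in> chart_img c \<Longrightarrow> chart_inv c x \<in> fst c"
  by (auto simp: chart_inv_def chart_img_def f_inv_into_f inv_into_into)

lemma chart_img_mem: "p \<in> fst c \<Longrightarrow> snd c p \<in> chart_img c"
  by (simp add: chart_img_def)

lemma chart_overlap_open:
  assumes "c \<in> A" "openin M V" "V \<subseteq> fst c"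
  shows "open (snd c ` V)"
proof -
  have "openin (subtopology M (fst c)) V" using assms by (simp add: openin_subset_topspace_eq openin_open_subtopology chart_open)
  then have "openin (top_of_set (chart_img c)) (snd c ` V)"
    using homeomorphic_imp_open_map[OF chart_homeo[OF assms(1)]] by (simp add: open_map_def)
  then show ?thesis using chart_open(2)[OF assms(1)] openin_open_trans by blast
qed

lemma transition_has_derivative:
  assumes "c \<in> A" "d \<in> A" "p \<in> fst c" "p \<in> fst d"
  shows "((snd d \<circ> chart_inv c) has_derivative transition_deriv c d p) (at (snd c p))"
proof -
  have "Ck_on (Suc 0) (snd c ` (fst c \<inter> fst d)) (snd d \<circ> chart_inv c)"
    using transition_smooth[OF assms(1,2)] unfolding smooth_on_def by blast
  then have "(snd d \<circ> chart_inv c) differentiable (at (snd c p))" using assms by auto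
  then show ?thesis unfolding transition_deriv_def using frechet_derivative_works by blast
qed

lemma linear_transition:
  "c \<in> A \<Longrightarrow> d \<in> A \<Longrightarrow> p \<in> fst c \<Longrightarrow> p \<in> fst d \<Longrightarrow> linear (transition_deriv c d p)"
  using transition_has_derivative has_derivative_linear by blast

text \<open>
  Applied to the coordinates of a third chart this is the cocycle rule for transition maps; applied to a real
  function it shows that its differential does not depend on the chart.
\<close>

lemma change_of_chart:
  assumes c: "c \<in> A" "p \<in> fst c" and d: "d \<in> A" "p \<in> fst d"
    and f: "(in_chart d f has_derivative D) (at (snd d p))"
  shows "(in_chart c f has_derivative D \<circ> transition_deriv c d p) (at (snd c p))"
proof -
  let ?V = "snd c ` (fst c \<inter> fst d)"
  have V: "open ?V" "snd c p \<in> ?V"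
    using c d by (auto intro!: chart_overlap_open openin_Int chart_open)
  have "(snd d \<circ> chart_inv c) (snd c p) = snd d p" using c by (simp add: chart_inv_left)
  then have "((in_chart d f \<circ> (snd d \<circ> chart_inv c)) has_derivative (D \<circ> transition_deriv c d p)) (at (snd c p))"
    using transition_has_derivative[OF c(1) d(1) c(2) d(2)] f by (intro diff_chain_at) simp_all
  then show ?thesis
    by (rule has_derivative_transform_within_open[OF _ V])
       (use c d in \<open>auto simp: in_chart_def chart_inv_left\<close>)
qed

lemma transition_cocycle:
  assumes "c \<in> A" "d \<in> A" "e \<in> A" "p \<in> fst c" "p \<in> fst d" "p \<in> fst e"
  shows "transition_deriv d e p (transition_deriv c d p y) = transition_deriv c e p y"
proof -
  have "in_chart d (snd e) = snd e \<circ> chart_inv d" "in_chart c (snd e) = snd e \<circ> chart_inv c"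
    by (auto simp: in_chart_def)
  then have "((snd e \<circ> chart_inv c) has_derivative transition_deriv d e p \<circ> transition_deriv c d p) (at (snd c p))"
    using change_of_chart[OF assms(1,4,2,5), of "snd e"] transition_has_derivative assms by metis
  then show ?thesis
    using transition_has_derivative[OF assms(1,3,4,6)] has_derivative_unique by (metis comp_apply)
qed

lemma transition_id:
  assumes "c \<in> A" "p \<in> fst c"
  shows "transition_deriv c c p y = y"
proof -
  have "((\<lambda>x. x) has_derivative (\<lambda>y. y)) (at (snd c p))" by simp
  then have "((snd c \<circ> chart_inv c) has_derivative (\<lambda>y. y)) (at (snd c p))"
    by (rule has_derivative_transform_within_open[OF _ chart_open(2)[OF assms(1)]])
       (use assms in \<open>auto simp: chart_inv_right chart_img_mem\<close>)
  then show ?thesis using transition_has_derivative[OF assms(1,1,2,2)] has_derivative_unique by metis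
qed

lemma tvec_of_coord: "c \<in> A \<Longrightarrow> p \<in> fst c \<Longrightarrow> tvec_of A c p y c = y"
  by (simp add: tvec_of_def transition_id)

lemma tvec_of_tangent: "c \<in> A \<Longrightarrow> p \<in> fst c \<Longrightarrow> tvec_of A c p y \<in> tangent_space A p"
  by (auto simp: tangent_space_def tvec_of_def transition_cocycle)

lemma tangent_transition:
  "c \<in> A \<Longrightarrow> d \<in> A \<Longrightarrow> p \<in> fst c \<Longrightarrow> p \<in> fst d \<Longrightarrow> v \<in> tangent_space A p \<Longrightarrow> v d = transition_deriv c d p (v c)"
  unfolding tangent_space_def by blast

lemma tvec_of_eq:
  assumes "c \<in> A" "p \<in> fst c" "v \<in> tangent_space A p"
  shows "tvec_of A c p (v c) = v"
proof
  fix d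
  show "tvec_of A c p (v c) d = v d"
  proof (cases "d \<in> A \<and> p \<in> fst d")
    case True
    then show ?thesis using tangent_transition[OF assms(1) _ assms(2) _ assms(3), of d] by (simp add: tvec_of_def)
  next
    case False
    then have "v d = 0" using assms(3) unfolding tangent_space_def by blast
    with False show ?thesis by (auto simp: tvec_of_def)
  qed
qed

lemma tvec_of_scale:
  "c \<in> A \<Longrightarrow> p \<in> fst c \<Longrightarrow> tvec_of A c p (t *\<^sub>R y) = (\<lambda>d. t *\<^sub>R tvec_of A c p y d)"
  by (auto simp: tvec_of_def fun_eq_iff linear_scale[OF linear_transition])

lemma in_tchart_eq:
  "c \<in> A \<Longrightarrow> p \<in> fst c \<Longrightarrow> v \<in> tangent_space A p \<Longrightarrow> in_tchart A c h (snd c p, v c) = h p v"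
  by (simp add: in_tchart_def chart_inv_left tvec_of_eq)

lemma tangent_zero:
  assumes "c \<in> A" "p \<in> fst c" "v \<in> tangent_space A p" "v c = 0"
  shows "v = (\<lambda>_. 0)"
proof
  fix d
  have "v d = tvec_of A c p 0 d" using tvec_of_eq[OF assms(1-3)] assms(4) by metis
  then show "v d = 0" using linear_0[OF linear_transition[OF assms(1) _ assms(2)]] by (auto simp: tvec_of_def)
qed

text \<open>
  The level set through a point is open and closed, because a function with vanishing derivative is constant on
  coordinate balls.
\<close>

lemma locally_constant_on_components:
  fixes f :: "'a \<Rightarrow> real"
  assumes f: "\<And>c x. c \<in> A \<Longrightarrow> x \<in> chart_img c \<Longrightarrow> (in_chart c f has_derivative (\<lambda>_. 0)) (at x)"
    and C: "C \<in> connected_components_of M" and pq: "p \<in> C" "q \<in> C"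
  shows "f p = f q"
proof -
  have nbhd: "\<exists>V. openin M V \<and> r \<in> V \<and> (\<forall>r'\<in>V. f r' = f r)" if r: "r \<in> topspace M" for r
  proof -
    obtain c where c: "c \<in> A" "r \<in> fst c" using r atlas_covers by blast
    obtain e where e: "e > 0" "ball (snd c r) e \<subseteq> chart_img c"
      using chart_open(2)[OF c(1)] chart_img_mem[OF c(2)] open_contains_ball by blast
    let ?V = "{r' \<in> topspace (subtopology M (fst c)). snd c r' \<in> ball (snd c r) e}"
    have "openin (subtopology M (fst c)) ?V"
    proof (rule openin_continuous_map_preimage)
      show "continuous_map (subtopology M (fst c)) (top_of_set (chart_img c)) (snd c)"
        using chart_homeo[OF c(1)] homeomorphic_imp_continuous_map by blast
      show "openin (top_of_set (chart_img c)) (ball (snd c r) e)"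
        using e(2) by (simp add: open_openin_trans open_subset)
    qed
    then have "openin M ?V" using chart_open(1)[OF c(1)] openin_trans_full by blast
    moreover have "r \<in> ?V" using c e r by simp
    moreover have "f r' = f r" if "r' \<in> ?V" for r'
    proof -
      have r': "r' \<in> fst c" "snd c r' \<in> ball (snd c r) e" using that topspace_chart[OF c(1)] by auto
      have "in_chart c f (snd c r') = in_chart c f (snd c r)"
        using has_derivative_zero_unique_connected[of "ball (snd c r) e" "in_chart c f" "snd c r'" "snd c r"]
          f[OF c(1)] e r' by (auto simp: subset_eq)
      then show ?thesis using r' c by (simp add: in_chart_def chart_inv_left)
    qed
    ultimately show ?thesis by blast
  qed
  have level: "openin M {r \<in> topspace M. f r \<in> R}" for R
  proof (subst openin_subopen, intro ballI)
    fix r assume r: "r \<in> {r \<in> topspace M. f r \<in> R}"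
    then have "r \<in> topspace M" by simp
    from nbhd[OF this] obtain V where V: "openin M V" "r \<in> V" and V_const: "\<forall>r'\<in>V. f r' = f r"
      by (elim exE conjE)
    have const: "f r' = f r" if "r' \<in> V" for r' using V_const that by (rule bspec)
    have "V \<subseteq> {r \<in> topspace M. f r \<in> R}"
    proof
      fix r' assume r': "r' \<in> V"
      have "f r' \<in> R" by (subst const[OF r']) (use r in simp)
      moreover have "r' \<in> topspace M" using openin_subset[OF V(1)] r' by blast
      ultimately show "r' \<in> {r \<in> topspace M. f r \<in> R}" by simp
    qed
    with V show "\<exists>T. openin M T \<and> r \<in> T \<and> T \<subseteq> {r \<in> topspace M. f r \<in> R}" by blast
  qed
  let ?T = "{r \<in> topspace M. f r = f p}"
  have "openin M ?T" using level[of "{f p}"] by simp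
  moreover have "openin M {r \<in> topspace M. f r \<noteq> f p}" using level[of "- {f p}"] by simp
  moreover have "topspace M - ?T = {r \<in> topspace M. f r \<noteq> f p}" by blast
  ultimately have "closedin M ?T" "openin M ?T" by (auto simp: closedin_def)
  moreover have "connectedin M C" using C connectedin_connected_components_of by blast
  moreover have "p \<in> ?T" using connected_components_of_subset[OF C] pq by auto
  ultimately have "C \<subseteq> ?T" using connectedin_clopen_cases[of M C ?T] pq(1) by (auto simp: disjnt_iff)
  then show ?thesis using pq by force
qed

end


section \<open>Finsler manifolds of scalar flag curvature and isotropic S-curvature\<close>

locale finsler_manifold = smooth_atlas M A
  for M :: "'a topology" and A :: "('a, 'n::finite) chart set" +
  fixes F :: "'a \<Rightarrow> ('a, 'n) tvec \<Rightarrow> real"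
  assumes finsler: "finsler_metric M A F"
begin

lemma chart_topspace: "c \<in> A \<Longrightarrow> p \<in> fst c \<Longrightarrow> p \<in> topspace M"
  using atlas_covers by auto

lemma finsler_chart: "c \<in> A \<Longrightarrow> finsler_chart (chart_img c) (in_tchart A c F)"
proof unfold_locales
  assume c: "c \<in> A"
  show "open (chart_img c)" by (rule chart_open(2)[OF c])
  show "smooth_on (chart_img c \<times> (UNIV - {0})) (in_tchart A c F)"
    using finsler c by (simp add: finsler_metric_def)
  show "w \<bullet> (fund_tensor (in_tchart A c F) z *v w) > 0"
    if "z \<in> chart_img c \<times> (UNIV - {0})" "w \<noteq> 0" for z w
    using finsler c that unfolding finsler_metric_def by blast
  fix x y assume x: "x \<in> chart_img c"
  let ?p = "chart_inv c x"
  have p: "?p \<in> fst c" "?p \<in> topspace M"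
    using chart_inv_right(2)[OF x] chart_topspace[OF c] by blast+
  note T = tvec_of_tangent[OF c p(1)]
  show "in_tchart A c F (x, y) \<ge> 0"
    using finsler T p unfolding finsler_metric_def in_tchart_def by auto
  show "in_tchart A c F (x, t *\<^sub>R y) = t * in_tchart A c F (x, y)" if "t > 0" for t
    using finsler T[of y] p that unfolding finsler_metric_def in_tchart_def
    by (simp add: tvec_of_scale[OF c p(1)])
qed

lemma sphere_coords:
  assumes "(p, v) \<in> sphere_bundle M A F" "c \<in> A" "p \<in> fst c"
  shows "in_tchart A c F (snd c p, v c) = 1" "v c \<noteq> 0" "snd c p \<in> chart_img c" "v \<in> tangent_space A p"
proof -
  interpret finsler_chart "chart_img c" "in_tchart A c F" using assms(2) by (rule finsler_chart)
  show v: "v \<in> tangent_space A p" using assms by (auto simp: sphere_bundle_def)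
  show 1: "in_tchart A c F (snd c p, v c) = 1"
    using assms in_tchart_eq[OF assms(2,3) v] by (auto simp: sphere_bundle_def)
  show x: "snd c p \<in> chart_img c" by (rule chart_img_mem[OF assms(3)])
  \<comment> \<open>homogeneity for positive factors already forces \<open>F\<close> to vanish on the zero vector\<close>
  show "v c \<noteq> 0"
  proof
    assume "v c = 0"
    then have "in_tchart A c F (snd c p, 0) = 2 * in_tchart A c F (snd c p, 0)"
      using F_scale[OF x, of 2 0] by simp
    then show False using 1 \<open>v c = 0\<close> by simp
  qed
qed

lemma sphere_of_coords:
  assumes "c \<in> A" "x \<in> chart_img c" "in_tchart A c F (x, y) = 1"
  shows "(chart_inv c x, tvec_of A c (chart_inv c x) y) \<in> sphere_bundle M A F"
  using assms chart_inv_right(2)[OF assms(2)] tvec_of_tangent[OF assms(1)] chart_topspace[OF assms(1)]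
  by (auto simp: sphere_bundle_def in_tchart_def)

end

locale isotropic_finsler_manifold = finsler_manifold M A F
  for M :: "'a topology" and A :: "('a, 'n::finite) chart set"
    and F :: "'a \<Rightarrow> ('a, 'n) tvec \<Rightarrow> real" +
  fixes K :: "'a \<Rightarrow> ('a, 'n) tvec \<Rightarrow> real" and \<mu> :: "('a, 'n) chart \<Rightarrow> 'a \<Rightarrow> real"
    and b :: "'a \<Rightarrow> real" and \<xi> :: "'a \<Rightarrow> ('a, 'n) tvec \<Rightarrow> real"
  assumes dim: "CARD('n) \<ge> 2" and density: "positive_density A \<mu>"
    and scalar_flag: "scalar_flag_curvature M A F K"
    and smooth_b: "smooth_function A b" and smooth_\<xi>: "smooth_one_form A \<xi>"
    and isotropic: "isotropic_S_with M A F \<mu> b \<xi>"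
begin

text \<open>
  The S-curvature is prescribed on unit vectors only. As the divergence and \<open>F S\<close> are homogeneous of degree 1, the
  relation extends to all nonzero \<open>y\<close> by evaluation at \<open>y/F\<close>.
\<close>

lemma isotropic_S_chart:
  assumes c: "c \<in> A"
  shows "isotropic_S_chart (chart_img c) (in_tchart A c F) (in_tchart A c K)
    (\<lambda>x. ln (in_chart c (\<mu> c) x)) (\<lambda>x. 1 / (real CARD('n) - 1) * in_chart c b x)
    (\<lambda>i x. one_form_in A c \<xi> x (axis i 1))"
proof -
  let ?U = "chart_img c" and ?F = "in_tchart A c F"
  interpret finsler_chart ?U ?F using c by (rule finsler_chart)
  let ?s = "in_chart c (\<mu> c)" and ?w = "one_form_in A c \<xi>"
  have D: "smooth_on ?U ?s" "\<forall>p\<in>fst c. \<mu> c p > 0"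
    using density c unfolding positive_density_def by blast+
  have s: "smooth_on ?U ?s" "\<And>x. x \<in> ?U \<Longrightarrow> ?s x > 0"
    using D chart_inv_right(2) unfolding in_chart_def by blast+
  have sl: "smooth_on ?U (\<lambda>x. ln (?s x))" by (intro smooth_on_ln open_U s)
  have lin: "linear (?w x)" if "x \<in> ?U" for x
    using smooth_\<xi> c that by (simp add: smooth_one_form_def)
  show ?thesis
  proof unfold_locales
    show "CARD('n) \<ge> 2" by (rule dim)
    show "riemann_curv ?F i k z = in_tchart A c K z * ((?F z)\<^sup>2 * (if i = k then 1 else 0) - ?F z * dy k ?F z * snd z $ i)"
      if z: "z \<in> slit" for z i k
    proof -
      obtain x y where xy: "z = (x, y)" "x \<in> ?U" "y \<noteq> 0" using z by auto
      let ?p = "chart_inv c x" and ?v = "tvec_of A c (chart_inv c x) y"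
      have p: "?p \<in> fst c" "snd c ?p = x" using chart_inv_right[OF xy(2)] by blast+
      have v: "?v c = y" using tvec_of_coord[OF c p(1)] .
      have "(?p, ?v) \<in> slit_tangent M A"
        using tvec_of_tangent[OF c p(1)] chart_topspace[OF c p(1)] v xy(3) by (auto simp: slit_tangent_def)
      moreover have "tcoords c ?p ?v = z" using v p xy by (simp add: tcoords_def)
      moreover have "in_tchart A c K z = K ?p ?v" using xy by (simp add: in_tchart_def)
      ultimately show ?thesis
        using scalar_flag c p(1) unfolding scalar_flag_curvature_def Let_def by fastforce
    qed
    show "smooth_on ?U (\<lambda>x. ln (?s x))" by (rule sl)
    show "smooth_on ?U (\<lambda>x. 1 / (real CARD('n) - 1) * in_chart c b x)"
      using smooth_b c by (intro smooth_on_mult open_U smooth_on_const) (simp add: smooth_function_def)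
    show "smooth_on ?U (\<lambda>x. ?w x (axis i 1))" for i
      using smooth_\<xi> c by (simp add: smooth_one_form_def)
    show "spray_div z = spray_deriv (\<lambda>z. ln (?s (fst z))) z + (1 / (real CARD('n) - 1) * in_chart c b (fst z) * ?F z
        + (\<Sum>i\<in>UNIV. ?w (fst z) (axis i 1) * snd z $ i))" if z: "z \<in> slit" for z
    proof -
      obtain x y where xy: "z = (x, y)" "x \<in> ?U" "y \<noteq> 0" using z by auto
      have Fp: "?F z > 0" by (rule F_pos[OF z])
      let ?y = "(1 / ?F z) *\<^sub>R y" let ?z = "(x, ?y)"
      have z': "?z \<in> slit" using xy Fp by simp
      have F1: "?F ?z = 1" using F_scale[OF xy(2), of "1 / ?F z" y] Fp xy by simp
      let ?p = "chart_inv c x" and ?v = "tvec_of A c (chart_inv c x) ?y"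
      have p: "?p \<in> fst c" "snd c ?p = x" using chart_inv_right[OF xy(2)] by blast+
      have tc: "tcoords c ?p ?v = ?z" using tvec_of_coord[OF c p(1)] p by (simp add: tcoords_def)
      have "(?p, ?v) \<in> sphere_bundle M A F" by (rule sphere_of_coords[OF c xy(2) F1])
      then have "S_curv ?F ?s ?z = 1 / (real CARD('n) - 1) * b ?p + pullback_form ?w ?z (reeb ?F ?z)"
        using isotropic c p(1) tc unfolding isotropic_S_with_def Let_def by fastforce
      moreover have "pullback_form ?w ?z (reeb ?F ?z) = ?w x ?y"
        using F1 by (simp add: pullback_form_def reeb_eq[OF z'] spray_vec_def)
      moreover have "?w x ?y = (1 / ?F z) * ?w x y" using linear_scale[OF lin[OF xy(2)]] by simp
      moreover have "?F ?z * S_curv ?F ?s ?z = spray_div ?z - spray_deriv (\<lambda>z. ln (?s (fst z))) ?z"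
        by (rule S_curv_eq[OF s z'])
      moreover have "spray_div ?z = (1 / ?F z) * spray_div z"
        using homogD[OF homog_div[OF homog_spray] z, of "1 / ?F z"] Fp xy by simp
      moreover have "spray_deriv (\<lambda>z. ln (?s (fst z))) ?z = (1 / ?F z) * spray_deriv (\<lambda>z. ln (?s (fst z))) z"
        unfolding spray_deriv_fst[OF sl z'] spray_deriv_fst[OF sl z]
        using linear_scale[OF linear_dir_deriv[OF smooth_on_differentiable[OF sl xy(2)]], of "1 / ?F z" y] xy(1)
        by simp
      ultimately have "(1 / ?F z) * (spray_div z - spray_deriv (\<lambda>z. ln (?s (fst z))) z)
        = 1 / (real CARD('n) - 1) * b ?p + (1 / ?F z) * ?w x y"
        using F1 by (simp add: right_diff_distrib)
      then have "spray_div z - spray_deriv (\<lambda>z. ln (?s (fst z))) z = 1 / (real CARD('n) - 1) * b ?p * ?F z + ?w x y"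
        using Fp by (simp add: field_simps)
      moreover have "?w x y = (\<Sum>i\<in>UNIV. ?w x (axis i 1) * y $ i)"
        unfolding linear_axis_expand[OF lin[OF xy(2)], of y] by (simp only: mult.commute)
      ultimately show ?thesis using xy by (simp add: in_chart_def)
    qed
  qed
qed

lemma berwald_scalar_sphere:
  assumes "(p, v) \<in> sphere_bundle M A F" "c \<in> A" "p \<in> fst c"
  shows "berwald_scalar (in_tchart A c F) (tcoords c p v) = b p"
proof -
  interpret isotropic_S_chart "chart_img c" "in_tchart A c F" "in_tchart A c K"
    "\<lambda>x. ln (in_chart c (\<mu> c) x)" "\<lambda>x. 1 / (real CARD('n) - 1) * in_chart c b x"
    "\<lambda>i x. one_form_in A c \<xi> x (axis i 1)"
    using assms(2) by (rule isotropic_S_chart)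
  show ?thesis
    using berwald_scalar_eq[of "tcoords c p v"] sphere_coords[OF assms] dim assms
    by (simp add: tcoords_def in_chart_def chart_inv_left)
qed

lemma ext_deriv_coords:
  assumes c: "c \<in> A" and x: "x \<in> chart_img c"
  shows "ext_deriv (one_form_in A c \<xi>) x Y Z
    = (\<Sum>m\<in>UNIV. \<Sum>k\<in>UNIV. Y $ m * Z $ k * (dir_deriv (axis m 1) (\<lambda>x. one_form_in A c \<xi> x (axis k 1)) x
         - dir_deriv (axis k 1) (\<lambda>x. one_form_in A c \<xi> x (axis m 1)) x))"
proof -
  let ?w = "one_form_in A c \<xi>" and ?U = "chart_img c"
  have lin: "linear (?w x)" if "x \<in> ?U" for x
    using smooth_\<xi> c that by (simp add: smooth_one_form_def)
  have smooth: "smooth_on ?U (\<lambda>x. ?w x Y)" for Y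
    using smooth_\<xi> c by (simp add: smooth_one_form_def)
  have 1: "?w q Y = (\<Sum>i\<in>UNIV. Y $ i * ?w q (axis i 1))" if "q \<in> ?U" for q Y
    by (rule linear_axis_expand[OF lin[OF that]])
  have 2: "dir_deriv Y f x = (\<Sum>i\<in>UNIV. Y $ i * dir_deriv (axis i 1) f x)" if "smooth_on ?U f" for f Y
    by (rule linear_axis_expand[OF linear_dir_deriv[OF smooth_on_differentiable[OF that x]]])
  have 3: "dir_deriv Y (\<lambda>q. ?w q Z) x = (\<Sum>m\<in>UNIV. \<Sum>k\<in>UNIV. Y $ m * Z $ k * dir_deriv (axis m 1) (\<lambda>x. ?w x (axis k 1)) x)" for Y Z
  proof -
    have "dir_deriv v (\<lambda>q. ?w q Z) x = (\<Sum>k\<in>UNIV. Z $ k * dir_deriv v (\<lambda>x. ?w x (axis k 1)) x)" for v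
    proof -
      have "dir_deriv v (\<lambda>q. ?w q Z) x = dir_deriv v (\<lambda>q. \<Sum>k\<in>UNIV. Z $ k * ?w q (axis k 1)) x"
        by (rule dir_deriv_cong[OF chart_open(2)[OF c] x 1])
      also have "\<dots> = (\<Sum>k\<in>UNIV. dir_deriv v (\<lambda>q. Z $ k * ?w q (axis k 1)) x)"
        by (intro dir_deriv_sum smooth_on_differentiable[OF _ x] smooth_on_mult chart_open c smooth_on_const smooth)
      also have "\<dots> = (\<Sum>k\<in>UNIV. Z $ k * dir_deriv v (\<lambda>x. ?w x (axis k 1)) x)"
        by (intro sum.cong refl dir_deriv_cmult smooth_on_differentiable[OF _ x] smooth)
      finally show ?thesis .
    qed
    then show ?thesis by (subst 2[OF smooth]) (simp add: sum_distrib_left mult.assoc)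
  qed
  have "ext_deriv ?w x Y Z = dir_deriv Y (\<lambda>q. ?w q Z) x - dir_deriv Z (\<lambda>q. ?w q Y) x"
    by (simp add: ext_deriv_def dir_deriv_def)
  also have "dir_deriv Z (\<lambda>q. ?w q Y) x = (\<Sum>m\<in>UNIV. \<Sum>k\<in>UNIV. Y $ m * Z $ k * dir_deriv (axis k 1) (\<lambda>x. ?w x (axis m 1)) x)"
    unfolding 3[of Z Y] by (subst sum.swap) (simp add: mult_ac)
  finally show ?thesis unfolding 3[of Y Z] by (simp add: sum_subtractf right_diff_distrib)
qed

lemma closed_iff:
  "closed_one_form A \<xi> \<longleftrightarrow> (\<forall>c\<in>A. \<forall>x\<in>chart_img c. \<forall>m k.
     dir_deriv (axis m 1) (\<lambda>x. one_form_in A c \<xi> x (axis k 1)) x = dir_deriv (axis k 1) (\<lambda>x. one_form_in A c \<xi> x (axis m 1)) x)"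
  (is "_ \<longleftrightarrow> ?R")
proof
  assume cl: "closed_one_form A \<xi>"
  show ?R
  proof (intro ballI allI)
    fix c x and m k :: 'n assume "c \<in> A" "x \<in> chart_img c"
    then have "ext_deriv (one_form_in A c \<xi>) x (axis m 1) (axis k 1) = 0"
      using cl by (simp add: closed_one_form_def)
    then show "dir_deriv (axis m 1) (\<lambda>x. one_form_in A c \<xi> x (axis k 1)) x = dir_deriv (axis k 1) (\<lambda>x. one_form_in A c \<xi> x (axis m 1)) x"
      by (simp add: ext_deriv_def dir_deriv_def)
  qed
qed (simp add: closed_one_form_def ext_deriv_coords)

text \<open>
  The weak isotropy of the flag curvature, rescaled from unit vectors to all nonzero ones and with the constant
  \<open>3/(n^2 - 1)\<close> split into \<open>3/(n + 1)\<close> and \<open>1/(n - 1)\<close>.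
\<close>

lemma flag_with_iff:
  assumes "smooth_function A f"
  shows "isotropic_flag_with M A F K f \<sigma> \<longleftrightarrow> (\<forall>c\<in>A. \<forall>x\<in>chart_img c. \<forall>y. y \<noteq> 0 \<longrightarrow>
    scalar_curved_chart.flag_defect (in_tchart A c F) (in_tchart A c K)
      (\<lambda>x. 1 / (real CARD('n) - 1) * in_chart c f x) (x, y) = in_chart c \<sigma> x)" (is "_ \<longleftrightarrow> ?R")
proof -
  have const: "3 / (real CARD('n) + 1) * (1 / (real CARD('n) - 1) * r) = 3 / ((real CARD('n))\<^sup>2 - 1) * r" for r
    using dim by (simp add: power2_eq_square algebra_simps)
  have pt: "K p v = 3 / ((real CARD('n))\<^sup>2 - 1) * pullback_form (differential (in_chart c f)) (tcoords c p v) (reeb (in_tchart A c F) (tcoords c p v)) + \<sigma> p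
     \<longleftrightarrow> scalar_curved_chart.flag_defect (in_tchart A c F) (in_tchart A c K)
      (\<lambda>x. 1 / (real CARD('n) - 1) * in_chart c f x) (snd c p, v c) = in_chart c \<sigma> (snd c p)"
    if pv: "(p, v) \<in> sphere_bundle M A F" "c \<in> A" "p \<in> fst c" for p v c
  proof -
    interpret isotropic_S_chart "chart_img c" "in_tchart A c F" "in_tchart A c K"
      "\<lambda>x. ln (in_chart c (\<mu> c) x)" "\<lambda>x. 1 / (real CARD('n) - 1) * in_chart c b x"
      "\<lambda>i x. one_form_in A c \<xi> x (axis i 1)"
      using pv(2) by (rule isotropic_S_chart)
    note sc = sphere_coords[OF pv]
    have f: "in_chart c f differentiable (at (snd c p))"
      using assms pv(2) sc(3) smooth_on_differentiable by (auto simp: smooth_function_def)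
    have z: "(snd c p, v c) \<in> slit" using sc by simp
    have "pullback_form (differential (in_chart c f)) (tcoords c p v) (reeb (in_tchart A c F) (tcoords c p v)) = dir_deriv (v c) (in_chart c f) (snd c p)"
      using sc(1) by (simp add: tcoords_def pullback_form_def differential_def dir_deriv_def reeb_eq[OF z] spray_vec_def)
    moreover have "flag_defect (\<lambda>x. 1 / (real CARD('n) - 1) * in_chart c f x) (snd c p, v c)
      = K p v - 3 / ((real CARD('n))\<^sup>2 - 1) * dir_deriv (v c) (in_chart c f) (snd c p)"
      unfolding const[symmetric] using sc(1) in_tchart_eq[OF pv(2,3) sc(4)]
      by (simp only: flag_defect_def dir_deriv_cmult[OF f] fst_conv snd_conv div_by_1)
    moreover have "in_chart c \<sigma> (snd c p) = \<sigma> p" using pv by (simp add: in_chart_def chart_inv_left)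
    ultimately show ?thesis by (simp only: diff_eq_eq add.commute)
  qed
  show ?thesis
  proof
    assume L: "isotropic_flag_with M A F K f \<sigma>"
    show ?R
    proof (intro ballI allI impI)
      fix c x y assume c: "c \<in> A" and x: "x \<in> chart_img c" and y: "y \<noteq> (0::real^'n)"
      interpret isotropic_S_chart "chart_img c" "in_tchart A c F" "in_tchart A c K"
        "\<lambda>x. ln (in_chart c (\<mu> c) x)" "\<lambda>x. 1 / (real CARD('n) - 1) * in_chart c b x"
        "\<lambda>i x. one_form_in A c \<xi> x (axis i 1)"
        using c by (rule isotropic_S_chart)
      let ?F = "in_tchart A c F" and ?h = "\<lambda>x. 1 / (real CARD('n) - 1) * in_chart c f x"
      have h: "smooth_on (chart_img c) ?h"
        using assms c by (intro smooth_on_mult open_U smooth_on_const) (simp add: smooth_function_def)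
      let ?t = "1 / ?F (x, y)" let ?y = "?t *\<^sub>R y"
      have z: "(x, y) \<in> slit" using x y by simp
      have t: "?t > 0" using F_pos[OF z] by simp
      have F1: "?F (x, ?y) = 1" using F_scale[OF x t] F_pos[OF z] by simp
      let ?p = "chart_inv c x" and ?v = "tvec_of A c (chart_inv c x) ?y"
      have p: "?p \<in> fst c" "snd c ?p = x" using chart_inv_right[OF x] by blast+
      have vc: "?v c = ?y" by (rule tvec_of_coord[OF c p(1)])
      have "(?p, ?v) \<in> sphere_bundle M A F" by (rule sphere_of_coords[OF c x F1])
      with L pt[OF this c p(1)] c p(1) have "flag_defect ?h (snd c ?p, ?v c) = in_chart c \<sigma> (snd c ?p)"
        unfolding isotropic_flag_with_def Let_def by fastforce
      then have "flag_defect ?h (x, ?y) = in_chart c \<sigma> x" by (simp only: p vc)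
      moreover have "flag_defect ?h (x, ?y) = flag_defect ?h (x, y)"
        using homogD[OF homog_\<kappa> z t] F_scale[OF x t] t
          linear_scale[OF linear_dir_deriv[OF smooth_on_differentiable[OF h x]], of ?t y]
        by (simp add: flag_defect_def)
      ultimately show "flag_defect ?h (x, y) = in_chart c \<sigma> x" by simp
    qed
  next
    assume R: ?R
    show "isotropic_flag_with M A F K f \<sigma>"
      unfolding isotropic_flag_with_def Let_def
      using pt R sphere_coords by (fastforce)
  qed
qed

text \<open>
  In each chart the flag defect \<open>\<Phi>\<close> of \<open>b/(n - 1)\<close> depends on \<open>x\<close> alone. It is a well-defined function on the
  manifold, because on a fixed tangent vector neither \<open>K\<close>, nor \<open>F\<close>, nor \<open>db\<close> depends on the chart.
\<close>

lemma closed_imp_weakly_isotropic_flag: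
  assumes "closed_one_form A \<xi>"
  shows "weakly_isotropic_flag M A F K"
proof -
  define \<Phi> where "\<Phi> c x y = scalar_curved_chart.flag_defect (in_tchart A c F) (in_tchart A c K)
      (\<lambda>x. 1 / (real CARD('n) - 1) * in_chart c b x) (x, y)" for c x y
  have const: "\<Phi> c x y = \<Phi> c x y'" if "c \<in> A" "x \<in> chart_img c" "y \<noteq> 0" "y' \<noteq> 0" for c x y y'
  proof -
    interpret isotropic_S_chart "chart_img c" "in_tchart A c F" "in_tchart A c K"
      "\<lambda>x. ln (in_chart c (\<mu> c) x)" "\<lambda>x. 1 / (real CARD('n) - 1) * in_chart c b x"
      "\<lambda>i x. one_form_in A c \<xi> x (axis i 1)"
      using that(1) by (rule isotropic_S_chart)
    show ?thesis unfolding \<Phi>_def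
      using assms that by (intro flag_defect_constant) (auto simp: closed_iff)
  qed
  have indep: "\<Phi> c (snd c p) (v c) = \<Phi> d (snd d p) (v d)"
    if "c \<in> A" "d \<in> A" "p \<in> fst c" "p \<in> fst d" and v: "v \<in> tangent_space A p" for c d p v
  proof -
    interpret C: isotropic_S_chart "chart_img c" "in_tchart A c F" "in_tchart A c K"
      "\<lambda>x. ln (in_chart c (\<mu> c) x)" "\<lambda>x. 1 / (real CARD('n) - 1) * in_chart c b x"
      "\<lambda>i x. one_form_in A c \<xi> x (axis i 1)"
      using that(1) by (rule isotropic_S_chart)
    interpret D: isotropic_S_chart "chart_img d" "in_tchart A d F" "in_tchart A d K"
      "\<lambda>x. ln (in_chart d (\<mu> d) x)" "\<lambda>x. 1 / (real CARD('n) - 1) * in_chart d b x"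
      "\<lambda>i x. one_form_in A d \<xi> x (axis i 1)"
      using that(2) by (rule isotropic_S_chart)
    have bd: "in_chart e b differentiable (at (snd e p))" if "e \<in> A" "p \<in> fst e" for e
    proof -
      have "smooth_on (chart_img e) (in_chart e b)"
        using smooth_b that(1) unfolding smooth_function_def by blast
      then show ?thesis by (rule smooth_on_differentiable[OF _ chart_img_mem[OF that(2)]])
    qed
    have "(in_chart c b has_derivative (\<lambda>u. dir_deriv u (in_chart d b) (snd d p)) \<circ> transition_deriv c d p) (at (snd c p))"
      using that by (intro change_of_chart has_derivative_dir_deriv bd)
    then have "dir_deriv (v c) (in_chart c b) (snd c p) = dir_deriv (v d) (in_chart d b) (snd d p)"
      using tangent_transition[OF that] by (simp add: dir_deriv_eqI)
    then show ?thesis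
      using that by (simp only: \<Phi>_def C.flag_defect_def D.flag_defect_def fst_conv snd_conv dir_deriv_cmult[OF bd] in_tchart_eq[OF _ _ v])
  qed
  \<comment> \<open>any chart and any nonzero vector give the same value\<close>
  define \<sigma> where "\<sigma> p = (let c = (SOME c. c \<in> A \<and> p \<in> fst c) in \<Phi> c (snd c p) (axis undefined 1))" for p
  have \<sigma>: "in_chart c \<sigma> x = \<Phi> c x y" if c: "c \<in> A" and x: "x \<in> chart_img c" and y: "y \<noteq> 0" for c x y
  proof -
    let ?p = "chart_inv c x"
    have p: "?p \<in> fst c" "snd c ?p = x" using chart_inv_right[OF x] by blast+
    define d where "d = (SOME d. d \<in> A \<and> ?p \<in> fst d)"
    have d: "d \<in> A \<and> ?p \<in> fst d" unfolding d_def by (rule someI[of _ c]) (use c p in simp)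
    let ?v = "tvec_of A c ?p y"
    have vT: "?v \<in> tangent_space A ?p" and vc: "?v c = y"
      using tvec_of_tangent[OF c p(1)] tvec_of_coord[OF c p(1)] by auto
    have vd: "?v d \<noteq> 0" using tangent_zero[OF _ _ vT, of d] d vc y by auto
    have "\<sigma> ?p = \<Phi> d (snd d ?p) (axis undefined 1)" by (simp add: \<sigma>_def d_def Let_def)
    also have "\<dots> = \<Phi> d (snd d ?p) (?v d)"
      using d vd by (intro const) (auto simp: chart_img_mem axis_eq_0_iff)
    also have "\<dots> = \<Phi> c (snd c ?p) (?v c)" using indep[OF _ c _ p(1) vT, of d] d by simp
    finally show ?thesis by (simp add: in_chart_def p vc)
  qed
  have "smooth_function A \<sigma>" unfolding smooth_function_def
  proof
    fix c assume c: "c \<in> A"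
    interpret isotropic_S_chart "chart_img c" "in_tchart A c F" "in_tchart A c K"
      "\<lambda>x. ln (in_chart c (\<mu> c) x)" "\<lambda>x. 1 / (real CARD('n) - 1) * in_chart c b x"
      "\<lambda>i x. one_form_in A c \<xi> x (axis i 1)"
      using c by (rule isotropic_S_chart)
    let ?y = "axis undefined 1 :: real^'n" and ?h = "\<lambda>x. 1 / (real CARD('n) - 1) * in_chart c b x"
    have y: "?y \<noteq> 0" by (simp add: axis_eq_0_iff)
    have L: "bounded_linear (\<lambda>x::real^'n. (x, 0::real^'n))"
      by (intro bounded_linear_Pair bounded_linear_zero bounded_linear_ident)
    have "smooth_on (chart_img c) (\<lambda>x. flag_defect ?h ((0, ?y) + (x, 0)))"
      by (rule smooth_on_compose_affine[OF smooth_flag_defect[OF \<beta>] open_U L]) (use y in simp)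
    then show "smooth_on (chart_img c) (in_chart c \<sigma>)"
      by (rule smooth_on_cong[OF open_U, rotated]) (use \<sigma>[OF c _ y] in \<open>simp add: \<Phi>_def\<close>)
  qed
  moreover have "isotropic_flag_with M A F K b \<sigma>"
    unfolding flag_with_iff[OF smooth_b] using \<sigma> by (simp add: \<Phi>_def)
  ultimately show ?thesis unfolding weakly_isotropic_flag_def using smooth_b by blast
qed

text \<open>
  In every chart \<open>d f = d b\<close>, and \<open>b\<close> is the Berwald scalar curvature.
\<close>

lemma flag_with_imp:
  assumes f: "smooth_function A f" and flag: "isotropic_flag_with M A F K f \<sigma>"
  shows "closed_one_form A \<xi>" "berwald_scalar_up_to_const M A F f"
proof -
  have *: "dir_deriv v (in_chart c b) x = dir_deriv v (in_chart c f) x \<and>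
      dir_deriv (axis m 1) (\<lambda>x. one_form_in A c \<xi> x (axis k 1)) x = dir_deriv (axis k 1) (\<lambda>x. one_form_in A c \<xi> x (axis m 1)) x"
    if c: "c \<in> A" and x: "x \<in> chart_img c" for c x v m k
  proof -
    interpret isotropic_S_chart "chart_img c" "in_tchart A c F" "in_tchart A c K"
      "\<lambda>x. ln (in_chart c (\<mu> c) x)" "\<lambda>x. 1 / (real CARD('n) - 1) * in_chart c b x"
      "\<lambda>i x. one_form_in A c \<xi> x (axis i 1)"
      using c by (rule isotropic_S_chart)
    let ?h = "\<lambda>x. 1 / (real CARD('n) - 1) * in_chart c f x"
    have sf: "smooth_on (chart_img c) (in_chart c f)" "smooth_on (chart_img c) (in_chart c b)"
      using f smooth_b c by (auto simp: smooth_function_def)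
    have h: "smooth_on (chart_img c) ?h" by (intro smooth_on_mult open_U smooth_on_const sf)
    have "\<And>y. y \<noteq> 0 \<Longrightarrow> flag_defect ?h (x, y) = in_chart c \<sigma> x"
      using flag c x unfolding flag_with_iff[OF f] by blast
    note conv = flag_defect_constant_converse[OF h x this]
    have "1 / (real CARD('n) - 1) * dir_deriv v (in_chart c b) x = 1 / (real CARD('n) - 1) * dir_deriv v (in_chart c f) x"
      by (rule conv(1)[of v, unfolded dir_deriv_cmult[OF smooth_on_differentiable[OF sf(1) x]]
            dir_deriv_cmult[OF smooth_on_differentiable[OF sf(2) x]]])
    then have "dir_deriv v (in_chart c b) x = dir_deriv v (in_chart c f) x" using dim by simp
    then show ?thesis using conv(2) by blast
  qed
  show "closed_one_form A \<xi>" unfolding closed_iff using * by blast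
  have d: "(in_chart c (\<lambda>p. f p - b p) has_derivative (\<lambda>_. 0)) (at x)" if c: "c \<in> A" and x: "x \<in> chart_img c" for c x
  proof -
    have "in_chart c (\<lambda>p. f p - b p) = (\<lambda>x. in_chart c f x - in_chart c b x)" by (auto simp: in_chart_def)
    moreover have "((\<lambda>x. in_chart c f x - in_chart c b x) has_derivative (\<lambda>v. dir_deriv v (in_chart c f) x - dir_deriv v (in_chart c b) x)) (at x)"
      using f smooth_b c x by (intro has_derivative_diff has_derivative_dir_deriv smooth_on_differentiable[OF _ x]) (auto simp: smooth_function_def)
    ultimately show ?thesis using *[OF c x] by simp
  qed
  show "berwald_scalar_up_to_const M A F f"
    unfolding berwald_scalar_up_to_const_def
  proof
    fix C assume C: "C \<in> connected_components_of M"
    then obtain q where q: "q \<in> C" using nonempty_connected_components_of by blast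
    show "\<exists>r. \<forall>(p, v)\<in>sphere_bundle M A F. p \<in> C \<longrightarrow>
       (\<forall>c\<in>A. p \<in> fst c \<longrightarrow> f p - berwald_scalar (in_tchart A c F) (tcoords c p v) = r)"
    proof (intro exI[of _ "f q - b q"] ballI, clarify)
      fix p v c0 S assume "(p, v) \<in> sphere_bundle M A F" "p \<in> C" "(c0, S) \<in> A" "p \<in> fst (c0, S)"
      then show "f p - berwald_scalar (in_tchart A (c0, S) F) (tcoords (c0, S) p v) = f q - b q"
        using locally_constant_on_components[OF d C, of p q] q berwald_scalar_sphere by simp
    qed
  qed
qed

end

theorem corollary3:
  fixes M :: "'a topology"
    and A :: "('a, 'n::finite) chart set"
    and F K :: "'a \<Rightarrow> ('a, 'n) tvec \<Rightarrow> real"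
    and \<mu> :: "('a, 'n) chart \<Rightarrow> 'a \<Rightarrow> real"
  assumes "CARD('n) \<ge> 2"
    and "smooth_manifold M A"
    and "finsler_metric M A F"
    and "positive_density A \<mu>"
    and "scalar_flag_curvature M A F K"
    and "weakly_isotropic_S M A F \<mu>"
  shows "(almost_isotropic_S M A F \<mu> \<longleftrightarrow> weakly_isotropic_flag M A F K) \<and>
    (\<forall>f \<sigma>. smooth_function A f \<and> smooth_function A \<sigma> \<and> isotropic_flag_with M A F K f \<sigma> \<longrightarrow>
       berwald_scalar_up_to_const M A F f)"
proof -
  have loc: "isotropic_finsler_manifold M A F K \<mu> b \<xi>"
    if "smooth_function A b" "smooth_one_form A \<xi>" "isotropic_S_with M A F \<mu> b \<xi>" for b \<xi>
    using assms that by unfold_locales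
  obtain b \<xi> where b\<xi>: "smooth_function A b" "smooth_one_form A \<xi>" "isotropic_S_with M A F \<mu> b \<xi>"
    using assms(6) unfolding weakly_isotropic_S_def by blast
  interpret isotropic_finsler_manifold M A F K \<mu> b \<xi> using b\<xi> by (rule loc)
  have "weakly_isotropic_flag M A F K" if "almost_isotropic_S M A F \<mu>"
    using that isotropic_finsler_manifold.closed_imp_weakly_isotropic_flag[OF loc]
    unfolding almost_isotropic_S_def by blast
  moreover have "almost_isotropic_S M A F \<mu>" if "weakly_isotropic_flag M A F K"
    using that flag_with_imp(1) b\<xi> unfolding almost_isotropic_S_def weakly_isotropic_flag_def by blast
  ultimately show ?thesis using flag_with_imp(2) by blast
qed

end
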